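(* Let $\hat g$, $n$, $p\in\{0,1,\dots,n\}$ satisfy: $p\neq 1$ if $\hat g=A_{2n-1}^{(2)}$; $n>1$ and $p\ne 1$ if $\hat g=B_n^{(1)}$; $n>1$ and $p\neq 1,n-1$ if $\hat g=D_n^{(1)}$; no restriction if $\hat g=A_{2n}^{(2)}$ or $C_n^{(1)}$. Let $(g^{(l)},g^{(r)})$ be the pair $$A_{2n}^{(2)}:(B_{n-p},C_p),\quad A_{2n-1}^{(2)}:(C_{n-p},D_p),\quad B_n^{(1)}:(B_{n-p},D_p),\quad C_n^{(1)}:(C_{n-p},C_p),\quad D_n^{(1)}:(D_{n-p},D_p).$$ Then for every $N\ge 1$ the open-chain transfer matrix $t(u,p)$ is invariant under the quantum group $U_q(g^{(l)})\otimes U_q(g^{(r)})$; that is, $$[\Delta_{(N)}(H^{(l)}_i),t(u,p)]=[\Delta_{(N)}(E^{\pm(l)}_i),t(u,p)]=0\quad (1\le i\le n-p),$$ $$[\Delta_{(N)}(H^{(r)}_i),t(u,p)]=[\Delta_{(N)}(E^{\pm(r)}_i),t(u,p)]=0\quad (1\le i\le p).$$ (The left factor is absent for $p=n$ and the right factor is absent for $p=0$.)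
   Context: **R-matrix.** Fix $n\ge 1$, $\eta\in\mathbb C$ and a type $\hat g\in\{A_{2n}^{(2)},A_{2n-1}^{(2)},B_n^{(1)},C_n^{(1)},D_n^{(1)}\}$. Set $d=2n+1$ for $A_{2n}^{(2)},B_n^{(1)}$ and $d=2n$ for $A_{2n-1}^{(2)},C_n^{(1)},D_n^{(1)}$; $\mathcal V=\mathbb C^d$; $e_{ij}$ the elementary $d\times d$ matrices; $\mathbb I$ the identity on $\mathcal V$; $\mathcal P=\sum_{i,j}e_{ij}\otimes e_{ji}$. Let $\kappa=2n+1,\,2n,\,2n-1,\,2n+2,\,2n-2$ for $A_{2n}^{(2)},A_{2n-1}^{(2)},B_n^{(1)},C_n^{(1)},D_n^{(1)}$ respectively. Let $h=\cosh$, $\sigma=-1$ for $A_{2n}^{(2)},A_{2n-1}^{(2)}$ and $h=\sinh$, $\sigma=+1$ for $B_n^{(1)},C_n^{(1)},D_n^{(1)}$. For $1\le\alpha\le d$ put $\alpha'=d+1-\alpha$. For $A_{2n-1}^{(2)},C_n^{(1)}$: $\epsilon_\alpha=1$, $\bar\alpha=\alpha-\frac12$ if $\alpha\le n$, and $\epsilon_\alpha=-1$, $\bar\alpha=\alpha+\frac12$ if $\alpha\ge n+1$. For $A_{2n}^{(2)},B_n^{(1)},D_n^{(1)}$: $\epsilon_\alpha=1$ and $\bar\alpha=\alpha+\frac12,\ \alpha,\ \alpha-\frac12$ according as $\alpha<\frac{d+1}2$, $\alpha=\frac{d+1}{2}$, $\alpha>\frac{d+1}2$. Let $$c(u)=2\sinh(\tfrac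 u2-2\eta)h(\tfrac u2-\kappa\eta),\ b(u)=2\sinh(\tfrac u2)h(\tfrac u2-\kappa\eta),\ e(u)=-2e^{-u/2}\sinh(2\eta)h(\tfrac u2-\kappa\eta),\ \bar e(u)=e^ue(u),$$ and $a_{\alpha\beta}(u)$ equal to: $2\sinh(\frac u2)h(\frac u2-(\kappa-2)\eta)$ if $\alpha=\beta\ne\alpha'$; if $\alpha=\beta=\alpha'$, $b(u)+2\sinh(2\eta)\sinh((2n-1)\eta)$ for $B_n^{(1)}$ and $b(u)-2\sinh(2\eta)\cosh((2n+1)\eta)$ for $A_{2n}^{(2)}$; $2\sinh(2\eta)e^{-u/2}[\sigma\epsilon_\alpha\epsilon_\beta e^{(\kappa+2(\bar\alpha-\bar\beta))\eta}\sinh(\frac u2)-\delta_{\alpha\beta'}h(\frac u2-\kappa\eta)]$ if $\alpha<\beta$; $2\sinh(2\eta)e^{u/2}[\epsilon_\alpha\epsilon_\beta e^{(-\kappa+2(\bar\alpha-\bar\beta))\eta}\sinh(\frac u2)-\delta_{\alpha\beta'}h(\frac u2-\kappa\eta)]$ if $\alpha>\beta$. Then $$R(u)=c(u)\sum_{\alpha\ne\alpha'}e_{\alpha\alpha}\otimes e_{\alpha\alpha}+b(u)\sum_{\alpha\neq\beta,\beta'}e_{\alpha\alpha}\otimes e_{\beta\beta}+\Big(e(u)\sum_{\alpha<\beta,\alpha\ne\beta'}+\bar e(u)\sum_{\alpha>\beta,\alpha\ne\beta'}\Big)e_{\alpha\beta}\otimes e_{\beta\alpha}+\sum_{\alpha,\beta}a_{\alpha\beta}(u)e_{\alpha\beta}\otimes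 e_{\alpha'\beta'}.$$ Subscripts on operators indicate the tensor factors on which they act ($R_{21}=\mathcal P R_{12}\mathcal P$, etc.). **K-matrices.** $\rho=-2\kappa\eta-i\pi$ for $A_{2n}^{(2)},A_{2n-1}^{(2)}$, $\rho=-2\kappa\eta$ for $B_n^{(1)},C_n^{(1)},D_n^{(1)}$. Fix $\gamma_0\in\{1,-1\}$; $\gamma=\gamma_0e^{(4p-2)\eta+\rho/2}$ for $A_{2n-1}^{(2)},B_n^{(1)},D_n^{(1)}$ and $\gamma=\gamma_0e^{(4p+2)\eta+\rho/2}$ for $A_{2n}^{(2)},C_n^{(1)}$. $K^R(u,p)$ is the diagonal matrix whose first $p$ entries are $e^{-u}$, middle $d-2p$ entries are $\frac{\gamma e^u+1}{\gamma+e^u}$, last $p$ entries are $e^u$. $M=\varsigma\sum_\alpha e^{4(\frac{d+1}2-\bar\alpha)\eta}e_{\alpha\alpha}$ with $\varsigma=-1$ for $A_{2n-1}^{(2)},C_n^{(1)}$ and $\varsigma=1$ otherwise; $K^L(u,p)=K^R(-u-\rho,p)M$. Identities in $u$ are understood as identities of meromorphic functions. **Transfer matrix** (on the quantum space $\mathcal V^{\otimes N}$, $a$ an auxiliary copy of $\mathcal V$): $t(u,p)=\operatorname{tr}_aK^L_a(u,p)T_a(u)K^R_a(u,p)\widehat T_a(u)$, $T_a(u)=R_{aN}(u)\cdots R_{a1}(u)$, $\widehat T_a(u)=R_{1a}(u)\cdots R_{Na}(u)$. **Generators** ($d\times d$ matrices). $H_i=e_{i,i}-e_{d+1-i,d+1-i}$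 ($1\le i\le n$); $E_i^+=e_{i,i+1}+e_{d-i,d+1-i}$ ($1\le i\le n-1$); $E_n^+=e_{n,n+1}+e_{d-n,d+1-n}$ for $A_{2n}^{(2)},B_n^{(1)}$, $\sqrt2\,e_{n,n+1}$ for $A_{2n-1}^{(2)},C_n^{(1)}$, $e_{n-1,n+1}+e_{n,n+2}$ for $D_n^{(1)}$; $E_0^+=\sqrt2\,e_{d,1}$ for $A_{2n}^{(2)},C_n^{(1)}$, $e_{d-1,1}+e_{d,2}$ for $A_{2n-1}^{(2)},B_n^{(1)},D_n^{(1)}$; $E_i^-=(E_i^+)^t$. Left generators: $H_i^{(l)}=H_{p+i}$, $E_i^{\pm(l)}=E^\pm_{p+i}$ ($1\le i\le n-p$). Right generators: $H^{(r)}_i=-H_{p+1-i}$, $E^{\pm(r)}_i=E^\pm_{p-i}$ ($1\le i\le p$). **Coproducts.** $\Delta(H)=H\otimes\mathbb I+\mathbb I\otimes H$ for each $H=H_j^{(l)},H_j^{(r)}$, and $\Delta(E)=E\otimes Q+Q^{-1}\otimes E$ for $E=E_j^{\pm(l)},E_j^{\pm(r)}$, where $Q$ (depending on the generator) is: for $E_j^{\pm(l)}$, $j\le n-p-1$: $e^{(\eta+i\pi)H_j^{(l)}-\eta H_{j+1}^{(l)}}$; for $E_{n-p}^{\pm(l)}$: $e^{(\eta+i\pi)H^{(l)}_{n-p}}$ if $g^{(l)}=B_{n-p}$, $e^{2\eta H^{(l)}_{n-p}}$ if $g^{(l)}=C_{n-p}$, $e^{\eta H^{(l)}_{n-p-1}+(\eta+i\pi)H^{(l)}_{n-p}}$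 if $g^{(l)}=D_{n-p}$; for $E_j^{\pm(r)}$, $j\le p-1$: $e^{(\eta+i\pi)H_j^{(r)}-\eta H_{j+1}^{(r)}}$; for $E_p^{\pm(r)}$: $e^{2\eta H_p^{(r)}}$ if $g^{(r)}=C_p$, $e^{(\eta+i\pi)H^{(r)}_{p-1}+\eta H_p^{(r)}}$ if $g^{(r)}=D_p$. The $N$-fold coproducts on $\mathcal V^{\otimes N}$ (sites $1,\dots,N$ from left to right) are $\Delta_{(N)}(H)=\sum_{k=1}^N\mathbb I^{\otimes(k-1)}\otimes H\otimes\mathbb I^{\otimes(N-k)}$ and $\Delta_{(N)}(E)=\sum_{k=1}^N(Q^{-1})^{\otimes(k-1)}\otimes E\otimes Q^{\otimes(N-k)}$. *)

theory Defs
  imports Complex_Main "Jordan_Normal_Form.Gauss_Jordan_Elimination"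
begin

section \<open>Tensor products and embeddings of matrices\<close>

text \<open>
  The space \<open>V\<^sup>\<otimes>\<^sup>L\<close> with \<open>V = \<complex>\<^sup>d\<close> is identified with \<open>\<complex>\<^sup>(d^L)\<close>: the basis vector
  \<open>v\<^sub>0 \<otimes> \<dots> \<otimes> v\<^sub>L\<^sub>-\<^sub>1\<close> has as its (0-based) index the number with base-\<open>d\<close> digits
  \<open>v\<^sub>0, \<dots>, v\<^sub>L\<^sub>-\<^sub>1\<close>, most significant digit (= leftmost tensor factor) first.
\<close>

definition kron :: "complex mat \<Rightarrow> complex mat \<Rightarrow> complex mat" (infixr \<open>\<otimes>\<^sub>m\<close> 72) where
  "A \<otimes>\<^sub>m B = mat (dim_row A * dim_row B) (dim_col A * dim_col B)
     (\<lambda>(i, j). A $$ (i div dim_row B, j div dim_col B) * B $$ (i mod dim_row B, j mod dim_col B))"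

definition kron_list :: "complex mat list \<Rightarrow> complex mat" where
  "kron_list As = foldr (\<otimes>\<^sub>m) As (1\<^sub>m 1)"

definition mat_sum :: "nat \<Rightarrow> ('a \<Rightarrow> complex mat) \<Rightarrow> 'a set \<Rightarrow> complex mat" where
  "mat_sum m f S = mat m m (\<lambda>ij. \<Sum>s\<in>S. f s $$ ij)"

definition mat_prod :: "nat \<Rightarrow> complex mat list \<Rightarrow> complex mat" where
  "mat_prod m As = foldr (*) As (1\<^sub>m m)"

definition mat_exp :: "complex mat \<Rightarrow> complex mat" where
  "mat_exp A = mat (dim_row A) (dim_row A) (\<lambda>ij. \<Sum>k. (A ^\<^sub>m k) $$ ij / fact k)"

definition mat_inv :: "complex mat \<Rightarrow> complex mat" where
  "mat_inv A = the (mat_inverse A)"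

definition commutator :: "complex mat \<Rightarrow> complex mat \<Rightarrow> complex mat" where
  "commutator A B = A * B - B * A"

definition tensor_digit :: "nat \<Rightarrow> nat \<Rightarrow> nat \<Rightarrow> nat \<Rightarrow> nat" where
  "tensor_digit d L k x = (x div d ^ (L - 1 - k)) mod d"

text \<open>The operator \<open>X\<^sub>i\<^sub>j\<close> on \<open>V\<^sup>\<otimes>\<^sup>L\<close> (factors numbered from 0, \<open>i \<noteq> j\<close>): the first tensor leg of
  \<open>X\<close> acts on factor \<open>i\<close>, the second one on factor \<open>j\<close>; \<open>i > j\<close> is allowed.\<close>

definition act_on :: "nat \<Rightarrow> nat \<Rightarrow> complex mat \<Rightarrow> nat \<Rightarrow> nat \<Rightarrow> complex mat" where
  "act_on d L X i j = mat (d ^ L) (d ^ L) (\<lambda>(x, y).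
     if \<forall>k<L. k \<noteq> i \<and> k \<noteq> j \<longrightarrow> tensor_digit d L k x = tensor_digit d L k y
     then X $$ (tensor_digit d L i x * d + tensor_digit d L j x,
                tensor_digit d L i y * d + tensor_digit d L j y)
     else 0)"

text \<open>Partial trace over the leftmost factor of \<open>\<complex>\<^sup>d \<otimes> \<complex>\<^sup>m\<close>.\<close>

definition partial_trace :: "nat \<Rightarrow> nat \<Rightarrow> complex mat \<Rightarrow> complex mat" where
  "partial_trace d m A = mat m m (\<lambda>(x, y). \<Sum>\<alpha><d. A $$ (\<alpha> * m + x, \<alpha> * m + y))"

text \<open>Elementary matrices \<open>e\<^sub>i\<^sub>j\<close> with 1-based indices.\<close>

definition elem_mat :: "nat \<Rightarrow> nat \<Rightarrow> nat \<Rightarrow> complex mat" where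
  "elem_mat d i j = mat d d (\<lambda>(r, s). if Suc r = i \<and> Suc s = j then 1 else 0)"


section \<open>The R-matrix\<close>

text \<open>\<open>A2_even, A2_odd, B1, C1, D1\<close> stand for
  \<open>A\<^sub>2\<^sub>n\<^sup>(\<^sup>2\<^sup>), A\<^sub>2\<^sub>n\<^sub>-\<^sub>1\<^sup>(\<^sup>2\<^sup>), B\<^sub>n\<^sup>(\<^sup>1\<^sup>), C\<^sub>n\<^sup>(\<^sup>1\<^sup>), D\<^sub>n\<^sup>(\<^sup>1\<^sup>)\<close>.\<close>

datatype affine_type = A2_even | A2_odd | B1 | C1 | D1

definition dimV :: "affine_type \<Rightarrow> nat \<Rightarrow> nat" where
  "dimV t n = (if t \<in> {A2_even, B1} then 2 * n + 1 else 2 * n)"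

fun kappa :: "affine_type \<Rightarrow> nat \<Rightarrow> complex" where
  "kappa A2_even n = 2 * of_nat n + 1"
| "kappa A2_odd n = 2 * of_nat n"
| "kappa B1 n = 2 * of_nat n - 1"
| "kappa C1 n = 2 * of_nat n + 2"
| "kappa D1 n = 2 * of_nat n - 2"

definition hfun :: "affine_type \<Rightarrow> complex \<Rightarrow> complex" where
  "hfun t = (if t \<in> {A2_even, A2_odd} then cosh else sinh)"

definition sigma :: "affine_type \<Rightarrow> complex" where
  "sigma t = (if t \<in> {A2_even, A2_odd} then - 1 else 1)"

definition dual_index :: "affine_type \<Rightarrow> nat \<Rightarrow> nat \<Rightarrow> nat" where
  "dual_index t n \<alpha> = dimV t n + 1 - \<alpha>"

definition eps :: "affine_type \<Rightarrow> nat \<Rightarrow> nat \<Rightarrow> complex" where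
  "eps t n \<alpha> = (if t \<in> {A2_odd, C1} \<and> n + 1 \<le> \<alpha> then - 1 else 1)"

definition bar :: "affine_type \<Rightarrow> nat \<Rightarrow> nat \<Rightarrow> complex" where
  "bar t n \<alpha> =
     (if t \<in> {A2_odd, C1}
      then (if \<alpha> \<le> n then of_nat \<alpha> - 1/2 else of_nat \<alpha> + 1/2)
      else (if 2 * \<alpha> < dimV t n + 1 then of_nat \<alpha> + 1/2
            else if 2 * \<alpha> = dimV t n + 1 then of_nat \<alpha>
            else of_nat \<alpha> - 1/2))"

definition c_fun :: "affine_type \<Rightarrow> nat \<Rightarrow> complex \<Rightarrow> complex \<Rightarrow> complex" where
  "c_fun t n \<eta> u = 2 * sinh (u/2 - 2 * \<eta>) * hfun t (u/2 - kappa t n * \<eta>)"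

definition b_fun :: "affine_type \<Rightarrow> nat \<Rightarrow> complex \<Rightarrow> complex \<Rightarrow> complex" where
  "b_fun t n \<eta> u = 2 * sinh (u/2) * hfun t (u/2 - kappa t n * \<eta>)"

definition e_fun :: "affine_type \<Rightarrow> nat \<Rightarrow> complex \<Rightarrow> complex \<Rightarrow> complex" where
  "e_fun t n \<eta> u = - 2 * exp (- u/2) * sinh (2 * \<eta>) * hfun t (u/2 - kappa t n * \<eta>)"

definition ebar_fun :: "affine_type \<Rightarrow> nat \<Rightarrow> complex \<Rightarrow> complex \<Rightarrow> complex" where
  "ebar_fun t n \<eta> u = exp u * e_fun t n \<eta> u"

text \<open>The case \<open>\<alpha> = \<beta> = \<alpha>'\<close> needs \<open>d\<close> odd, so it only arises for \<open>B1\<close> and \<open>A2_even\<close>; the final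
  \<open>else\<close> of the second branch therefore concerns \<open>A2_even\<close> only.\<close>

definition a_fun :: "affine_type \<Rightarrow> nat \<Rightarrow> complex \<Rightarrow> complex \<Rightarrow> nat \<Rightarrow> nat \<Rightarrow> complex" where
  "a_fun t n \<eta> u \<alpha> \<beta> =
     (let h = hfun t; k = kappa t n;
          \<delta> = (if \<alpha> = dual_index t n \<beta> then 1 else 0 :: complex)
      in
      if \<alpha> = \<beta> \<and> \<alpha> \<noteq> dual_index t n \<alpha> then 2 * sinh (u/2) * h (u/2 - (k - 2) * \<eta>)
      else if \<alpha> = \<beta> then
        (if t = B1 then b_fun t n \<eta> u + 2 * sinh (2 * \<eta>) * sinh ((2 * of_nat n - 1) * \<eta>)
         else b_fun t n \<eta> u - 2 * sinh (2 * \<eta>) * cosh ((2 * of_nat n + 1) * \<eta>))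
      else if \<alpha> < \<beta> then
        2 * sinh (2 * \<eta>) * exp (- u/2) *
          (sigma t * eps t n \<alpha> * eps t n \<beta> * exp ((k + 2 * (bar t n \<alpha> - bar t n \<beta>)) * \<eta>) * sinh (u/2)
           - \<delta> * h (u/2 - k * \<eta>))
      else
        2 * sinh (2 * \<eta>) * exp (u/2) *
          (eps t n \<alpha> * eps t n \<beta> * exp ((- k + 2 * (bar t n \<alpha> - bar t n \<beta>)) * \<eta>) * sinh (u/2)
           - \<delta> * h (u/2 - k * \<eta>)))"

definition R_mat :: "affine_type \<Rightarrow> nat \<Rightarrow> complex \<Rightarrow> complex \<Rightarrow> complex mat" where
  "R_mat t n \<eta> u =
     (let d = dimV t n; I = {1..d}; E = elem_mat d; du = dual_index t n in
        c_fun t n \<eta> u \<cdot>\<^sub>m mat_sum (d * d) (\<lambda>\<alpha>. E \<alpha> \<alpha> \<otimes>\<^sub>m E \<alpha> \<alpha>) {\<alpha> \<in> I. \<alpha> \<noteq> du \<alpha>}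
      + b_fun t n \<eta> u \<cdot>\<^sub>m mat_sum (d * d) (\<lambda>(\<alpha>, \<beta>). E \<alpha> \<alpha> \<otimes>\<^sub>m E \<beta> \<beta>)
          {(\<alpha>, \<beta>) \<in> I \<times> I. \<alpha> \<noteq> \<beta> \<and> \<alpha> \<noteq> du \<beta>}
      + e_fun t n \<eta> u \<cdot>\<^sub>m mat_sum (d * d) (\<lambda>(\<alpha>, \<beta>). E \<alpha> \<beta> \<otimes>\<^sub>m E \<beta> \<alpha>)
          {(\<alpha>, \<beta>) \<in> I \<times> I. \<alpha> < \<beta> \<and> \<alpha> \<noteq> du \<beta>}
      + ebar_fun t n \<eta> u \<cdot>\<^sub>m mat_sum (d * d) (\<lambda>(\<alpha>, \<beta>). E \<alpha> \<beta> \<otimes>\<^sub>m E \<beta> \<alpha>)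
          {(\<alpha>, \<beta>) \<in> I \<times> I. \<alpha> > \<beta> \<and> \<alpha> \<noteq> du \<beta>}
      + mat_sum (d * d) (\<lambda>(\<alpha>, \<beta>). a_fun t n \<eta> u \<alpha> \<beta> \<cdot>\<^sub>m (E \<alpha> \<beta> \<otimes>\<^sub>m E (du \<alpha>) (du \<beta>))) (I \<times> I))"


section \<open>The K-matrices\<close>

definition rho :: "affine_type \<Rightarrow> nat \<Rightarrow> complex \<Rightarrow> complex" where
  "rho t n \<eta> = (if t \<in> {A2_even, A2_odd} then - 2 * kappa t n * \<eta> - \<i> * of_real pi
                else - 2 * kappa t n * \<eta>)"

definition gam :: "affine_type \<Rightarrow> nat \<Rightarrow> complex \<Rightarrow> complex \<Rightarrow> nat \<Rightarrow> complex" where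
  "gam t n \<eta> \<gamma>0 p =
     (if t \<in> {A2_odd, B1, D1} then \<gamma>0 * exp ((4 * of_nat p - 2) * \<eta> + rho t n \<eta> / 2)
      else \<gamma>0 * exp ((4 * of_nat p + 2) * \<eta> + rho t n \<eta> / 2))"

definition KR_mat :: "affine_type \<Rightarrow> nat \<Rightarrow> complex \<Rightarrow> complex \<Rightarrow> nat \<Rightarrow> complex \<Rightarrow> complex mat" where
  "KR_mat t n \<eta> \<gamma>0 p u = mat_diag (dimV t n)
     (\<lambda>i. if i < p then exp (- u)
          else if i < dimV t n - p then (gam t n \<eta> \<gamma>0 p * exp u + 1) / (gam t n \<eta> \<gamma>0 p + exp u)
          else exp u)"

definition M_mat :: "affine_type \<Rightarrow> nat \<Rightarrow> complex \<Rightarrow> complex mat" where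
  "M_mat t n \<eta> = mat_sum (dimV t n)
     (\<lambda>\<alpha>. ((if t \<in> {A2_odd, C1} then - 1 else 1)
            * exp (4 * ((of_nat (dimV t n) + 1) / 2 - bar t n \<alpha>) * \<eta>)) \<cdot>\<^sub>m elem_mat (dimV t n) \<alpha> \<alpha>)
     {1..dimV t n}"

definition KL_mat :: "affine_type \<Rightarrow> nat \<Rightarrow> complex \<Rightarrow> complex \<Rightarrow> nat \<Rightarrow> complex \<Rightarrow> complex mat" where
  "KL_mat t n \<eta> \<gamma>0 p u = KR_mat t n \<eta> \<gamma>0 p (- u - rho t n \<eta>) * M_mat t n \<eta>"


section \<open>The transfer matrix\<close>

text \<open>The auxiliary space \<open>a\<close> is factor 0 of \<open>V\<^sup>\<otimes>\<^sup>(\<^sup>N\<^sup>+\<^sup>1\<^sup>)\<close>, the sites are factors \<open>1, \<dots>, N\<close>.\<close>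

definition T_mat :: "affine_type \<Rightarrow> nat \<Rightarrow> complex \<Rightarrow> nat \<Rightarrow> complex \<Rightarrow> complex mat" where
  "T_mat t n \<eta> N u = mat_prod (dimV t n ^ (N + 1))
     (map (\<lambda>k. act_on (dimV t n) (N + 1) (R_mat t n \<eta> u) 0 k) (rev [1..<N + 1]))"

definition That_mat :: "affine_type \<Rightarrow> nat \<Rightarrow> complex \<Rightarrow> nat \<Rightarrow> complex \<Rightarrow> complex mat" where
  "That_mat t n \<eta> N u = mat_prod (dimV t n ^ (N + 1))
     (map (\<lambda>k. act_on (dimV t n) (N + 1) (R_mat t n \<eta> u) k 0) [1..<N + 1])"

definition transfer_mat ::
  "affine_type \<Rightarrow> nat \<Rightarrow> complex \<Rightarrow> complex \<Rightarrow> nat \<Rightarrow> nat \<Rightarrow> complex \<Rightarrow> complex mat" where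
  "transfer_mat t n \<eta> \<gamma>0 p N u =
     (let d = dimV t n in
      partial_trace d (d ^ N)
        ((KL_mat t n \<eta> \<gamma>0 p u \<otimes>\<^sub>m 1\<^sub>m (d ^ N)) * T_mat t n \<eta> N u
         * (KR_mat t n \<eta> \<gamma>0 p u \<otimes>\<^sub>m 1\<^sub>m (d ^ N)) * That_mat t n \<eta> N u))"


section \<open>Generators and coproducts\<close>

definition H_gen :: "affine_type \<Rightarrow> nat \<Rightarrow> nat \<Rightarrow> complex mat" where
  "H_gen t n i = (let d = dimV t n in elem_mat d i i - elem_mat d (d + 1 - i) (d + 1 - i))"

definition E_gen :: "affine_type \<Rightarrow> nat \<Rightarrow> nat \<Rightarrow> complex mat" where
  "E_gen t n i =
     (let d = dimV t n; E = elem_mat d in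
      if i = 0 then
        (if t \<in> {A2_even, C1} then of_real (sqrt 2) \<cdot>\<^sub>m E d 1
         else E (d - 1) 1 + E d 2)
      else if i < n then E i (i + 1) + E (d - i) (d + 1 - i)
      else
        (if t \<in> {A2_even, B1} then E n (n + 1) + E (d - n) (d + 1 - n)
         else if t \<in> {A2_odd, C1} then of_real (sqrt 2) \<cdot>\<^sub>m E n (n + 1)
         else E (n - 1) (n + 1) + E n (n + 2)))"

definition H_left :: "affine_type \<Rightarrow> nat \<Rightarrow> nat \<Rightarrow> nat \<Rightarrow> complex mat" where
  "H_left t n p i = H_gen t n (p + i)"

definition Eplus_left :: "affine_type \<Rightarrow> nat \<Rightarrow> nat \<Rightarrow> nat \<Rightarrow> complex mat" where
  "Eplus_left t n p i = E_gen t n (p + i)"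

definition Eminus_left :: "affine_type \<Rightarrow> nat \<Rightarrow> nat \<Rightarrow> nat \<Rightarrow> complex mat" where
  "Eminus_left t n p i = transpose_mat (E_gen t n (p + i))"

definition H_right :: "affine_type \<Rightarrow> nat \<Rightarrow> nat \<Rightarrow> nat \<Rightarrow> complex mat" where
  "H_right t n p i = - H_gen t n (p + 1 - i)"

definition Eplus_right :: "affine_type \<Rightarrow> nat \<Rightarrow> nat \<Rightarrow> nat \<Rightarrow> complex mat" where
  "Eplus_right t n p i = E_gen t n (p - i)"

definition Eminus_right :: "affine_type \<Rightarrow> nat \<Rightarrow> nat \<Rightarrow> nat \<Rightarrow> complex mat" where
  "Eminus_right t n p i = transpose_mat (E_gen t n (p - i))"

datatype series = Series_B | Series_C | Series_D

fun left_series :: "affine_type \<Rightarrow> series" where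
  "left_series A2_even = Series_B"
| "left_series A2_odd = Series_C"
| "left_series B1 = Series_B"
| "left_series C1 = Series_C"
| "left_series D1 = Series_D"

fun right_series :: "affine_type \<Rightarrow> series" where
  "right_series A2_even = Series_C"
| "right_series A2_odd = Series_D"
| "right_series B1 = Series_D"
| "right_series C1 = Series_C"
| "right_series D1 = Series_D"

definition Q_left :: "affine_type \<Rightarrow> nat \<Rightarrow> complex \<Rightarrow> nat \<Rightarrow> nat \<Rightarrow> complex mat" where
  "Q_left t n \<eta> p j =
     (let H = H_left t n p; \<theta> = \<eta> + \<i> * of_real pi in
      mat_exp
        (if j < n - p then \<theta> \<cdot>\<^sub>m H j - \<eta> \<cdot>\<^sub>m H (j + 1)
         else case left_series t of
             Series_B \<Rightarrow> \<theta> \<cdot>\<^sub>m H j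
           | Series_C \<Rightarrow> (2 * \<eta>) \<cdot>\<^sub>m H j
           | Series_D \<Rightarrow> \<eta> \<cdot>\<^sub>m H (j - 1) + \<theta> \<cdot>\<^sub>m H j))"

text \<open>The right factor is never of series \<open>B\<close>.\<close>

definition Q_right :: "affine_type \<Rightarrow> nat \<Rightarrow> complex \<Rightarrow> nat \<Rightarrow> nat \<Rightarrow> complex mat" where
  "Q_right t n \<eta> p j =
     (let H = H_right t n p; \<theta> = \<eta> + \<i> * of_real pi in
      mat_exp
        (if j < p then \<theta> \<cdot>\<^sub>m H j - \<eta> \<cdot>\<^sub>m H (j + 1)
         else if right_series t = Series_C then (2 * \<eta>) \<cdot>\<^sub>m H j
         else \<theta> \<cdot>\<^sub>m H (j - 1) + \<eta> \<cdot>\<^sub>m H j))"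

definition coprod_H :: "nat \<Rightarrow> nat \<Rightarrow> complex mat \<Rightarrow> complex mat" where
  "coprod_H d N H = mat_sum (d ^ N)
     (\<lambda>k. kron_list (replicate (k - 1) (1\<^sub>m d) @ [H] @ replicate (N - k) (1\<^sub>m d))) {1..N}"

definition coprod_E :: "nat \<Rightarrow> nat \<Rightarrow> complex mat \<Rightarrow> complex mat \<Rightarrow> complex mat" where
  "coprod_E d N Q E = mat_sum (d ^ N)
     (\<lambda>k. kron_list (replicate (k - 1) (mat_inv Q) @ [E] @ replicate (N - k) Q)) {1..N}"

end

theory Submission
  imports Defs "HOL-Library.FuncSet"
begin

text \<open>
  Each left or right generator \<open>X\<close> is an affine generator \<open>E\<^sub>m\<close> or its transpose, and the
    R-matrix satisfies
  \<open>R(u) (z X \<otimes> Q + Q\<^sup>-\<^sup>1 \<otimes> X) = (z X \<otimes> Q\<^sup>-\<^sup>1 + Q \<otimes> X) R(u)\<close>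
    with \<open>z = 1\<close> for \<open>m \<ge> 1\<close> and \<open>z = e\<^sup>\<plusminus>\<^sup>u\<close> for \<open>m =
    0\<close>.
  Hence \<open>T\<^sub>a\<close> moves the auxiliary factor of the \<open>(N + 1)\<close>-fold coproduct from the front to the
    back, with weight \<open>z\<close>
  on that factor, and the second row of R-matrices moves it to the front again, with weight \<open>z\<^sup>-\<^sup>1\<close>.
    Since
  \<open>K\<^sup>R X = z\<^sup>2 X K\<^sup>R\<close>, the double-row monodromy matrix intertwines the coproducts of weights
    \<open>z\<^sup>-\<^sup>1\<close> and \<open>z\<close>. After
  multiplication by \<open>K\<^sup>L Q\<^sup>-\<^sup>1\<close> the trace over the auxiliary space removes the terms in which
    \<open>X\<close> acts there, because
  \<open>z\<^sup>-\<^sup>1 Q X K\<^sup>L Q\<^sup>-\<^sup>2 = z K\<^sup>L Q\<^sup>-\<^sup>1 X\<close>. Both K-matrix relations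
    only use the block structure of \<open>K\<^sup>R\<close>; the middle
  eigenvalue, and with it \<open>\<gamma>\<close>, is irrelevant.
\<close>

subsection \<open>The R-matrix and a single root vector\<close>

text \<open>The index p marks the node omitted from the affine diagram. K^R has three blocks: the
  first p indices, the middle, the last p. For 1 \<le> m < p and for m > p the vector
  \<open>E_gen\<close> m moves indices inside one block. For m = 0 it joins the last block to the
  first, whose eigenvalues exp u and exp (- u) differ by the square of the spectral weight. The node
  m = p fits neither pattern, and removing it leaves the two diagrams of the left and right
  algebras. The excluded values of p are those where a fork-shaped end vector would straddle two
  blocks. K^L causes no new condition on the root data, because M is proportional to the inverse
  square of the same function \<open>G\<close> that orders the weight-zero entries of R, and the
  shift by \<rho> matches the growth of \<open>G\<close> over the whole index range. The obstacle is
  the number of cases: five types, several shapes of root vectors with their transposes, and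
  relations with four free indices. Weight conservation leaves finitely many scalar identities per
  shape, and the variables y, Q, K, \<sigma> and G make these independent of the type, which is
  remembered only by ratios of G at a few indices.\<close>

text \<open>\<open>r_entry pr C B F V a b c e\<close> is the coefficient of \<open>e\<^sub>a\<^sub>c \<otimes>
  e\<^sub>b\<^sub>e\<close>; all entries of weight zero, \<open>b = a'\<close> and \<open>e = c'\<close>,
  are collected in \<open>V\<close>. In \<open>local_int\<close> the matrix \<open>X\<close> carries the weight \<open>z\<close>
    on the first factor, and \<open>q\<close>, \<open>qi\<close> are the diagonals
  of \<open>Q\<close> and \<open>Q\<^sup>-\<^sup>1\<close>.\<close>

definition r_entry :: "(nat \<Rightarrow> nat) \<Rightarrow> complex \<Rightarrow> complex \<Rightarrow> (nat \<Rightarrow> nat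
  \<Rightarrow> complex) \<Rightarrow> (nat \<Rightarrow> nat \<Rightarrow> complex)
   \<Rightarrow> nat \<Rightarrow> nat \<Rightarrow> nat \<Rightarrow> nat \<Rightarrow> complex" where
  "r_entry pr C B F V a b c e =
     (if a = c \<and> b = e \<and> b \<noteq> pr a then (if a = b then C else B) else 0)
   + (if a = e \<and> b = c \<and> a \<noteq> b \<and> b \<noteq> pr a then F a c else 0)
   + (if b = pr a \<and> e = pr c then V a c else 0)"

definition local_int :: "nat set \<Rightarrow> (nat \<Rightarrow> nat \<Rightarrow> nat \<Rightarrow> nat \<Rightarrow> complex)
  \<Rightarrow> complex \<Rightarrow> (nat \<Rightarrow> nat \<Rightarrow> complex)
   \<Rightarrow> (nat \<Rightarrow> complex) \<Rightarrow> (nat \<Rightarrow> complex) \<Rightarrow> bool" where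
  "local_int I r z X q qi \<longleftrightarrow> (\<forall>a\<in>I. \<forall>b\<in>I. \<forall>c\<in>I. \<forall>e\<in>I.
     z * q e * (\<Sum>s\<in>I. r a b s e * X s c) + qi c * (\<Sum>s\<in>I. r a b c s * X s e)
   = z * qi b * (\<Sum>s\<in>I. X a s * r s b c e) + q a * (\<Sum>s\<in>I. X b s * r a s c e))"

text \<open>Up to a factor, every root vector is \<open>e\<^sub>i\<^sub>j + e\<^sub>j\<^sub>'\<^sub>i\<^sub>'\<close> (the
  interior of the diagram and the ends of type D), \<open>e\<^sub>i\<^sub>i\<^sub>'\<close> (type C)
  or \<open>e\<^sub>i\<^sub>m + e\<^sub>m\<^sub>i\<^sub>'\<close> with \<open>m = m'\<close> (type B). Weight conservation leaves
    only the listed conditions.\<close>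

lemma local_int_D:
  fixes i j i2 j2 :: nat
  assumes fin: "finite I" and I: "i \<in> I" "j \<in> I" "i2 \<in> I" "j2 \<in> I"
   and pr: "pr i = i2" "pr j = j2" "pr i2 = i" "pr j2 = j"
   and prI: "\<And>x. x \<in> I \<Longrightarrow> pr x \<in> I \<and> pr (pr x) = x"
   and dist: "distinct [i,j,i2,j2]"
   and X: "\<And>s c. X s c = (if s = i \<and> c = j then 1 else 0) + (if s = j2 \<and> c = i2 then 1 else (0::complex))"
   and q: "q i = q1" "q j = q2" "q i2 = p1" "q j2 = p2" "\<And>x. x \<notin> {i,j,i2,j2} \<Longrightarrow> q x = 1"
   and qi: "qi i = p1" "qi j = p2" "qi i2 = q1" "qi j2 = q2" "\<And>x. x \<notin> {i,j,i2,j2} \<Longrightarrow> qi x = 1"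
   and F: "\<And>x. x \<in> I - {i,j,i2,j2} \<Longrightarrow> F x j = z * F x i \<and> F i x = z * F j x \<and> F x i2 = z * F x
     j2 \<and> F j2 x = z * F i2 x"
   and g1: "z * q2 * B + p2 * F i j = z * p2 * C" "z * q2 * F j i + p2 * B = q2 * C"
   and g2: "z * q1 * C = z * p1 * B + q1 * F i j" "p1 * C = z * p1 * F j i + q1 * B"
   and g3: "z * p1 * B + q1 * F j2 i2 = z * q1 * C" "z * p1 * F i2 j2 + q1 * B = p1 * C"
   and g4: "z * p2 * C = z * q2 * B + p2 * F j2 i2" "q2 * C = z * q2 * F i2 j2 + p2 * B"
   and v1: "\<And>x. x \<in> I - {i,j,i2,j2} \<Longrightarrow> z * p1 * V x i + p2 * V x j = 0"
      "z * p1 * V i i + p2 * V i j = z * q1 * B" "z * p1 * V j i + p2 * V j j = q2 * B"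
      "z * p1 * V j2 i + p2 * V j2 j = z * p2 * F i2 j" "z * p1 * V i2 i + p2 * V i2 j = p1 * F i2 j"
   and v2: "\<And>x. x \<in> I - {i,j,i2,j2} \<Longrightarrow> z * q2 * V x j2 + q1 * V x i2 = 0"
      "z * q2 * V j2 j2 + q1 * V j2 i2 = z * p2 * B" "z * q2 * V i j2 + q1 * V i i2 = z * q1 * F j i2"
      "z * q2 * V i2 j2 + q1 * V i2 i2 = p1 * B" "z * q2 * V j j2 + q1 * V j i2 = q2 * F j i2"
   and v3: "\<And>x. x \<in> I - {i,j,i2,j2} \<Longrightarrow> z * q2 * V j x + q1 * V i x = 0"
      "z * q2 * V j j + q1 * V i j = z * p2 * B" "z * q2 * V j i2 + q1 * V i i2 = z * q1 * F i j2"
      "z * q2 * V j j2 + q1 * V i j2 = q2 * F i j2" "z * q2 * V j i + q1 * V i i = p1 * B"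
   and v4: "\<And>x. x \<in> I - {i,j,i2,j2} \<Longrightarrow> z * p1 * V i2 x + p2 * V j2 x = 0"
      "z * p1 * V i2 j + p2 * V j2 j = z * p2 * F j2 i" "z * p1 * V i2 i2 + p2 * V j2 i2 = z * q1 * B"
      "z * p1 * V i2 j2 + p2 * V j2 j2 = q2 * B" "z * p1 * V i2 i + p2 * V j2 i = p1 * F j2 i"
  shows "local_int I (r_entry pr C B F V) z X q qi"
proof -
  have S1: "(\<Sum>s\<in>I. f s * X s c) = (if c = j then f i else 0) + (if c = i2 then f j2 else 0)" for f c
    using fin I dist by (simp add: X algebra_simps sum.distrib if_distrib[of "\<lambda>x. _ * x"] cong: if_cong)
  have S2: "(\<Sum>s\<in>I. X a s * f s) = (if a = i then f j else 0) + (if a = j2 then f i2 else 0)" for f a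
    using fin I dist by (simp add: X algebra_simps sum.distrib if_distrib[of "\<lambda>x. _ * x"] cong: if_cong)
  have oth: "x = i \<or> x = j \<or> x = i2 \<or> x = j2 \<or> (x \<noteq> i \<and> x \<noteq> j \<and> x \<noteq> i2 \<and> x
    \<noteq> j2 \<and> pr x \<noteq> i \<and> pr x \<noteq> j \<and> pr x \<noteq> i2 \<and> pr x \<noteq> j2)"
    if "x \<in> I" for x using prI[OF that] pr by metis
  have inj: "pr x = pr y \<longleftrightarrow> x = y" if "x \<in> I" "y \<in> I" for x y using prI that by metis
  have sw: "x = pr y \<longleftrightarrow> y = pr x" if "x \<in> I" "y \<in> I" for x y using prI that by metis
  have d: "i \<noteq> j" "i \<noteq> i2" "i \<noteq> j2" "j \<noteq> i2" "j \<noteq> j2" "i2 \<noteq> j2"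
     "j \<noteq> i" "i2 \<noteq> i" "j2 \<noteq> i" "i2 \<noteq> j" "j2 \<noteq> j" "j2 \<noteq> i2" using dist by auto
  have prx: "(i = pr x) = (x = i2)" "(j = pr x) = (x = j2)" "(i2 = pr x) = (x = i)" "(j2 = pr x) = (x = j)"
     "(pr x = i) = (x = i2)" "(pr x = j) = (x = j2)" "(pr x = i2) = (x = i)" "(pr x = j2) = (x = j)" if "x \<in> I" for x
    using prI[OF that] pr by metis+
  \<comment> \<open>The column (c, e) decides which part of \<open>r_entry\<close> can be nonzero:
    unrelated indices leave B and F, a repeated index leaves C, a dual pair leaves V. These three
    rules replace the definition in the case analysis.\<close>
  have r1: "r_entry pr C B F V a b c e = (if a = c \<and> b = e then B else 0) + (if a = e \<and> b = c then F a c else 0)"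
    if "c \<noteq> e" "e \<noteq> pr c" "c \<noteq> pr e" for a b c e
    using that by (auto simp: r_entry_def)
  have r2: "r_entry pr C B F V a b c c = (if a = c \<and> b = c then C else 0)"
    if "c \<noteq> pr c" for a b c
    using that by (auto simp: r_entry_def)
  have r3: "r_entry pr C B F V a b c e = (if b = pr a then V a c else 0)"
    if "e = pr c" "c \<in> I" for a b c e
    using that prI by (auto simp: r_entry_def)
  show ?thesis
    unfolding local_int_def S1 S2
  proof (intro ballI)
    fix a b c e assume A: "a \<in> I" "b \<in> I" "c \<in> I" "e \<in> I"
    show "z * q e * ((if c = j then r_entry pr C B F V a b i e else 0) + (if c = i2 then r_entry pr C B F V a b j2 e else 0)) +
         qi c * ((if e = j then r_entry pr C B F V a b c i else 0) + (if e = i2 then r_entry pr C B F V a b c j2 else 0)) =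
         z * qi b * ((if a = i then r_entry pr C B F V j b c e else 0) + (if a = j2 then r_entry pr C B F V i2 b c e else 0)) +
         q a * ((if b = i then r_entry pr C B F V a j c e else 0) + (if b = j2 then r_entry pr C B F V a i2 c e else 0))"
    (is "?L c e = ?R c e")
    proof -
      \<comment> \<open>The conditions are sorted by the entries that produce them: g1 and g3 are
        the columns (j, j) and (i2, i2), g2 and g4 the rows (i, i) and (j2, j2), v1 and v2 the
        columns (j, i2) and (i2, j), v3 and v4 the rows (i, j2) and (j2, i). F covers the entries in
        which one index is a spectator.\<close>
      note cond = g1 g2 g3 g4 v1 v2 v3 v4 F
      note simps = d pr q qi r1 r2 r3 A I prx
      have "\<forall>c\<in>{i,j,i2,j2}. \<forall>e\<in>{i,j,i2,j2}. ?L c e = ?R c e"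
        by (simp only: ball_simps simp_thms, intro conjI; insert oth[OF A(1)], elim disjE;
            (simp_all add: simps split del: if_split cong: if_cong)?; (auto simp: simps cond)?)
      moreover have "\<forall>c\<in>{i,j,i2,j2}. ?L c e = ?R c e" if o: "e \<noteq> i" "e \<noteq> j" "e \<noteq> i2"
        "e \<noteq> j2"
        by (simp only: ball_simps simp_thms, intro conjI; insert oth[OF A(1)], elim disjE;
            (simp_all add: simps o o[symmetric] split del: if_split cong: if_cong)?; (auto simp: simps cond o o[symmetric])?)
      moreover have "\<forall>e\<in>{i,j,i2,j2}. ?L c e = ?R c e" if o: "c \<noteq> i" "c \<noteq> j" "c \<noteq> i2"
        "c \<noteq> j2"
        by (simp only: ball_simps simp_thms, intro conjI; insert oth[OF A(1)], elim disjE;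
            (simp_all add: simps o o[symmetric] split del: if_split cong: if_cong)?; (auto simp: simps cond o o[symmetric])?)
      \<comment> \<open>With both column indices outside the support the left side vanishes, and the
        right side can survive only in a weight-zero column, where v3 and v4 apply.\<close>
      moreover have "?L c e = ?R c e" if o: "c \<noteq> i" "c \<noteq> j" "c \<noteq> i2" "c \<noteq> j2" "e \<noteq> i"
        "e \<noteq> j" "e \<noteq> i2" "e \<noteq> j2"
      proof -
        consider "e = pr c" | "e = c" "c \<noteq> pr c" | "c \<noteq> e" "e \<noteq> pr c" "c \<noteq> pr e" using prI A by metis
        then show ?thesis
        proof cases
          case 1
          have r3c: "r_entry pr C B F V a b c (pr c) = (if b = pr a then V a c else 0)" for a b
            using r3 A by simp
          show ?thesis unfolding 1 r3c
            by (insert oth[OF A(1)], elim disjE; (simp add: d pr A prx qi q o o[symmetric] split del: if_split cong: if_cong)?;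
              (auto simp: d pr A prx q qi cond o o[symmetric])?)
        next
          case 2
          then show ?thesis by (simp add: d r2 o o[symmetric])
        next
          case 3
          then show ?thesis by (simp add: r1[OF 3] o o[symmetric])
        qed
      qed
      ultimately show ?thesis by (metis insertCI)
    qed
  qed
qed

text \<open>Here X joins an index to its own dual. Applied to one leg of a repeated pair it produces
  a dual pair, so the V-conditions sit at the column (i2, i2) for v1 and at the row (i, i) for v3,
  with C on the other side.\<close>

lemma local_int_C:
  fixes i i2 :: nat
  assumes fin: "finite I" and I: "i \<in> I" "i2 \<in> I"
   and pr: "pr i = i2" "pr i2 = i"
   and prI: "\<And>x. x \<in> I \<Longrightarrow> pr x \<in> I \<and> pr (pr x) = x"
   and dist: "distinct [i,i2]"
   and X: "\<And>s c. X s c = (if s = i \<and> c = i2 then 1 else (0::complex))"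
   and q: "q i = q1" "q i2 = p1" "\<And>x. x \<notin> {i,i2} \<Longrightarrow> q x = 1"
   and qi: "qi i = p1" "qi i2 = q1" "\<And>x. x \<notin> {i,i2} \<Longrightarrow> qi x = 1"
   and F: "\<And>x. x \<in> I - {i,i2} \<Longrightarrow> F x i2 = z * F x i \<and> F i x = z * F i2 x"
   and v1: "\<And>x. x \<in> I - {i,i2} \<Longrightarrow> z * p1 * V x i + q1 * V x i2 = 0"
      "z * p1 * V i i + q1 * V i i2 = z * q1 * C" "z * p1 * V i2 i + q1 * V i2 i2 = p1 * C"
   and v3: "\<And>x. x \<in> I - {i,i2} \<Longrightarrow> z * p1 * V i2 x + q1 * V i x = 0"
      "z * p1 * V i2 i2 + q1 * V i i2 = z * q1 * C" "z * p1 * V i2 i + q1 * V i i = p1 * C"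
  shows "local_int I (r_entry pr C B F V) z X q qi"
proof -
  have S1: "(\<Sum>s\<in>I. f s * X s c) = (if c = i2 then f i else 0)" for f c
    using fin I dist by (simp add: X algebra_simps sum.distrib if_distrib[of "\<lambda>x. _ * x"] cong: if_cong)
  have S2: "(\<Sum>s\<in>I. X a s * f s) = (if a = i then f i2 else 0)" for f a
    using fin I dist by (simp add: X algebra_simps sum.distrib if_distrib[of "\<lambda>x. _ * x"] cong: if_cong)
  have oth: "x = i \<or> x = i2 \<or> (x \<noteq> i \<and> x \<noteq> i2 \<and> pr x \<noteq> i \<and> pr x \<noteq> i2)"
    if "x \<in> I" for x using prI[OF that] pr by metis
  have prx: "(i = pr x) = (x = i2)" "(pr x = i) = (x = i2)" "(i2 = pr x) = (x = i)" "(pr x = i2) = (x = i)" if "x \<in> I" for x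
    using prI[OF that] pr by metis+
  have d: "i \<noteq> i2" "i2 \<noteq> i" using dist by auto
  have r1: "r_entry pr C B F V a b c e = (if a = c \<and> b = e then B else 0) + (if a = e \<and> b = c then F a c else 0)"
    if "c \<noteq> e" "e \<noteq> pr c" "c \<noteq> pr e" for a b c e
    using that by (auto simp: r_entry_def)
  have r2: "r_entry pr C B F V a b c c = (if a = c \<and> b = c then C else 0)"
    if "c \<noteq> pr c" for a b c
    using that by (auto simp: r_entry_def)
  have r3: "r_entry pr C B F V a b c e = (if b = pr a then V a c else 0)"
    if "e = pr c" "c \<in> I" for a b c e
    using that prI by (auto simp: r_entry_def)
  show ?thesis
    unfolding local_int_def S1 S2
  proof (intro ballI)
    fix a b c e assume A: "a \<in> I" "b \<in> I" "c \<in> I" "e \<in> I"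
    show "z * q e * (if c = i2 then r_entry pr C B F V a b i e else 0) + qi c * (if e = i2 then r_entry pr C B F V a b c i else
      0) = z * qi b * (if a = i then r_entry pr C B F V i2 b c e else 0) + q a * (if b = i then r_entry pr C B F V a i2 c e else
      0)"
    (is "?L c e = ?R c e")
    proof -
      note cond = v1 v3 F
      note simps = d pr q qi r1 r2 r3 A I prx
      have "\<forall>c\<in>{i,i2}. \<forall>e\<in>{i,i2}. ?L c e = ?R c e"
        by (simp only: ball_simps simp_thms, intro conjI; insert oth[OF A(1)], elim disjE;
            (simp_all add: simps split del: if_split cong: if_cong)?; (auto simp: simps cond)?)
      moreover have "\<forall>c\<in>{i,i2}. ?L c e = ?R c e" if ot: "e \<noteq> i" "e \<noteq> i2"
        by (simp only: ball_simps simp_thms, intro conjI; insert oth[OF A(1)], elim disjE;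
            (simp_all add: simps ot ot[symmetric] split del: if_split cong: if_cong)?; (auto simp: simps cond ot ot[symmetric])?)
      moreover have "\<forall>e\<in>{i,i2}. ?L c e = ?R c e" if ot: "c \<noteq> i" "c \<noteq> i2"
        by (simp only: ball_simps simp_thms, intro conjI; insert oth[OF A(1)], elim disjE;
            (simp_all add: simps ot ot[symmetric] split del: if_split cong: if_cong)?; (auto simp: simps cond ot ot[symmetric])?)
      moreover have "?L c e = ?R c e" if ot: "c \<noteq> i" "c \<noteq> i2" "e \<noteq> i" "e \<noteq> i2"
      proof -
        consider "e = pr c" | "e = c" "c \<noteq> pr c" | "c \<noteq> e" "e \<noteq> pr c" "c \<noteq> pr e" using prI A by metis
        then show ?thesis
        proof cases
          case 1
          have r3c: "r_entry pr C B F V a b c (pr c) = (if b = pr a then V a c else 0)" for a b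
            using r3 A by simp
          show ?thesis unfolding 1 r3c
            by (insert oth[OF A(1)], elim disjE; (simp add: d pr A prx qi q ot ot[symmetric] split del: if_split cong: if_cong)?;
              (auto simp: d pr A prx q qi cond ot ot[symmetric])?)
        next
          case 2
          then show ?thesis by (simp add: d r2 ot ot[symmetric])
        next
          case 3
          then show ?thesis by (simp add: r1[OF 3] ot ot[symmetric])
        qed
      qed
      ultimately show ?thesis by (metis insertCI)
    qed
  qed
qed

text \<open>The self-dual index makes (m, m) a pair of weight zero, one step of X away from (m, i2),
  (i2, m), (i, m) and (m, i). These four pairs give v1 to v4, and this is where the exceptional
  diagonal entry \<open>V m m\<close> is tested.\<close>

lemma local_int_B:
  fixes i m i2 :: nat
  assumes fin: "finite I" and I: "i \<in> I" "m \<in> I" "i2 \<in> I"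
   and pr: "pr i = i2" "pr m = m" "pr i2 = i"
   and prI: "\<And>x. x \<in> I \<Longrightarrow> pr x \<in> I \<and> pr (pr x) = x"
   and dist: "distinct [i,m,i2]"
   and X: "\<And>s c. X s c = (if s = i \<and> c = m then 1 else 0) + (if s = m \<and> c = i2 then 1 else (0::complex))"
   and q: "q i = q1" "q i2 = p1" "q m = 1" "\<And>x. x \<notin> {i,m,i2} \<Longrightarrow> q x = 1"
   and qi: "qi i = p1" "qi i2 = q1" "qi m = 1" "\<And>x. x \<notin> {i,m,i2} \<Longrightarrow> qi x = 1"
   and F: "\<And>x. x \<in> I - {i,m,i2} \<Longrightarrow> F x m = z * F x i \<and> F i x = z * F m x \<and> F x i2 = z * F x m
     \<and> F m x = z * F i2 x"
   and g2: "z * q1 * C = z * p1 * B + q1 * F i m" "p1 * C = z * p1 * F m i + q1 * B"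
   and g3: "z * p1 * B + q1 * F m i2 = z * q1 * C" "z * p1 * F i2 m + q1 * B = p1 * C"
   and v1: "\<And>x. x \<in> I - {i,m,i2} \<Longrightarrow> z * p1 * V x i + V x m = 0"
      "z * p1 * V i i + V i m = z * q1 * B" "z * p1 * V m i + V m m = z * F i2 m + B" "z * p1 * V i2 i + V i2 m = p1 * F i2 m"
   and v2: "\<And>x. x \<in> I - {i,m,i2} \<Longrightarrow> z * V x m + q1 * V x i2 = 0"
      "z * V i m + q1 * V i i2 = z * q1 * F m i2" "z * V m m + q1 * V m i2 = z * B + F m i2" "z * V i2 m + q1 * V i2 i2 = p1 * B"
   and v3: "\<And>x. x \<in> I - {i,m,i2} \<Longrightarrow> z * V m x + q1 * V i x = 0"
      "z * V m m + q1 * V i m = z * B + F i m" "z * V m i2 + q1 * V i i2 = z * q1 * F i m" "z * V m i + q1 * V i i = p1 * B"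
   and v4: "\<And>x. x \<in> I - {i,m,i2} \<Longrightarrow> z * p1 * V i2 x + V m x = 0"
      "z * p1 * V i2 m + V m m = z * F m i + B" "z * p1 * V i2 i2 + V m i2 = z * q1 * B" "z * p1 * V i2 i + V m i = p1 * F m i"
  shows "local_int I (r_entry pr C B F V) z X q qi"
proof -
  have S1: "(\<Sum>s\<in>I. f s * X s c) = (if c = m then f i else 0) + (if c = i2 then f m else 0)" for f c
    using fin I dist by (simp add: X algebra_simps sum.distrib if_distrib[of "\<lambda>x. _ * x"] cong: if_cong)
  have S2: "(\<Sum>s\<in>I. X a s * f s) = (if a = i then f m else 0) + (if a = m then f i2 else 0)" for f a
    using fin I dist by (simp add: X algebra_simps sum.distrib if_distrib[of "\<lambda>x. _ * x"] cong: if_cong)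
  have oth: "x = i \<or> x = m \<or> x = i2 \<or> (x \<noteq> i \<and> x \<noteq> m \<and> x \<noteq> i2 \<and> pr x \<noteq> i
    \<and> pr x \<noteq> m \<and> pr x \<noteq> i2)"
    if "x \<in> I" for x using prI[OF that] pr by metis
  have prx: "(i = pr x) = (x = i2)" "(pr x = i) = (x = i2)" "(m = pr x) = (x = m)" "(pr x = m) = (x = m)"
    "(i2 = pr x) = (x = i)" "(pr x = i2) = (x = i)" if "x \<in> I" for x
    using prI[OF that] pr by metis+
  have d: "i \<noteq> m" "i \<noteq> i2" "m \<noteq> i" "m \<noteq> i2" "i2 \<noteq> i" "i2 \<noteq> m" using dist by auto
  have r1: "r_entry pr C B F V a b c e = (if a = c \<and> b = e then B else 0) + (if a = e \<and> b = c then F a c else 0)"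
    if "c \<noteq> e" "e \<noteq> pr c" "c \<noteq> pr e" for a b c e
    using that by (auto simp: r_entry_def)
  have r2: "r_entry pr C B F V a b c c = (if a = c \<and> b = c then C else 0)"
    if "c \<noteq> pr c" for a b c
    using that by (auto simp: r_entry_def)
  have r3: "r_entry pr C B F V a b c e = (if b = pr a then V a c else 0)"
    if "e = pr c" "c \<in> I" for a b c e
    using that prI by (auto simp: r_entry_def)
  show ?thesis
    unfolding local_int_def S1 S2
  proof (intro ballI)
    fix a b c e assume A: "a \<in> I" "b \<in> I" "c \<in> I" "e \<in> I"
    show "z * q e * ((if c = m then r_entry pr C B F V a b i e else 0) + (if c = i2 then r_entry pr C B F V a b m e else 0)) + qi
      c * ((if e = m then r_entry pr C B F V a b c i else 0) + (if e = i2 then r_entry pr C B F V a b c m else 0)) = z * qi b *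
      ((if a = i then r_entry pr C B F V m b c e else 0) + (if a = m then r_entry pr C B F V i2 b c e else 0)) + q a * ((if b = i
      then r_entry pr C B F V a m c e else 0) + (if b = m then r_entry pr C B F V a i2 c e else 0))"
    (is "?L c e = ?R c e")
    proof -
      note cond = g2 g3 v1 v2 v3 v4 F
      note simps = d pr q qi r1 r2 r3 A I prx
      have "\<forall>c\<in>{i,m,i2}. \<forall>e\<in>{i,m,i2}. ?L c e = ?R c e"
        by (simp only: ball_simps simp_thms, intro conjI; insert oth[OF A(1)], elim disjE;
            (simp_all add: simps split del: if_split cong: if_cong)?; (auto simp: simps cond)?)
      moreover have "\<forall>c\<in>{i,m,i2}. ?L c e = ?R c e" if ot: "e \<noteq> i" "e \<noteq> m" "e \<noteq> i2"
        by (simp only: ball_simps simp_thms, intro conjI; insert oth[OF A(1)], elim disjE;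
            (simp_all add: simps ot ot[symmetric] split del: if_split cong: if_cong)?; (auto simp: simps cond ot ot[symmetric])?)
      moreover have "\<forall>e\<in>{i,m,i2}. ?L c e = ?R c e" if ot: "c \<noteq> i" "c \<noteq> m" "c \<noteq> i2"
        by (simp only: ball_simps simp_thms, intro conjI; insert oth[OF A(1)], elim disjE;
            (simp_all add: simps ot ot[symmetric] split del: if_split cong: if_cong)?; (auto simp: simps cond ot ot[symmetric])?)
      moreover have "?L c e = ?R c e" if ot: "c \<noteq> i" "c \<noteq> m" "c \<noteq> i2" "e \<noteq> i" "e \<noteq> m"
        "e \<noteq> i2"
      proof -
        consider "e = pr c" | "e = c" "c \<noteq> pr c" | "c \<noteq> e" "e \<noteq> pr c" "c \<noteq> pr e" using prI A by metis
        then show ?thesis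
        proof cases
          case 1
          have r3c: "r_entry pr C B F V a b c (pr c) = (if b = pr a then V a c else 0)" for a b
            using r3 A by simp
          show ?thesis unfolding 1 r3c
            by (insert oth[OF A(1)], elim disjE; (simp add: d pr A prx qi q ot ot[symmetric] split del: if_split cong: if_cong)?;
              (auto simp: d pr A prx q qi cond ot ot[symmetric])?)
        next
          case 2
          then show ?thesis by (simp add: d r2 ot ot[symmetric])
        next
          case 3
          then show ?thesis by (simp add: r1[OF 3] ot ot[symmetric])
        qed
      qed
      ultimately show ?thesis by (metis insertCI)
    qed
  qed
qed

subsection \<open>The intertwining relations for the Jimbo R-matrix coefficients\<close>

text \<open>With \<open>h(x) = (e\<^sup>x - \<sigma> e\<^sup>-\<^sup>x) / 2\<close> the coefficients are Laurent polynomials in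
  \<open>y = e\<^sup>u\<^sup>/\<^sup>2\<close>, \<open>Q = e\<^sup>\<eta>\<close> and \<open>K =
  e\<^sup>\<kappa>\<^sup>\<eta>\<close>, uniformly
  in the affine type; \<open>G \<alpha>\<close> stands for \<open>eps \<alpha> * exp (2 * bar \<alpha> * \<eta>)\<close>.\<close>

definition F_coef :: "complex \<Rightarrow> complex \<Rightarrow> complex \<Rightarrow> complex \<Rightarrow> nat \<Rightarrow>
  nat \<Rightarrow> complex" where
  "F_coef y Q K \<sigma> a c = (if a < c then 1 / y else y) * (- (Q^2 - 1/Q^2) * (y/K - \<sigma>*K/y) / 2)"

definition V_coef :: "(nat \<Rightarrow> nat) \<Rightarrow> complex \<Rightarrow> complex \<Rightarrow> complex \<Rightarrow>
  complex \<Rightarrow> (nat \<Rightarrow> complex) \<Rightarrow> nat \<Rightarrow> nat \<Rightarrow> complex" where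
  "V_coef pr y Q K \<sigma> G a c =
    (if a = c then (if a = pr a then ((y - 1/y) * (y/K - \<sigma>*K/y) + \<sigma> * (Q^2 - 1/Q^2) * (K - \<sigma>/K)) / 2
       else (y - 1/y) * (y*Q^2/K - \<sigma>*K/(y*Q^2)) / 2)
     else if a < c then (Q^2 - 1/Q^2) / y * (\<sigma>*K * (G a/G c) * (y - 1/y) - (if c = pr a then y/K - \<sigma>*K/y else 0)) /
       2
     else (Q^2 - 1/Q^2) * y * ((G a/G c) * (y - 1/y) / K - (if c = pr a then y/K - \<sigma>*K/y else 0)) / 2)"

abbreviation "B_coef y K \<sigma> \<equiv> (y - 1/y) * (y/K - \<sigma>*K/y) / (2::complex)"
abbreviation "C_coef y Q K \<sigma> \<equiv> (y/Q^2 - Q^2/y) * (y/K - \<sigma>*K/y) / (2::complex)"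

abbreviation "r_coef pr y Q K \<sigma> G \<equiv> r_entry pr (C_coef y Q K \<sigma>) (B_coef y K \<sigma>) (F_coef y Q K
  \<sigma>) (V_coef pr y Q K \<sigma> G)"

text \<open>No spectator separates i from j or j2 from i2, so \<open>F_coef\<close> takes the same
  branch at both ends and z = 1 suffices. Since G grows by Q^2 from i to j, the condition p1 * V x i
  + p2 * V x j = 0 fixes the relative sign of q at i and j; the common sign \<tau> stays free. What
  remains are Laurent identities in y, Q and K modulo \<sigma>^2 = \<tau>^2 = 1.\<close>

lemma local_int_bulk:
  fixes i j i2 j2 :: nat
  assumes I: "finite I" "i \<in> I" "j \<in> I" "i2 \<in> I" "j2 \<in> I"
   and pr: "pr i = i2" "pr j = j2" "pr i2 = i" "pr j2 = j"
   and prI: "\<And>x. x \<in> I \<Longrightarrow> pr x \<in> I \<and> pr (pr x) = x"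
   and ord: "i < j" "j < j2" "j2 < i2"
   and btw: "\<And>x. x \<in> I - {i,j,i2,j2} \<Longrightarrow> (x < i \<and> x < j \<or> i < x \<and> j < x) \<and> (x < j2
     \<and> x < i2 \<or> j2 < x \<and> i2 < x)"
   and X: "\<And>s c. X s c = (if s = i \<and> c = j then 1 else 0) + (if s = j2 \<and> c = i2 then 1 else (0::complex))"
   and q: "q i = \<tau>*Q" "q j = -\<tau>/Q" "q i2 = \<tau>/Q" "q j2 = -\<tau>*Q"
     "\<And>x. x \<notin> {i,j,i2,j2} \<Longrightarrow> q x = 1"
   and qi: "qi i = \<tau>/Q" "qi j = -\<tau>*Q" "qi i2 = \<tau>*Q" "qi j2 = -\<tau>/Q"
     "\<And>x. x \<notin> {i,j,i2,j2} \<Longrightarrow> qi x = 1"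
   and \<tau>: "\<tau> * \<tau> = 1" and \<sigma>: "\<sigma> = 1 \<or> \<sigma> = - 1"
   and nz: "y \<noteq> 0" "Q \<noteq> 0" "K \<noteq> 0" "\<And>x. G x \<noteq> 0"
   and G: "G j = Q^2 * G i" "G i2 = Q^2 * G j2"
  shows "local_int I (r_coef pr y Q K \<sigma> G) (1) X q qi"
proof -
  have s2: "\<sigma> * \<sigma> = 1" using \<sigma> by auto
  have ord: "i < j" "i < j2" "i < i2" "j < j2" "j < i2" "j2 < i2" using ord by auto
  note o = ord ord[THEN less_imp_neq] ord[THEN less_imp_neq, THEN not_sym] ord[THEN less_not_sym]
  have dist: "distinct [i,j,i2,j2]" using o by simp
  have x: "x \<notin> {i,j,i2,j2} \<and> pr x \<notin> {i,j,i2,j2}" (is ?A)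
    "(x < i \<and> \<not> i < x \<and> x < j \<and> \<not> j < x \<or> i < x \<and> \<not> x < i \<and> j < x \<and> \<not> x <
      j) \<and> (x < j2 \<and> \<not> j2 < x \<and> x < i2 \<and> \<not> i2 < x \<or> j2 < x \<and> \<not> x < j2 \<and> i2 < x
      \<and> \<not> x < i2)" (is ?B) if "x \<in> I - {i,j,i2,j2}" for x
  proof -
    have "pr (pr x) = x" using prI that by simp
    then show ?A using pr that by auto
    show ?B using btw[OF that] by auto
  qed
  show ?thesis
    by (rule local_int_D[where i=i and j=j and ?i2.0=i2 and ?j2.0=j2, OF I pr prI dist X q qi];
       (frule x(1), drule x(2), elim conjE disjE)?;
       (use \<tau> s2 nz in \<open>simp add: F_coef_def V_coef_def pr o G field_simps power2_eq_square power4_eq_xxxx\<close>))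
qed

text \<open>In the transposed vector j precedes i, so the upper and lower branches of
  \<open>F_coef\<close> and \<open>V_coef\<close> trade places. Accordingly G grows from j to i, and
  Q is replaced by its inverse in the diagonals.\<close>

lemma local_int_bulk_transp:
  fixes i j i2 j2 :: nat
  assumes I: "finite I" "i \<in> I" "j \<in> I" "i2 \<in> I" "j2 \<in> I"
   and pr: "pr i = i2" "pr j = j2" "pr i2 = i" "pr j2 = j"
   and prI: "\<And>x. x \<in> I \<Longrightarrow> pr x \<in> I \<and> pr (pr x) = x"
   and ord: "j < i" "i < i2" "i2 < j2"
   and btw: "\<And>x. x \<in> I - {i,j,i2,j2} \<Longrightarrow> (x < i \<and> x < j \<or> i < x \<and> j < x) \<and> (x < j2
     \<and> x < i2 \<or> j2 < x \<and> i2 < x)"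
   and X: "\<And>s c. X s c = (if s = i \<and> c = j then 1 else 0) + (if s = j2 \<and> c = i2 then 1 else (0::complex))"
   and q: "q i = \<tau>/Q" "q j = -\<tau>*Q" "q i2 = \<tau>*Q" "q j2 = -\<tau>/Q"
     "\<And>x. x \<notin> {i,j,i2,j2} \<Longrightarrow> q x = 1"
   and qi: "qi i = \<tau>*Q" "qi j = -\<tau>/Q" "qi i2 = \<tau>/Q" "qi j2 = -\<tau>*Q"
     "\<And>x. x \<notin> {i,j,i2,j2} \<Longrightarrow> qi x = 1"
   and \<tau>: "\<tau> * \<tau> = 1" and \<sigma>: "\<sigma> = 1 \<or> \<sigma> = - 1"
   and nz: "y \<noteq> 0" "Q \<noteq> 0" "K \<noteq> 0" "\<And>x. G x \<noteq> 0"
   and G: "G i = Q^2 * G j" "G j2 = Q^2 * G i2"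
  shows "local_int I (r_coef pr y Q K \<sigma> G) (1) X q qi"
proof -
  have s2: "\<sigma> * \<sigma> = 1" using \<sigma> by auto
  have ord: "j < i" "j < i2" "j < j2" "i < i2" "i < j2" "i2 < j2" using ord by auto
  note o = ord ord[THEN less_imp_neq] ord[THEN less_imp_neq, THEN not_sym] ord[THEN less_not_sym]
  have dist: "distinct [i,j,i2,j2]" using o by simp
  have x: "x \<notin> {i,j,i2,j2} \<and> pr x \<notin> {i,j,i2,j2}" (is ?A)
    "(x < i \<and> \<not> i < x \<and> x < j \<and> \<not> j < x \<or> i < x \<and> \<not> x < i \<and> j < x \<and> \<not> x <
      j) \<and> (x < j2 \<and> \<not> j2 < x \<and> x < i2 \<and> \<not> i2 < x \<or> j2 < x \<and> \<not> x < j2 \<and> i2 < x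
      \<and> \<not> x < i2)" (is ?B) if "x \<in> I - {i,j,i2,j2}" for x
  proof -
    have "pr (pr x) = x" using prI that by simp
    then show ?A using pr that by auto
    show ?B using btw[OF that] by auto
  qed
  show ?thesis
    by (rule local_int_D[where i=i and j=j and ?i2.0=i2 and ?j2.0=j2, OF I pr prI dist X q qi];
       (frule x(1), drule x(2), elim conjE disjE)?;
       (use \<tau> s2 nz in \<open>simp add: F_coef_def V_coef_def pr o G field_simps power2_eq_square power4_eq_xxxx\<close>))
qed

text \<open>At a fork the four indices interlace as i < j2 < j < i2, with the dual pair j2, j in the
  middle. A spectator lies on one side of all four, and G takes the same value at j and j2.\<close>

lemma local_int_D_end:
  fixes i j i2 j2 :: nat
  assumes I: "finite I" "i \<in> I" "j \<in> I" "i2 \<in> I" "j2 \<in> I"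
   and pr: "pr i = i2" "pr j = j2" "pr i2 = i" "pr j2 = j"
   and prI: "\<And>x. x \<in> I \<Longrightarrow> pr x \<in> I \<and> pr (pr x) = x"
   and ord: "i < j2" "j2 < j" "j < i2"
   and btw: "\<And>x. x \<in> I - {i,j,i2,j2} \<Longrightarrow> (x < i \<and> x < j \<and> x < j2 \<and> x < i2 \<or> i < x
     \<and> j < x \<and> j2 < x \<and> i2 < x)"
   and X: "\<And>s c. X s c = (if s = i \<and> c = j then 1 else 0) + (if s = j2 \<and> c = i2 then 1 else (0::complex))"
   and q: "q i = \<tau>*Q" "q j = -\<tau>/Q" "q i2 = \<tau>/Q" "q j2 = -\<tau>*Q"
     "\<And>x. x \<notin> {i,j,i2,j2} \<Longrightarrow> q x = 1"
   and qi: "qi i = \<tau>/Q" "qi j = -\<tau>*Q" "qi i2 = \<tau>*Q" "qi j2 = -\<tau>/Q"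
     "\<And>x. x \<notin> {i,j,i2,j2} \<Longrightarrow> qi x = 1"
   and \<tau>: "\<tau> * \<tau> = 1" and \<sigma>: "\<sigma> = 1 \<or> \<sigma> = - 1"
   and nz: "y \<noteq> 0" "Q \<noteq> 0" "K \<noteq> 0" "\<And>x. G x \<noteq> 0"
   and G: "G j = Q^2 * G i" "G j2 = Q^2 * G i" "G i2 = Q^2 * (Q^2 * G i)"
  shows "local_int I (r_coef pr y Q K \<sigma> G) (1) X q qi"
proof -
  have s2: "\<sigma> * \<sigma> = 1" using \<sigma> by auto
  have ord: "i < j2" "i < j" "i < i2" "j2 < j" "j2 < i2" "j < i2" using ord by auto
  note o = ord ord[THEN less_imp_neq] ord[THEN less_imp_neq, THEN not_sym] ord[THEN less_not_sym]
  have dist: "distinct [i,j,i2,j2]" using o by simp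
  have x: "x \<notin> {i,j,i2,j2} \<and> pr x \<notin> {i,j,i2,j2}" (is ?A)
    "(x < i \<and> \<not> i < x \<and> x < j \<and> \<not> j < x \<and> x < j2 \<and> \<not> j2 < x \<and> x < i2 \<and> \<not>
      i2 < x \<or> i < x \<and> \<not> x < i \<and> j < x \<and> \<not> x < j \<and> j2 < x \<and> \<not> x < j2 \<and> i2 < x
      \<and> \<not> x < i2)" (is ?B) if "x \<in> I - {i,j,i2,j2}" for x
  proof -
    have "pr (pr x) = x" using prI that by simp
    then show ?A using pr that by auto
    show ?B using btw[OF that] by auto
  qed
  show ?thesis
    by (rule local_int_D[where i=i and j=j and ?i2.0=i2 and ?j2.0=j2, OF I pr prI dist X q qi];
       (frule x(1), drule x(2), elim conjE disjE)?;
       (use \<tau> s2 nz in \<open>simp add: F_coef_def V_coef_def pr o G field_simps power2_eq_square power4_eq_xxxx\<close>))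
qed

lemma local_int_D_end_transp:
  fixes i j i2 j2 :: nat
  assumes I: "finite I" "i \<in> I" "j \<in> I" "i2 \<in> I" "j2 \<in> I"
   and pr: "pr i = i2" "pr j = j2" "pr i2 = i" "pr j2 = j"
   and prI: "\<And>x. x \<in> I \<Longrightarrow> pr x \<in> I \<and> pr (pr x) = x"
   and ord: "j < i2" "i2 < i" "i < j2"
   and btw: "\<And>x. x \<in> I - {i,j,i2,j2} \<Longrightarrow> (x < i \<and> x < j \<and> x < j2 \<and> x < i2 \<or> i < x
     \<and> j < x \<and> j2 < x \<and> i2 < x)"
   and X: "\<And>s c. X s c = (if s = i \<and> c = j then 1 else 0) + (if s = j2 \<and> c = i2 then 1 else (0::complex))"
   and q: "q i = \<tau>/Q" "q j = -\<tau>*Q" "q i2 = \<tau>*Q" "q j2 = -\<tau>/Q"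
     "\<And>x. x \<notin> {i,j,i2,j2} \<Longrightarrow> q x = 1"
   and qi: "qi i = \<tau>*Q" "qi j = -\<tau>/Q" "qi i2 = \<tau>/Q" "qi j2 = -\<tau>*Q"
     "\<And>x. x \<notin> {i,j,i2,j2} \<Longrightarrow> qi x = 1"
   and \<tau>: "\<tau> * \<tau> = 1" and \<sigma>: "\<sigma> = 1 \<or> \<sigma> = - 1"
   and nz: "y \<noteq> 0" "Q \<noteq> 0" "K \<noteq> 0" "\<And>x. G x \<noteq> 0"
   and G: "G i = Q^2 * G j" "G i2 = Q^2 * G j" "G j2 = Q^2 * (Q^2 * G j)"
  shows "local_int I (r_coef pr y Q K \<sigma> G) (1) X q qi"
proof -
  have s2: "\<sigma> * \<sigma> = 1" using \<sigma> by auto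
  have ord: "j < i2" "j < i" "j < j2" "i2 < i" "i2 < j2" "i < j2" using ord by auto
  note o = ord ord[THEN less_imp_neq] ord[THEN less_imp_neq, THEN not_sym] ord[THEN less_not_sym]
  have dist: "distinct [i,j,i2,j2]" using o by simp
  have x: "x \<notin> {i,j,i2,j2} \<and> pr x \<notin> {i,j,i2,j2}" (is ?A)
    "(x < i \<and> \<not> i < x \<and> x < j \<and> \<not> j < x \<and> x < j2 \<and> \<not> j2 < x \<and> x < i2 \<and> \<not>
      i2 < x \<or> i < x \<and> \<not> x < i \<and> j < x \<and> \<not> x < j \<and> j2 < x \<and> \<not> x < j2 \<and> i2 < x
      \<and> \<not> x < i2)" (is ?B) if "x \<in> I - {i,j,i2,j2}" for x
  proof -
    have "pr (pr x) = x" using prI that by simp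
    then show ?A using pr that by auto
    show ?B using btw[OF that] by auto
  qed
  show ?thesis
    by (rule local_int_D[where i=i and j=j and ?i2.0=i2 and ?j2.0=j2, OF I pr prI dist X q qi];
       (frule x(1), drule x(2), elim conjE disjE)?;
       (use \<tau> s2 nz in \<open>simp add: F_coef_def V_coef_def pr o G field_simps power2_eq_square power4_eq_xxxx\<close>))
qed

text \<open>The affine vector spans the whole index range, so every spectator lies between its ends.
  \<open>F_coef\<close> then takes opposite branches there, y against 1/y, which is why the weight
  is y^2. The factor \<sigma> * K^2 in the G-ratios compensates the prefactors \<sigma> * K and 1/K
  that distinguish the two branches of \<open>V_coef\<close>.\<close>

lemma local_int_D_affine:
  fixes i j i2 j2 :: nat
  assumes I: "finite I" "i \<in> I" "j \<in> I" "i2 \<in> I" "j2 \<in> I"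
   and pr: "pr i = i2" "pr j = j2" "pr i2 = i" "pr j2 = j"
   and prI: "\<And>x. x \<in> I \<Longrightarrow> pr x \<in> I \<and> pr (pr x) = x"
   and ord: "j < i2" "i2 < i" "i < j2"
   and btw: "\<And>x. x \<in> I - {i,j,i2,j2} \<Longrightarrow> j < x \<and> i2 < x \<and> x < i \<and> x < j2"
   and X: "\<And>s c. X s c = (if s = i \<and> c = j then 1 else 0) + (if s = j2 \<and> c = i2 then 1 else (0::complex))"
   and q: "q i = \<tau>*Q" "q j = -\<tau>/Q" "q i2 = \<tau>/Q" "q j2 = -\<tau>*Q"
     "\<And>x. x \<notin> {i,j,i2,j2} \<Longrightarrow> q x = 1"
   and qi: "qi i = \<tau>/Q" "qi j = -\<tau>*Q" "qi i2 = \<tau>*Q" "qi j2 = -\<tau>/Q"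
     "\<And>x. x \<notin> {i,j,i2,j2} \<Longrightarrow> qi x = 1"
   and \<tau>: "\<tau> * \<tau> = 1" and \<sigma>: "\<sigma> = 1 \<or> \<sigma> = - 1"
   and nz: "y \<noteq> 0" "Q \<noteq> 0" "K \<noteq> 0" "\<And>x. G x \<noteq> 0"
   and G: "G i = \<sigma> * K^2 / Q^2 * G j" "G i2 = Q^2 * G j" "G j2 = \<sigma> * K^2 * G j"
  shows "local_int I (r_coef pr y Q K \<sigma> G) (y^2) X q qi"
proof -
  have ord: "j < i2" "j < i" "j < j2" "i2 < i" "i2 < j2" "i < j2" using ord by auto
  note o = ord ord[THEN less_imp_neq] ord[THEN less_imp_neq, THEN not_sym] ord[THEN less_not_sym]
  have dist: "distinct [i,j,i2,j2]" using o by simp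
  have x: "x \<notin> {i,j,i2,j2} \<and> pr x \<notin> {i,j,i2,j2}" (is ?A)
    "j < x \<and> \<not> x < j \<and> i2 < x \<and> \<not> x < i2 \<and> x < i \<and> \<not> i < x \<and> x < j2 \<and> \<not> j2
      < x" (is ?B) if "x \<in> I - {i,j,i2,j2}" for x
  proof -
    have "pr (pr x) = x" using prI that by simp
    then show ?A using pr that by auto
    show ?B using btw[OF that] by auto
  qed
  show ?thesis
    by (rule local_int_D[where i=i and j=j and ?i2.0=i2 and ?j2.0=j2, OF I pr prI dist X q qi];
       (frule x(1), drule x(2), elim conjE disjE)?;
       (rule disjE[OF \<sigma>]; use \<tau> nz in \<open>simp add: F_coef_def V_coef_def pr o G field_simps power2_eq_square
         power4_eq_xxxx\<close>))
qed

text \<open>Reversing the affine vector reverses the comparison of the branches, so the weight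
  becomes 1/y^2.\<close>

lemma local_int_D_affine_transp:
  fixes i j i2 j2 :: nat
  assumes I: "finite I" "i \<in> I" "j \<in> I" "i2 \<in> I" "j2 \<in> I"
   and pr: "pr i = i2" "pr j = j2" "pr i2 = i" "pr j2 = j"
   and prI: "\<And>x. x \<in> I \<Longrightarrow> pr x \<in> I \<and> pr (pr x) = x"
   and ord: "i < j2" "j2 < j" "j < i2"
   and btw: "\<And>x. x \<in> I - {i,j,i2,j2} \<Longrightarrow> i < x \<and> j2 < x \<and> x < j \<and> x < i2"
   and X: "\<And>s c. X s c = (if s = i \<and> c = j then 1 else 0) + (if s = j2 \<and> c = i2 then 1 else (0::complex))"
   and q: "q i = \<tau>/Q" "q j = -\<tau>*Q" "q i2 = \<tau>*Q" "q j2 = -\<tau>/Q"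
     "\<And>x. x \<notin> {i,j,i2,j2} \<Longrightarrow> q x = 1"
   and qi: "qi i = \<tau>*Q" "qi j = -\<tau>/Q" "qi i2 = \<tau>/Q" "qi j2 = -\<tau>*Q"
     "\<And>x. x \<notin> {i,j,i2,j2} \<Longrightarrow> qi x = 1"
   and \<tau>: "\<tau> * \<tau> = 1" and \<sigma>: "\<sigma> = 1 \<or> \<sigma> = - 1"
   and nz: "y \<noteq> 0" "Q \<noteq> 0" "K \<noteq> 0" "\<And>x. G x \<noteq> 0"
   and G: "G j = \<sigma> * K^2 / Q^2 * G i" "G j2 = Q^2 * G i" "G i2 = \<sigma> * K^2 * G i"
  shows "local_int I (r_coef pr y Q K \<sigma> G) (1/y^2) X q qi"
proof -
  have ord: "i < j2" "i < j" "i < i2" "j2 < j" "j2 < i2" "j < i2" using ord by auto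
  note o = ord ord[THEN less_imp_neq] ord[THEN less_imp_neq, THEN not_sym] ord[THEN less_not_sym]
  have dist: "distinct [i,j,i2,j2]" using o by simp
  have x: "x \<notin> {i,j,i2,j2} \<and> pr x \<notin> {i,j,i2,j2}" (is ?A)
    "i < x \<and> \<not> x < i \<and> j2 < x \<and> \<not> x < j2 \<and> x < j \<and> \<not> j < x \<and> x < i2 \<and> \<not> i2
      < x" (is ?B) if "x \<in> I - {i,j,i2,j2}" for x
  proof -
    have "pr (pr x) = x" using prI that by simp
    then show ?A using pr that by auto
    show ?B using btw[OF that] by auto
  qed
  show ?thesis
    by (rule local_int_D[where i=i and j=j and ?i2.0=i2 and ?j2.0=j2, OF I pr prI dist X q qi];
       (frule x(1), drule x(2), elim conjE disjE)?;
       (rule disjE[OF \<sigma>]; use \<tau> nz in \<open>simp add: F_coef_def V_coef_def pr o G field_simps power2_eq_square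
         power4_eq_xxxx\<close>))
qed

text \<open>The diagonal of Q carries no sign here. The cancellation in p1 * V x i + q1 * V x i2 = 0
  comes instead from the negative ratio of G, which records the change of \<open>eps\<close> across
  the middle.\<close>

lemma local_int_C_end:
  fixes i i2 :: nat
  assumes I: "finite I" "i \<in> I" "i2 \<in> I"
   and pr: "pr i = i2" "pr i2 = i"
   and prI: "\<And>x. x \<in> I \<Longrightarrow> pr x \<in> I \<and> pr (pr x) = x"
   and ord: "i < i2"
   and btw: "\<And>x. x \<in> I - {i,i2} \<Longrightarrow> (x < i \<and> x < i2 \<or> i < x \<and> i2 < x)"
   and X: "\<And>s c. X s c = (if s = i \<and> c = i2 then 1 else (0::complex))"
   and q: "q i = Q^2" "q i2 = 1/Q^2" "\<And>x. x \<notin> {i,i2} \<Longrightarrow> q x = 1"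
   and qi: "qi i = 1/Q^2" "qi i2 = Q^2" "\<And>x. x \<notin> {i,i2} \<Longrightarrow> qi x = 1"
   and \<sigma>: "\<sigma> = 1 \<or> \<sigma> = - 1"
   and nz: "y \<noteq> 0" "Q \<noteq> 0" "K \<noteq> 0" "\<And>x. G x \<noteq> 0"
   and G: "G i2 = - (Q^4 * G i)"
  shows "local_int I (r_coef pr y Q K \<sigma> G) (1) X q qi"
proof -
  have s2: "\<sigma> * \<sigma> = 1" using \<sigma> by auto
  have ord: "i < i2" using ord by auto
  note o = ord ord[THEN less_imp_neq] ord[THEN less_imp_neq, THEN not_sym] ord[THEN less_not_sym]
  have dist: "distinct [i,i2]" using o by simp
  have x: "x \<notin> {i,i2} \<and> pr x \<notin> {i,i2}" (is ?A)
    "(x < i \<and> \<not> i < x \<and> x < i2 \<and> \<not> i2 < x \<or> i < x \<and> \<not> x < i \<and> i2 < x \<and> \<not> x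
      < i2)" (is ?B) if "x \<in> I - {i,i2}" for x
  proof -
    have "pr (pr x) = x" using prI that by simp
    then show ?A using pr that by auto
    show ?B using btw[OF that] by auto
  qed
  show ?thesis
    by (rule local_int_C[where i=i and ?i2.0=i2, OF I pr prI dist X q qi];
       (frule x(1), drule x(2), elim conjE disjE)?;
       (use s2 nz in \<open>simp add: F_coef_def V_coef_def pr o G field_simps power2_eq_square power4_eq_xxxx\<close>))
qed

lemma local_int_C_end_transp:
  fixes i i2 :: nat
  assumes I: "finite I" "i \<in> I" "i2 \<in> I"
   and pr: "pr i = i2" "pr i2 = i"
   and prI: "\<And>x. x \<in> I \<Longrightarrow> pr x \<in> I \<and> pr (pr x) = x"
   and ord: "i2 < i"
   and btw: "\<And>x. x \<in> I - {i,i2} \<Longrightarrow> (x < i \<and> x < i2 \<or> i < x \<and> i2 < x)"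
   and X: "\<And>s c. X s c = (if s = i \<and> c = i2 then 1 else (0::complex))"
   and q: "q i = 1/Q^2" "q i2 = Q^2" "\<And>x. x \<notin> {i,i2} \<Longrightarrow> q x = 1"
   and qi: "qi i = Q^2" "qi i2 = 1/Q^2" "\<And>x. x \<notin> {i,i2} \<Longrightarrow> qi x = 1"
   and \<sigma>: "\<sigma> = 1 \<or> \<sigma> = - 1"
   and nz: "y \<noteq> 0" "Q \<noteq> 0" "K \<noteq> 0" "\<And>x. G x \<noteq> 0"
   and G: "G i = - (Q^4 * G i2)"
  shows "local_int I (r_coef pr y Q K \<sigma> G) (1) X q qi"
proof -
  have s2: "\<sigma> * \<sigma> = 1" using \<sigma> by auto
  have ord: "i2 < i" using ord by auto
  note o = ord ord[THEN less_imp_neq] ord[THEN less_imp_neq, THEN not_sym] ord[THEN less_not_sym]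
  have dist: "distinct [i,i2]" using o by simp
  have x: "x \<notin> {i,i2} \<and> pr x \<notin> {i,i2}" (is ?A)
    "(x < i \<and> \<not> i < x \<and> x < i2 \<and> \<not> i2 < x \<or> i < x \<and> \<not> x < i \<and> i2 < x \<and> \<not> x
      < i2)" (is ?B) if "x \<in> I - {i,i2}" for x
  proof -
    have "pr (pr x) = x" using prI that by simp
    then show ?A using pr that by auto
    show ?B using btw[OF that] by auto
  qed
  show ?thesis
    by (rule local_int_C[where i=i and ?i2.0=i2, OF I pr prI dist X q qi];
       (frule x(1), drule x(2), elim conjE disjE)?;
       (use s2 nz in \<open>simp add: F_coef_def V_coef_def pr o G field_simps power2_eq_square power4_eq_xxxx\<close>))
qed

text \<open>The G-ratio - \<sigma> * K^2 / Q^4 covers a sign change of \<open>eps\<close> with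
  \<sigma> = 1 as well as constant \<open>eps\<close> with \<sigma> = - 1, so that \<open>C1\<close>
  and \<open>A2_even\<close> are treated together.\<close>

lemma local_int_C_affine:
  fixes i i2 :: nat
  assumes I: "finite I" "i \<in> I" "i2 \<in> I"
   and pr: "pr i = i2" "pr i2 = i"
   and prI: "\<And>x. x \<in> I \<Longrightarrow> pr x \<in> I \<and> pr (pr x) = x"
   and ord: "i2 < i"
   and btw: "\<And>x. x \<in> I - {i,i2} \<Longrightarrow> i2 < x \<and> x < i"
   and X: "\<And>s c. X s c = (if s = i \<and> c = i2 then 1 else (0::complex))"
   and q: "q i = Q^2" "q i2 = 1/Q^2" "\<And>x. x \<notin> {i,i2} \<Longrightarrow> q x = 1"
   and qi: "qi i = 1/Q^2" "qi i2 = Q^2" "\<And>x. x \<notin> {i,i2} \<Longrightarrow> qi x = 1"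
   and \<sigma>: "\<sigma> = 1 \<or> \<sigma> = - 1"
   and nz: "y \<noteq> 0" "Q \<noteq> 0" "K \<noteq> 0" "\<And>x. G x \<noteq> 0"
   and G: "G i = - (\<sigma> * K^2 / Q^4 * G i2)"
  shows "local_int I (r_coef pr y Q K \<sigma> G) (y^2) X q qi"
proof -
  have ord: "i2 < i" using ord by auto
  note o = ord ord[THEN less_imp_neq] ord[THEN less_imp_neq, THEN not_sym] ord[THEN less_not_sym]
  have dist: "distinct [i,i2]" using o by simp
  have x: "x \<notin> {i,i2} \<and> pr x \<notin> {i,i2}" (is ?A)
    "i2 < x \<and> \<not> x < i2 \<and> x < i \<and> \<not> i < x" (is ?B) if "x \<in> I - {i,i2}" for x
  proof -
    have "pr (pr x) = x" using prI that by simp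
    then show ?A using pr that by auto
    show ?B using btw[OF that] by auto
  qed
  show ?thesis
    by (rule local_int_C[where i=i and ?i2.0=i2, OF I pr prI dist X q qi];
       (frule x(1), drule x(2), elim conjE disjE)?;
       (rule disjE[OF \<sigma>]; use nz in \<open>simp add: F_coef_def V_coef_def pr o G field_simps power2_eq_square
         power4_eq_xxxx\<close>))
qed

lemma local_int_C_affine_transp:
  fixes i i2 :: nat
  assumes I: "finite I" "i \<in> I" "i2 \<in> I"
   and pr: "pr i = i2" "pr i2 = i"
   and prI: "\<And>x. x \<in> I \<Longrightarrow> pr x \<in> I \<and> pr (pr x) = x"
   and ord: "i < i2"
   and btw: "\<And>x. x \<in> I - {i,i2} \<Longrightarrow> i < x \<and> x < i2"
   and X: "\<And>s c. X s c = (if s = i \<and> c = i2 then 1 else (0::complex))"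
   and q: "q i = 1/Q^2" "q i2 = Q^2" "\<And>x. x \<notin> {i,i2} \<Longrightarrow> q x = 1"
   and qi: "qi i = Q^2" "qi i2 = 1/Q^2" "\<And>x. x \<notin> {i,i2} \<Longrightarrow> qi x = 1"
   and \<sigma>: "\<sigma> = 1 \<or> \<sigma> = - 1"
   and nz: "y \<noteq> 0" "Q \<noteq> 0" "K \<noteq> 0" "\<And>x. G x \<noteq> 0"
   and G: "G i2 = - (\<sigma> * K^2 / Q^4 * G i)"
  shows "local_int I (r_coef pr y Q K \<sigma> G) (1/y^2) X q qi"
proof -
  have ord: "i < i2" using ord by auto
  note o = ord ord[THEN less_imp_neq] ord[THEN less_imp_neq, THEN not_sym] ord[THEN less_not_sym]
  have dist: "distinct [i,i2]" using o by simp
  have x: "x \<notin> {i,i2} \<and> pr x \<notin> {i,i2}" (is ?A)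
    "i < x \<and> \<not> x < i \<and> x < i2 \<and> \<not> i2 < x" (is ?B) if "x \<in> I - {i,i2}" for x
  proof -
    have "pr (pr x) = x" using prI that by simp
    then show ?A using pr that by auto
    show ?B using btw[OF that] by auto
  qed
  show ?thesis
    by (rule local_int_C[where i=i and ?i2.0=i2, OF I pr prI dist X q qi];
       (frule x(1), drule x(2), elim conjE disjE)?;
       (rule disjE[OF \<sigma>]; use nz in \<open>simp add: F_coef_def V_coef_def pr o G field_simps power2_eq_square
         power4_eq_xxxx\<close>))
qed

text \<open>The middle index splits the vector into two half steps: G grows by Q from i to m and
  again from m to i2, and q is 1 at m. The minus sign of q at the ends is forced by p1 * V x i + V x
  m = 0.\<close>

lemma local_int_B_end:
  fixes i m i2 :: nat
  assumes I: "finite I" "i \<in> I" "m \<in> I" "i2 \<in> I"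
   and pr: "pr i = i2" "pr m = m" "pr i2 = i"
   and prI: "\<And>x. x \<in> I \<Longrightarrow> pr x \<in> I \<and> pr (pr x) = x"
   and ord: "i < m" "m < i2"
   and btw: "\<And>x. x \<in> I - {i,m,i2} \<Longrightarrow> (x < i \<and> x < m \<and> x < i2 \<or> i < x \<and> m < x \<and> i2
     < x)"
   and X: "\<And>s c. X s c = (if s = i \<and> c = m then 1 else 0) + (if s = m \<and> c = i2 then 1 else (0::complex))"
   and q: "q i = -Q" "q i2 = -1/Q" "q m = 1" "\<And>x. x \<notin> {i,m,i2} \<Longrightarrow> q x = 1"
   and qi: "qi i = -1/Q" "qi i2 = -Q" "qi m = 1" "\<And>x. x \<notin> {i,m,i2} \<Longrightarrow> qi x = 1"
   and \<sigma>: "\<sigma> = 1 \<or> \<sigma> = - 1"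
   and nz: "y \<noteq> 0" "Q \<noteq> 0" "K \<noteq> 0" "\<And>x. G x \<noteq> 0"
   and G: "G m = Q * G i" "G i2 = Q^2 * G i"
  shows "local_int I (r_coef pr y Q K \<sigma> G) (1) X q qi"
proof -
  have s2: "\<sigma> * \<sigma> = 1" using \<sigma> by auto
  have ord: "i < m" "i < i2" "m < i2" using ord by auto
  note o = ord ord[THEN less_imp_neq] ord[THEN less_imp_neq, THEN not_sym] ord[THEN less_not_sym]
  have dist: "distinct [i,m,i2]" using o by simp
  have x: "x \<notin> {i,m,i2} \<and> pr x \<notin> {i,m,i2}" (is ?A)
    "(x < i \<and> \<not> i < x \<and> x < m \<and> \<not> m < x \<and> x < i2 \<and> \<not> i2 < x \<or> i < x \<and> \<not> x <
      i \<and> m < x \<and> \<not> x < m \<and> i2 < x \<and> \<not> x < i2)" (is ?B) if "x \<in> I - {i,m,i2}" for x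
  proof -
    have "pr (pr x) = x" using prI that by simp
    then show ?A using pr that by auto
    show ?B using btw[OF that] by auto
  qed
  show ?thesis
    by (rule local_int_B[where i=i and m=m and ?i2.0=i2, OF I pr prI dist X q qi];
       (frule x(1), drule x(2), elim conjE disjE)?;
       (use s2 nz in \<open>simp add: F_coef_def V_coef_def pr o G field_simps power2_eq_square power4_eq_xxxx\<close>))
qed

lemma local_int_B_end_transp:
  fixes i m i2 :: nat
  assumes I: "finite I" "i \<in> I" "m \<in> I" "i2 \<in> I"
   and pr: "pr i = i2" "pr m = m" "pr i2 = i"
   and prI: "\<And>x. x \<in> I \<Longrightarrow> pr x \<in> I \<and> pr (pr x) = x"
   and ord: "i2 < m" "m < i"
   and btw: "\<And>x. x \<in> I - {i,m,i2} \<Longrightarrow> (x < i \<and> x < m \<and> x < i2 \<or> i < x \<and> m < x \<and> i2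
     < x)"
   and X: "\<And>s c. X s c = (if s = i \<and> c = m then 1 else 0) + (if s = m \<and> c = i2 then 1 else (0::complex))"
   and q: "q i = -1/Q" "q i2 = -Q" "q m = 1" "\<And>x. x \<notin> {i,m,i2} \<Longrightarrow> q x = 1"
   and qi: "qi i = -Q" "qi i2 = -1/Q" "qi m = 1" "\<And>x. x \<notin> {i,m,i2} \<Longrightarrow> qi x = 1"
   and \<sigma>: "\<sigma> = 1 \<or> \<sigma> = - 1"
   and nz: "y \<noteq> 0" "Q \<noteq> 0" "K \<noteq> 0" "\<And>x. G x \<noteq> 0"
   and G: "G m = Q * G i2" "G i = Q^2 * G i2"
  shows "local_int I (r_coef pr y Q K \<sigma> G) (1) X q qi"
proof -
  have s2: "\<sigma> * \<sigma> = 1" using \<sigma> by auto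
  have ord: "i2 < m" "i2 < i" "m < i" using ord by auto
  note o = ord ord[THEN less_imp_neq] ord[THEN less_imp_neq, THEN not_sym] ord[THEN less_not_sym]
  have dist: "distinct [i,m,i2]" using o by simp
  have x: "x \<notin> {i,m,i2} \<and> pr x \<notin> {i,m,i2}" (is ?A)
    "(x < i \<and> \<not> i < x \<and> x < m \<and> \<not> m < x \<and> x < i2 \<and> \<not> i2 < x \<or> i < x \<and> \<not> x <
      i \<and> m < x \<and> \<not> x < m \<and> i2 < x \<and> \<not> x < i2)" (is ?B) if "x \<in> I - {i,m,i2}" for x
  proof -
    have "pr (pr x) = x" using prI that by simp
    then show ?A using pr that by auto
    show ?B using btw[OF that] by auto
  qed
  show ?thesis
    by (rule local_int_B[where i=i and m=m and ?i2.0=i2, OF I pr prI dist X q qi];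
       (frule x(1), drule x(2), elim conjE disjE)?;
       (use s2 nz in \<open>simp add: F_coef_def V_coef_def pr o G field_simps power2_eq_square power4_eq_xxxx\<close>))
qed

subsection \<open>Tensor products of operators\<close>

text \<open>\<open>restrict\<close> makes the digit sequence extensional, so that it lands in a
  finite function space with exactly d ^ L elements.\<close>

definition digits :: "nat \<Rightarrow> nat \<Rightarrow> nat \<Rightarrow> (nat \<Rightarrow> nat)" where
  "digits d L x = restrict (\<lambda>k. tensor_digit d L k x) {..<L}"

abbreviation words :: "nat \<Rightarrow> nat \<Rightarrow> (nat \<Rightarrow> nat) set" where
  "words d L \<equiv> {..<L} \<rightarrow>\<^sub>E {..<d}"

lemma tensor_digit_0: "x < d ^ Suc L \<Longrightarrow> tensor_digit d (Suc L) 0 x = x div d ^ L"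
  by (simp add: tensor_digit_def less_mult_imp_div_less)

lemma tensor_digit_Suc:
  assumes "k < L"
  shows "tensor_digit d (Suc L) (Suc k) x = tensor_digit d L k (x mod d ^ L)"
proof -
  define m where "m = L - 1 - k"
  have L: "d ^ L = d ^ m * d ^ Suc k" using assms by (simp add: m_def flip: power_add power_Suc)
  have "(x mod d ^ L) div d ^ m mod d = x div d ^ m mod d"
  proof (cases "d = 0")
    case False
    have "(x mod d ^ L) div d ^ m = x div d ^ m mod d ^ Suc k"
      unfolding L mod_mult2_eq using False by simp
    then show ?thesis by (simp add: mod_mod_cancel)
  qed (use assms in \<open>auto simp: power_0_left m_def\<close>)
  then show ?thesis using assms by (simp add: tensor_digit_def m_def)
qed

lemma digits_inj:
  assumes "x < d ^ L" "y < d ^ L" "\<And>k. k < L \<Longrightarrow> tensor_digit d L k x = tensor_digit d L k y"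
  shows "x = y"
  using assms
proof (induction L arbitrary: x y)
  case (Suc L)
  have "d > 0" using Suc.prems(1) by (metis gr0I not_less_zero power_0_Suc)
  have "x mod d ^ L = y mod d ^ L"
  proof (rule Suc.IH)
    fix k assume k: "k < L"
    show "tensor_digit d L k (x mod d ^ L) = tensor_digit d L k (y mod d ^ L)"
      using Suc.prems(3)[of "Suc k"] k tensor_digit_Suc[OF k] by simp
  qed (use \<open>d > 0\<close> in simp_all)
  moreover have "x div d ^ L = y div d ^ L"
    using Suc.prems(3)[of 0] Suc.prems(1,2) by (simp add: tensor_digit_0)
  ultimately show ?case by (metis div_mult_mod_eq)
qed simp

text \<open>Injectivity and equal cardinalities give surjectivity, so the inverse of the positional
  notation is never written down.\<close>

lemma bij_betw_digits:
  assumes "d > 0"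
  shows "bij_betw (digits d L) {..<d ^ L} (words d L)"
proof -
  have inj: "inj_on (digits d L) {..<d ^ L}"
  proof (rule inj_onI)
    fix x y assume A: "x \<in> {..<d ^ L}" "y \<in> {..<d ^ L}" "digits d L x = digits d L y"
    have "tensor_digit d L k x = tensor_digit d L k y" if "k < L" for k
    proof -
      have "digits d L x k = digits d L y k" using A(3) by simp
      then show ?thesis using that by (simp add: digits_def)
    qed
    then show "x = y" using A digits_inj by auto
  qed
  moreover have sub: "digits d L ` {..<d ^ L} \<subseteq> words d L"
    using assms by (auto simp: digits_def tensor_digit_def split: if_splits)
  moreover have "card (words d L) = card (digits d L ` {..<d ^ L})"
    by (simp add: card_image[OF inj] card_PiE)
  ultimately show ?thesis
    by (metis bij_betw_def card_subset_eq finite_PiE finite_lessThan)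
qed

lemma sum_digits: "d > 0 \<Longrightarrow> (\<Sum>x<d ^ L. g (digits d L x)) = (\<Sum>f\<in>words d L. g f)"
  by (rule sum.reindex_bij_betw[OF bij_betw_digits])

text \<open>Indexing entries by words turns a matrix product into a sum over intermediate words and
  describes operators on adjacent and non-adjacent factors alike.\<close>

definition kernel_mat :: "nat \<Rightarrow> nat \<Rightarrow> ((nat \<Rightarrow> nat) \<Rightarrow> (nat \<Rightarrow> nat)
  \<Rightarrow> complex) \<Rightarrow> complex mat" where
  "kernel_mat d L F = mat (d ^ L) (d ^ L) (\<lambda>(x, y). F (digits d L x) (digits d L y))"

lemma digits_in_words: "d > 0 \<Longrightarrow> x < d ^ L \<Longrightarrow> digits d L x \<in> words d L"
  using bij_betw_digits[of d L] by (auto simp: bij_betw_def)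

lemma kernel_mat_carrier [simp]: "kernel_mat d L F \<in> carrier_mat (d ^ L) (d ^ L)"
  by (simp add: kernel_mat_def)

lemma kernel_mat_cong:
  assumes "d > 0" "\<And>f g. f \<in> words d L \<Longrightarrow> g \<in> words d L \<Longrightarrow> F f g = G f g"
  shows "kernel_mat d L F = kernel_mat d L G"
  using assms digits_in_words by (intro eq_matI) (auto simp: kernel_mat_def)

lemma kernel_mat_add: "kernel_mat d L F + kernel_mat d L G = kernel_mat d L (\<lambda>f g. F f g + G f g)"
  by (intro eq_matI) (auto simp: kernel_mat_def)

lemma kernel_mat_mult:
  assumes "d > 0"
  shows "kernel_mat d L F * kernel_mat d L G = kernel_mat d L (\<lambda>f g. \<Sum>h\<in>words d L. F f h * G h g)"
  using assms by (intro eq_matI)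
    (auto simp: kernel_mat_def scalar_prod_def lessThan_atLeast0[symmetric] sum_digits[symmetric])

text \<open>A two-site operator leaves all other digits alone, so the sum over intermediate words
  collapses to the two digits that may change.\<close>

lemma sum_words_agree:
  assumes f: "f \<in> words d L" and ij: "i < L" "j < L" "i \<noteq> j"
  shows "(\<Sum>h\<in>words d L. if \<forall>k<L. k \<noteq> i \<and> k \<noteq> j \<longrightarrow> f k = h k then w h else 0)
       = (\<Sum>s<d. \<Sum>t<d. w (f(i := s, j := t)))"
proof -
  let ?H = "{h \<in> words d L. \<forall>k<L. k \<noteq> i \<and> k \<noteq> j \<longrightarrow> f k = h k}"
  have "(\<Sum>h\<in>words d L. if \<forall>k<L. k \<noteq> i \<and> k \<noteq> j \<longrightarrow> f k = h k then w h else 0) =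
    sum w ?H"
    by (rule sum.inter_filter[symmetric]) (simp add: finite_PiE)
  also have "\<dots> = (\<Sum>p\<in>{..<d} \<times> {..<d}. w (f(i := fst p, j := snd p)))"
  proof -
    \<comment> \<open>Below L the words differ at most at i and j, and from L on both are undefined
      in the extensional sense; hence h is recovered from f and two digits.\<close>
    have upd: "f(i := h i, j := h j) = h" if "h \<in> ?H" for h
    proof
      fix k show "(f(i := h i, j := h j)) k = h k"
        using that f ij by (cases "k < L") (auto simp: PiE_def extensional_def)
    qed
    show ?thesis
    proof (rule sum.reindex_bij_witness[where i = "\<lambda>p. f(i := fst p, j := snd p)" and j = "\<lambda>h. (h i, h j)"])
      fix h assume h: "h \<in> ?H"
      show "f(i := fst (h i, h j), j := snd (h i, h j)) = h" using upd[OF h] by simp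
      show "w (f(i := fst (h i, h j), j := snd (h i, h j))) = w h" using upd[OF h] by simp
    qed (use f ij in \<open>auto simp: PiE_def Pi_def extensional_def\<close>)
  qed
  also have "\<dots> = (\<Sum>s<d. \<Sum>t<d. w (f(i := s, j := t)))"
    by (simp add: sum.cartesian_product case_prod_unfold)
  finally show ?thesis .
qed

lemma act_on_kernel_mat:
  assumes "i < L" "j < L"
  shows "act_on d L X i j = kernel_mat d L (\<lambda>f g. if \<forall>k<L. k \<noteq> i \<and> k \<noteq> j \<longrightarrow> f k
    = g k
     then X $$ (f i * d + f j, g i * d + g j) else 0)"
  using assms unfolding act_on_def kernel_mat_def digits_def by (intro cong_mat) (auto simp: split_beta)

section \<open>Product operators and two-site exchange relations\<close>

definition tensor_op :: "nat \<Rightarrow> nat \<Rightarrow> (nat \<Rightarrow> complex mat) \<Rightarrow> complex mat" where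
  "tensor_op d L \<phi> = kernel_mat d L (\<lambda>f g. \<Prod>k<L. \<phi> k $$ (f k, g k))"

lemma tensor_op_carrier [simp]: "tensor_op d L \<phi> \<in> carrier_mat (d ^ L) (d ^ L)"
  by (simp add: tensor_op_def)

abbreviation spectators :: "nat \<Rightarrow> nat \<Rightarrow> nat \<Rightarrow> (nat \<Rightarrow> complex mat) \<Rightarrow>
  (nat \<Rightarrow> nat) \<Rightarrow> (nat \<Rightarrow> nat) \<Rightarrow> complex" where
  "spectators L i j \<phi> f g \<equiv> \<Prod>k\<in>{..<L} - {i, j}. \<phi> k $$ (f k, g k)"

lemma prod_split2:
  fixes F :: "nat \<Rightarrow> complex"
  assumes "i < L" "j < L" "i \<noteq> j"
  shows "(\<Prod>k<L. F k) = F i * F j * (\<Prod>k\<in>{..<L} - {i, j}. F k)"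
proof -
  have "(\<Prod>k<L. F k) = F i * (\<Prod>k\<in>{..<L} - {i}. F k)" using assms by (simp add: prod.remove)
  also have "(\<Prod>k\<in>{..<L} - {i}. F k) = F j * (\<Prod>k\<in>{..<L} - {i} - {j}. F k)"
    using assms by (intro prod.remove) auto
  finally show ?thesis by (simp add: Diff_insert2[symmetric] insert_commute mult.assoc)
qed

text \<open>The factors off i and j come out as one scalar, \<open>spectators\<close>, which leaves
  a double sum over the two active digits.\<close>

lemma act_on_mult_tensor_op:
  assumes "d > 0" and ij: "i < L" "j < L" "i \<noteq> j"
  shows "act_on d L X i j * tensor_op d L \<phi> = kernel_mat d L (\<lambda>f g. spectators L i j \<phi> f g *
     (\<Sum>s<d. \<Sum>t<d. X $$ (f i * d + f j, s * d + t) * (\<phi> i $$ (s, g i) * \<phi> j $$ (t, g j))))"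
  unfolding act_on_kernel_mat[OF ij(1,2)] tensor_op_def kernel_mat_mult[OF assms(1)]
proof (rule kernel_mat_cong[OF assms(1)], goal_cases)
  case (1 f g)
  let ?P = "\<lambda>h. X $$ (f i * d + f j, h i * d + h j) * (\<Prod>k<L. \<phi> k $$ (h k, g k))"
  have P: "?P (f(i := s, j := t)) = spectators L i j \<phi> f g *
     (X $$ (f i * d + f j, s * d + t) * (\<phi> i $$ (s, g i) * \<phi> j $$ (t, g j)))" for s t
    using ij by (simp add: prod_split2[OF ij])
  have "(\<Sum>h\<in>words d L. (if \<forall>k<L. k \<noteq> i \<and> k \<noteq> j \<longrightarrow> f k = h k
        then X $$ (f i * d + f j, h i * d + h j) else 0) * (\<Prod>k<L. \<phi> k $$ (h k, g k)))
      = (\<Sum>s<d. \<Sum>t<d. ?P (f(i := s, j := t)))"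
    by (subst sum_words_agree[OF 1(1) ij, where w = ?P, symmetric]) (rule sum.cong, auto)
  then show ?case unfolding P by (simp only: sum_distrib_left)
qed

lemma tensor_op_mult_act_on:
  assumes "d > 0" and ij: "i < L" "j < L" "i \<noteq> j"
  shows "tensor_op d L \<phi> * act_on d L X i j = kernel_mat d L (\<lambda>f g. spectators L i j \<phi> f g *
     (\<Sum>s<d. \<Sum>t<d. (\<phi> i $$ (f i, s) * \<phi> j $$ (f j, t)) * X $$ (s * d + t, g i * d + g j)))"
  unfolding act_on_kernel_mat[OF ij(1,2)] tensor_op_def kernel_mat_mult[OF assms(1)]
proof (rule kernel_mat_cong[OF assms(1)], goal_cases)
  case (1 f g)
  let ?P = "\<lambda>h. (\<Prod>k<L. \<phi> k $$ (f k, h k)) * X $$ (h i * d + h j, g i * d + g j)"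
  have P: "?P (g(i := s, j := t)) = spectators L i j \<phi> f g *
     ((\<phi> i $$ (f i, s) * \<phi> j $$ (f j, t)) * X $$ (s * d + t, g i * d + g j))" for s t
    using ij by (simp add: prod_split2[OF ij])
  have "(\<Sum>h\<in>words d L. (\<Prod>k<L. \<phi> k $$ (f k, h k)) * (if \<forall>k<L. k \<noteq> i \<and> k \<noteq> j
    \<longrightarrow> h k = g k
        then X $$ (h i * d + h j, g i * d + g j) else 0))
      = (\<Sum>s<d. \<Sum>t<d. ?P (g(i := s, j := t)))"
    by (subst sum_words_agree[OF 1(2) ij, where w = ?P, symmetric]) (rule sum.cong, auto)
  then show ?case unfolding P by (simp only: sum_distrib_left)
qed

lemma act_on_exchange:
  assumes "d > 0" and ij: "i < L" "j < L" "i \<noteq> j"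
   and loc: "\<And>a b c e. a < d \<Longrightarrow> b < d \<Longrightarrow> c < d \<Longrightarrow> e < d \<Longrightarrow>
     (\<Sum>s<d. \<Sum>t<d. X $$ (a * d + b, s * d + t) * (A $$ (s, c) * B $$ (t, e)))
   = (\<Sum>s<d. \<Sum>t<d. (A $$ (a, s) * B $$ (b, t)) * X $$ (s * d + t, c * d + e))"
   and \<phi>: "\<phi> i = A" "\<phi> j = B"
  shows "act_on d L X i j * tensor_op d L \<phi> = tensor_op d L \<phi> * act_on d L X i j"
  unfolding act_on_mult_tensor_op[OF assms(1) ij] tensor_op_mult_act_on[OF assms(1) ij] \<phi>
  using ij by (intro kernel_mat_cong[OF assms(1)] arg_cong[where f = "\<lambda>x. _ * x"] loc)
     (auto simp: PiE_def Pi_def)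

text \<open>The hypothesis concerns a sum of two products, so all four product operators need the
  same spectators. \<chi> records this, and the common factor is extracted before the two-site
  identity is applied.\<close>

lemma act_on_exchange2:
  assumes "d > 0" and ij: "i < L" "j < L" "i \<noteq> j"
   and loc: "\<And>a b c e. a < d \<Longrightarrow> b < d \<Longrightarrow> c < d \<Longrightarrow> e < d \<Longrightarrow>
     (\<Sum>s<d. \<Sum>t<d. X $$ (a * d + b, s * d + t) * (U1 $$ (s, c) * W1 $$ (t, e) + U2 $$ (s, c) * W2 $$ (t, e)))
   = (\<Sum>s<d. \<Sum>t<d. (U1' $$ (a, s) * W1' $$ (b, t) + U2' $$ (a, s) * W2' $$ (b, t)) * X $$ (s * d + t, c * d + e))"
   and \<phi>: "\<phi>1 i = U1" "\<phi>1 j = W1" "\<phi>2 i = U2" "\<phi>2 j = W2" "\<psi>1 i = U1'" "\<psi>1 j = W1'"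
     "\<psi>2 i = U2'" "\<psi>2 j = W2'"
   and off: "\<And>k. k < L \<Longrightarrow> k \<noteq> i \<Longrightarrow> k \<noteq> j \<Longrightarrow> \<phi>1 k = \<chi> k
     \<and> \<phi>2 k = \<chi> k \<and> \<psi>1 k = \<chi> k \<and> \<psi>2 k = \<chi> k"
  shows "act_on d L X i j * (tensor_op d L \<phi>1 + tensor_op d L \<phi>2)
       = (tensor_op d L \<psi>1 + tensor_op d L \<psi>2) * act_on d L X i j"
proof -
  have c: "act_on d L X i j \<in> carrier_mat (d ^ L) (d ^ L)" by (simp add: act_on_def)
  have sp: "spectators L i j \<phi>1 f g = spectators L i j \<chi> f g"
    "spectators L i j \<phi>2 f g = spectators L i j \<chi> f g"
     "spectators L i j \<psi>1 f g = spectators L i j \<chi> f g" "spectators L i j \<psi>2 f g = spectators L i j \<chi> f g"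
       for f g
    by (rule prod.cong[OF refl]; use off in force)+
  have "act_on d L X i j * (tensor_op d L \<phi>1 + tensor_op d L \<phi>2) =
     kernel_mat d L (\<lambda>f g. spectators L i j \<chi> f g *
     (\<Sum>s<d. \<Sum>t<d. X $$ (f i * d + f j, s * d + t) *
        (U1 $$ (s, g i) * W1 $$ (t, g j) + U2 $$ (s, g i) * W2 $$ (t, g j))))"
    by (simp add: mult_add_distrib_mat[OF c tensor_op_carrier tensor_op_carrier] act_on_mult_tensor_op[OF assms(1) ij] \<phi> sp
      kernel_mat_add
        sum.distrib distrib_left)
  also have "\<dots> = kernel_mat d L (\<lambda>f g. spectators L i j \<chi> f g *
     (\<Sum>s<d. \<Sum>t<d. (U1' $$ (f i, s) * W1' $$ (f j, t) + U2' $$ (f i, s) * W2' $$ (f j, t)) *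
        X $$ (s * d + t, g i * d + g j)))"
    using ij by (intro kernel_mat_cong[OF assms(1)] arg_cong[where f = "\<lambda>x. _ * x"] loc)
       (auto simp: PiE_def Pi_def)
  also have "\<dots> = (tensor_op d L \<psi>1 + tensor_op d L \<psi>2) * act_on d L X i j"
    by (simp add: add_mult_distrib_mat[OF tensor_op_carrier tensor_op_carrier c] tensor_op_mult_act_on[OF assms(1) ij] \<phi> sp
      kernel_mat_add
        sum.distrib distrib_left distrib_right)
  finally show ?thesis .
qed

text \<open>The leftmost factor is the most significant digit, found by division by d ^ N, and the
  remainder carries the other digits. This links the word description to
  \<open>kron\<close>.\<close>

lemma tensor_op_Suc:
  assumes "d > 0" "\<phi> 0 \<in> carrier_mat d d"
  shows "tensor_op d (Suc N) \<phi> = \<phi> 0 \<otimes>\<^sub>m tensor_op d N (\<lambda>k. \<phi> (Suc k))"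
proof (rule eq_matI, goal_cases)
  case (1 x y)
  then have x: "x < d ^ Suc N" "y < d ^ Suc N" "x div d ^ N < d" "y div d ^ N < d"
    "x mod d ^ N < d ^ N" "y mod d ^ N < d ^ N"
    using assms less_mult_imp_div_less[of _ d "d ^ N"] by (simp_all add: kron_def tensor_op_def kernel_mat_def)
  have "(\<Prod>k<Suc N. \<phi> k $$ (tensor_digit d (Suc N) k x, tensor_digit d (Suc N) k y))
     = \<phi> 0 $$ (x div d ^ N, y div d ^ N) *
       (\<Prod>k<N. \<phi> (Suc k) $$ (tensor_digit d N k (x mod d ^ N), tensor_digit d N k (y mod d ^ N)))"
    unfolding prod.lessThan_Suc_shift using x by (simp add: tensor_digit_0 tensor_digit_Suc)
  then show ?case using x assms
    by (simp add: tensor_op_def kernel_mat_def kron_def digits_def)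
qed (use assms in \<open>auto simp: kron_def tensor_op_def kernel_mat_def\<close>)

lemma kron_list_tensor_op:
  assumes "d > 0" "set As \<subseteq> carrier_mat d d"
  shows "kron_list As = tensor_op d (length As) (\<lambda>k. As ! k)"
  using assms(2)
proof (induction As)
  case Nil
  show ?case by (intro eq_matI) (auto simp: kron_list_def tensor_op_def kernel_mat_def)
next
  case (Cons A As)
  then show ?case using tensor_op_Suc[of d "\<lambda>k. (A # As) ! k" "length As"] assms(1)
    by (simp add: kron_list_def)
qed

subsection \<open>Transporting the coproduct through the monodromy matrix\<close>

lemma act_on_carrier [simp]: "act_on d L X i j \<in> carrier_mat (d ^ L) (d ^ L)"
  by (simp add: act_on_def)

lemma mat_sum_carrier [simp]: "mat_sum m f S \<in> carrier_mat m m"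
  by (simp add: mat_sum_def)

lemma mat_sum_cong: "(\<And>s. s \<in> S \<Longrightarrow> f s = g s) \<Longrightarrow> mat_sum m f S = mat_sum m g S"
  by (simp add: mat_sum_def)

lemma mult_mat_entry:
  assumes "A \<in> carrier_mat m n" "B \<in> carrier_mat n l" "i < m" "j < l"
  shows "(A * B) $$ (i, j) = (\<Sum>k<n. A $$ (i, k) * B $$ (k, j))"
  using assms by (auto simp: scalar_prod_def lessThan_atLeast0)

lemma mult_mat_sum:
  assumes "A \<in> carrier_mat m m" "\<And>s. s \<in> S \<Longrightarrow> f s \<in> carrier_mat m m"
  shows "A * mat_sum m f S = mat_sum m (\<lambda>s. A * f s) S"
proof (rule eq_matI, goal_cases)
  case (1 i j)
  then have ij: "i < m" "j < m" by (auto simp: mat_sum_def)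
  have "(A * mat_sum m f S) $$ (i, j) = (\<Sum>k<m. A $$ (i, k) * (\<Sum>s\<in>S. f s $$ (k, j)))"
    unfolding mult_mat_entry[OF assms(1) mat_sum_carrier ij] using ij by (simp add: mat_sum_def)
  also have "\<dots> = (\<Sum>s\<in>S. \<Sum>k<m. A $$ (i, k) * f s $$ (k, j))"
    by (simp add: sum_distrib_left sum.swap[of _ "{..<m}"])
  also have "\<dots> = mat_sum m (\<lambda>s. A * f s) S $$ (i, j)"
    using ij assms by (auto simp: mult_mat_entry[of _ m m _ m] mat_sum_def intro!: sum.cong)
  finally show ?case .
qed (use assms in \<open>auto simp: mat_sum_def\<close>)

lemma mat_sum_mult:
  assumes "A \<in> carrier_mat m m" "\<And>s. s \<in> S \<Longrightarrow> f s \<in> carrier_mat m m"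
  shows "mat_sum m f S * A = mat_sum m (\<lambda>s. f s * A) S"
proof (rule eq_matI, goal_cases)
  case (1 i j)
  then have ij: "i < m" "j < m" using assms by (auto simp: mat_sum_def)
  have "(mat_sum m f S * A) $$ (i, j) = (\<Sum>k<m. (\<Sum>s\<in>S. f s $$ (i, k)) * A $$ (k, j))"
    unfolding mult_mat_entry[OF mat_sum_carrier assms(1) ij] using ij by (simp add: mat_sum_def)
  also have "\<dots> = (\<Sum>s\<in>S. \<Sum>k<m. f s $$ (i, k) * A $$ (k, j))"
    by (simp add: sum_distrib_right sum.swap[of _ "{..<m}"])
  also have "\<dots> = mat_sum m (\<lambda>s. f s * A) S $$ (i, j)"
    using ij assms by (auto simp: mult_mat_entry[of _ m m _ m] mat_sum_def intro!: sum.cong)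
  finally show ?case .
qed (use assms in \<open>auto simp: mat_sum_def\<close>)

lemma mat_sum_remove:
  assumes "finite S" "s \<in> S" "f s \<in> carrier_mat m m"
  shows "mat_sum m f S = f s + mat_sum m f (S - {s})"
  using assms by (intro eq_matI) (auto simp: mat_sum_def sum.remove)

lemma intertwine_add:
  assumes "A \<in> carrier_mat m m" "P \<in> carrier_mat m m" "P' \<in> carrier_mat m m"
    "S \<in> carrier_mat m m" "S' \<in> carrier_mat m m" "A * P = P' * A" "A * S = S' * A"
  shows "A * (P + S) = (P' + S') * A"
  using assms by (simp add: mult_add_distrib_mat[of _ m m] add_mult_distrib_mat[of _ m m])

lemma intertwine_sum:
  assumes "A \<in> carrier_mat m m" "\<And>s. f s \<in> carrier_mat m m" "\<And>s. f' s \<in> carrier_mat m m"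
    "\<And>s. s \<in> S \<Longrightarrow> A * f s = f' s * A"
  shows "A * mat_sum m f S = mat_sum m f' S * A"
  using assms by (simp add: mult_mat_sum mat_sum_mult cong: mat_sum_cong)

text \<open>Written with entry sums rather than \<open>kron\<close>, which is the form that
  \<open>act_on_exchange2\<close> accepts for factors in any position and order.\<close>

definition exchanges :: "nat \<Rightarrow> complex mat \<Rightarrow> complex \<Rightarrow> complex mat \<Rightarrow> complex mat
  \<Rightarrow> complex mat \<Rightarrow> bool" where
  "exchanges d R z X Q Qi \<longleftrightarrow> (\<forall>a<d. \<forall>b<d. \<forall>c<d. \<forall>e<d.
     (\<Sum>s<d. \<Sum>t<d. R $$ (a * d + b, s * d + t) * (z * X $$ (s, c) * Q $$ (t, e) + Qi $$ (s, c) * X $$ (t, e)))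
   = (\<Sum>s<d. \<Sum>t<d. (z * X $$ (a, s) * Qi $$ (b, t) + Q $$ (a, s) * X $$ (b, t)) * R $$ (s * d + t, c * d + e)))"

definition commutes2 :: "nat \<Rightarrow> complex mat \<Rightarrow> complex mat \<Rightarrow> bool" where
  "commutes2 d R Q \<longleftrightarrow> (\<forall>a<d. \<forall>b<d. \<forall>c<d. \<forall>e<d.
     (\<Sum>s<d. \<Sum>t<d. R $$ (a * d + b, s * d + t) * (Q $$ (s, c) * Q $$ (t, e)))
   = (\<Sum>s<d. \<Sum>t<d. (Q $$ (a, s) * Q $$ (b, t)) * R $$ (s * d + t, c * d + e)))"

text \<open>The iterated coproduct of a generator on the factors taken in the order \<open>1, \<dots>, k, 0, k + 1, \<dots>,
  N\<close>,
  with weight \<open>z\<close> on the auxiliary factor \<open>0\<close>: passing the auxiliary factor over site \<open>k +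
    1\<close> is what
  a single R-matrix does.\<close>

definition coprod_aux :: "nat \<Rightarrow> nat \<Rightarrow> complex mat \<Rightarrow> complex mat \<Rightarrow> complex mat
  \<Rightarrow> nat \<Rightarrow> nat \<Rightarrow> nat \<Rightarrow> complex mat" where
  "coprod_aux d N X Q Qi k l m =
     (if m = 0 then (if l \<le> k then Q else Qi) else if m < l then Qi else if m = l then X else Q)"

text \<open>Only the summand with X on the auxiliary factor carries z. It is kept apart from the sum
  over sites because it is the one that must disappear under the trace.\<close>

definition coprod_ord :: "nat \<Rightarrow> nat \<Rightarrow> complex mat \<Rightarrow> complex mat \<Rightarrow> complex mat
  \<Rightarrow> complex \<Rightarrow> nat \<Rightarrow> complex mat" where
  "coprod_ord d N X Q Qi z k =
     tensor_op d (N + 1) (\<lambda>m. if m = 0 then z \<cdot>\<^sub>m X else if m \<le> k then Qi else Q)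
   + mat_sum (d ^ (N + 1)) (\<lambda>l. tensor_op d (N + 1) (coprod_aux d N X Q Qi k l)) {1..N}"

lemma coprod_ord_carrier [simp]: "coprod_ord d N X Q Qi z k \<in> carrier_mat (d ^ (N + 1)) (d ^ (N + 1))"
  unfolding coprod_ord_def by (intro add_carrier_mat mat_sum_carrier)

text \<open>Moving the auxiliary factor past site k + 1 affects just the summands with X on factor 0
  or on site k + 1, and these two have to be moved together.\<close>

lemma coprod_ord_split:
  assumes "k < N"
  shows "coprod_ord d N X Q Qi z j =
     (tensor_op d (N + 1) (\<lambda>m. if m = 0 then z \<cdot>\<^sub>m X else if m \<le> j then Qi else Q)
      + tensor_op d (N + 1) (coprod_aux d N X Q Qi j (Suc k)))
   + mat_sum (d ^ (N + 1)) (\<lambda>l. tensor_op d (N + 1) (coprod_aux d N X Q Qi j l)) ({1..N} - {Suc k})"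
  unfolding coprod_ord_def
  using assms by (subst mat_sum_remove[where s = "Suc k"])
     (auto intro!: assoc_add_mat[symmetric, where nr = "d ^ (N + 1)" and nc = "d ^ (N + 1)"] simp del: power_Suc)

text \<open>k1 and k2 leave the direction open, so both rows of R-matrices are served. In every
  summand outside the distinguished pair the two active factors both carry Q or both carry Qi, and
  \<open>commutes2\<close> is enough.\<close>

lemma act_on_coprod_ord:
  assumes d: "d > 0" and k: "k < N" and X: "X \<in> carrier_mat d d"
   and ij: "{i, j} = {0, Suc k}" and k': "k1 = k \<and> k2 = Suc k \<or> k1 = Suc k \<and> k2 = k"
   and pair: "act_on d (N + 1) R i j *
       (tensor_op d (N + 1) (\<lambda>m. if m = 0 then z \<cdot>\<^sub>m X else if m \<le> k1 then Qi else Q)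
        + tensor_op d (N + 1) (coprod_aux d N X Q Qi k1 (Suc k)))
     = (tensor_op d (N + 1) (\<lambda>m. if m = 0 then z \<cdot>\<^sub>m X else if m \<le> k2 then Qi else Q)
        + tensor_op d (N + 1) (coprod_aux d N X Q Qi k2 (Suc k))) * act_on d (N + 1) R i j"
   and com: "commutes2 d R Q" "commutes2 d R Qi"
  shows "act_on d (N + 1) R i j * coprod_ord d N X Q Qi z k1
       = coprod_ord d N X Q Qi z k2 * act_on d (N + 1) R i j"
proof -
  let ?A = "act_on d (N + 1) R i j"
  have ij': "i < N + 1" "j < N + 1" "i \<noteq> j" using ij k by (auto simp: doubleton_eq_iff)
  have comm: "?A * tensor_op d (N + 1) (coprod_aux d N X Q Qi k1 l)
      = tensor_op d (N + 1) (coprod_aux d N X Q Qi k2 l) * ?A" if l: "l \<in> {1..N} - {Suc k}" for l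
  proof -
    \<comment> \<open>Since l is not k + 1, comparing l with k or with k + 1 gives the same
      answer.\<close>
    have e: "coprod_aux d N X Q Qi k1 l = coprod_aux d N X Q Qi k2 l"
      using k' l by (auto simp: coprod_aux_def fun_eq_iff)
    show ?thesis
    proof (cases "l \<le> k")
      case True
      then have "coprod_aux d N X Q Qi k1 l i = Q" "coprod_aux d N X Q Qi k1 l j = Q"
        using ij k' l by (auto simp: coprod_aux_def doubleton_eq_iff)
      then show ?thesis unfolding e[symmetric] using com(1) ij' d
        by (intro act_on_exchange[where A = Q and B = Q]) (auto simp: commutes2_def)
    next
      case False
      then have "coprod_aux d N X Q Qi k1 l i = Qi" "coprod_aux d N X Q Qi k1 l j = Qi"
        using ij k' l by (auto simp: coprod_aux_def doubleton_eq_iff)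
      then show ?thesis unfolding e[symmetric] using com(2) ij' d
        by (intro act_on_exchange[where A = Qi and B = Qi]) (auto simp: commutes2_def)
    qed
  qed
  have c: "?A \<in> carrier_mat (d ^ (N + 1)) (d ^ (N + 1))" by (rule act_on_carrier)
  show ?thesis
    unfolding coprod_ord_split[OF k]
    by (intro intertwine_add[OF c] intertwine_sum[OF c] add_carrier_mat tensor_op_carrier
        mat_sum_carrier pair comm)
qed

lemma act_on_aux_left:
  assumes d: "d > 0" and k: "k < N" and X: "X \<in> carrier_mat d d"
   and ex: "exchanges d R z X Q Qi" and com: "commutes2 d R Q" "commutes2 d R Qi"
  shows "act_on d (N + 1) R 0 (Suc k) * coprod_ord d N X Q Qi z k
       = coprod_ord d N X Q Qi z (Suc k) * act_on d (N + 1) R 0 (Suc k)"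
proof (rule act_on_coprod_ord[OF d k X _ _ _ com])
  let ?T = "tensor_op d (N + 1)"
  show "act_on d (N + 1) R 0 (Suc k) *
       (?T (\<lambda>m. if m = 0 then z \<cdot>\<^sub>m X else if m \<le> k then Qi else Q) + ?T (coprod_aux d N X Q Qi k (Suc
         k)))
     = (?T (\<lambda>m. if m = 0 then z \<cdot>\<^sub>m X else if m \<le> Suc k then Qi else Q)
        + ?T (coprod_aux d N X Q Qi (Suc k) (Suc k))) * act_on d (N + 1) R 0 (Suc k)"
  proof (rule act_on_exchange2[where \<chi> = "\<lambda>m. if m \<le> k then Qi else Q" and ?U1.0 = "z \<cdot>\<^sub>m X" and
    ?W1.0 = Q
       and ?U2.0 = Qi and ?W2.0 = X and U1' = "z \<cdot>\<^sub>m X" and W1' = Qi and U2' = Q and W2' = X])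
    fix a b c e assume "a < d" "b < d" "c < d" "e < d"
    then show "(\<Sum>s<d. \<Sum>t<d. R $$ (a * d + b, s * d + t) *
        ((z \<cdot>\<^sub>m X) $$ (s, c) * Q $$ (t, e) + Qi $$ (s, c) * X $$ (t, e)))
      = (\<Sum>s<d. \<Sum>t<d. ((z \<cdot>\<^sub>m X) $$ (a, s) * Qi $$ (b, t) + Q $$ (a, s) * X $$ (b, t)) *
        R $$ (s * d + t, c * d + e))"
      using ex X unfolding exchanges_def by (simp add: X[THEN carrier_matD(1)] X[THEN carrier_matD(2)])
  qed (use d k in \<open>auto simp: coprod_aux_def\<close>)
qed (use k in auto)

text \<open>The auxiliary space is now the second leg of R. Scaling the exchange relation by z' =
  1/z moves the weight from the first leg to the second, so the relation for R also yields the one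
  for the flipped R-matrix.\<close>

lemma act_on_aux_right:
  assumes d: "d > 0" and k: "k < N" and X: "X \<in> carrier_mat d d" and z: "z * z' = 1"
   and ex: "exchanges d R z X Q Qi" and com: "commutes2 d R Q" "commutes2 d R Qi"
  shows "act_on d (N + 1) R (Suc k) 0 * coprod_ord d N X Q Qi z' (Suc k)
       = coprod_ord d N X Q Qi z' k * act_on d (N + 1) R (Suc k) 0"
proof (rule act_on_coprod_ord[OF d k X _ _ _ com])
  let ?T = "tensor_op d (N + 1)"
  show "act_on d (N + 1) R (Suc k) 0 *
       (?T (\<lambda>m. if m = 0 then z' \<cdot>\<^sub>m X else if m \<le> Suc k then Qi else Q) + ?T (coprod_aux d N X Q Qi (Suc
         k) (Suc k)))
     = (?T (\<lambda>m. if m = 0 then z' \<cdot>\<^sub>m X else if m \<le> k then Qi else Q)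
        + ?T (coprod_aux d N X Q Qi k (Suc k))) * act_on d (N + 1) R (Suc k) 0"
  proof (rule act_on_exchange2[where \<chi> = "\<lambda>m. if m \<le> k then Qi else Q" and ?U1.0 = Qi and ?W1.0 = "z'
    \<cdot>\<^sub>m X"
       and ?U2.0 = X and ?W2.0 = Q and U1' = Q and W1' = "z' \<cdot>\<^sub>m X" and U2' = X and W2' = Qi])
    fix a b c e assume A: "a < d" "b < d" "c < d" "e < d"
    have z': "z' \<noteq> 0" "z = 1 / z'" using z by (auto simp: eq_divide_eq)
    have "(\<Sum>s<d. \<Sum>t<d. R $$ (a * d + b, s * d + t) *
        (Qi $$ (s, c) * (z' \<cdot>\<^sub>m X) $$ (t, e) + X $$ (s, c) * Q $$ (t, e)))
      = z' * (\<Sum>s<d. \<Sum>t<d. R $$ (a * d + b, s * d + t) * (z * X $$ (s, c) * Q $$ (t, e) + Qi $$ (s, c) * X $$ (t, e)))"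
      unfolding sum_distrib_left
    proof (intro sum.cong refl, goal_cases)
      case (1 s t)
      then have "(z' \<cdot>\<^sub>m X) $$ (t, e) = z' * X $$ (t, e)" using X A by simp
      then show ?case using z' by (simp add: field_simps)
    qed
    also have "\<dots> = z' * (\<Sum>s<d. \<Sum>t<d. (z * X $$ (a, s) * Qi $$ (b, t) + Q $$ (a, s) * X $$ (b, t)) *
        R $$ (s * d + t, c * d + e))"
      using ex A unfolding exchanges_def by auto
    also have "\<dots> = (\<Sum>s<d. \<Sum>t<d. (Q $$ (a, s) * (z' \<cdot>\<^sub>m X) $$ (b, t) + X $$ (a, s) * Qi $$ (b, t)) *
        R $$ (s * d + t, c * d + e))"
      unfolding sum_distrib_left
    proof (intro sum.cong refl, goal_cases)
      case (1 s t)
      then have "(z' \<cdot>\<^sub>m X) $$ (b, t) = z' * X $$ (b, t)" using X A by simp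
      then show ?case using z' by (simp add: field_simps)
    qed
    finally show "(\<Sum>s<d. \<Sum>t<d. R $$ (a * d + b, s * d + t) *
        (Qi $$ (s, c) * (z' \<cdot>\<^sub>m X) $$ (t, e) + X $$ (s, c) * Q $$ (t, e)))
      = (\<Sum>s<d. \<Sum>t<d. (Q $$ (a, s) * (z' \<cdot>\<^sub>m X) $$ (b, t) + X $$ (a, s) * Qi $$ (b, t)) *
        R $$ (s * d + t, c * d + e))" .
  qed (use d k in \<open>auto simp: coprod_aux_def\<close>)
qed (use k in auto)

lemma mat_prod_Nil [simp]: "mat_prod m [] = 1\<^sub>m m"
  and mat_prod_Cons [simp]: "mat_prod m (A # As) = A * mat_prod m As"
  by (simp_all add: mat_prod_def)

lemma mat_prod_carrier: "set As \<subseteq> carrier_mat m m \<Longrightarrow> mat_prod m As \<in> carrier_mat m m"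
  by (induction As) auto

lemma intertwine_mult:
  assumes "A \<in> carrier_mat m m" "B \<in> carrier_mat m m" "P \<in> carrier_mat m m" "P' \<in> carrier_mat m m"
    "P'' \<in> carrier_mat m m"
    "A * P' = P'' * A" "B * P = P' * B"
  shows "(A * B) * P = P'' * (A * B)"
  using assms by (simp add: assoc_mult_mat[of _ m m _ m _ m] flip: assoc_mult_mat[of _ m m P' m _ m])

lemma monodromy_left:
  assumes d: "d > 0" and X: "X \<in> carrier_mat d d"
   and ex: "exchanges d R z X Q Qi" and com: "commutes2 d R Q" "commutes2 d R Qi" and "k \<le> N"
  shows "mat_prod (d ^ (N + 1)) (map (\<lambda>k. act_on d (N + 1) R 0 k) (rev [1..<k + 1])) * coprod_ord d N X Q Qi z 0
    = coprod_ord d N X Q Qi z k * mat_prod (d ^ (N + 1)) (map (\<lambda>k. act_on d (N + 1) R 0 k) (rev [1..<k + 1]))"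
  using \<open>k \<le> N\<close>
proof (induction k)
  case 0
  show ?case using left_mult_one_mat[OF coprod_ord_carrier] right_mult_one_mat[OF coprod_ord_carrier] by simp
next
  case (Suc k)
  have "rev [1..<Suc k + 1] = Suc k # rev [1..<k + 1]" by simp
  moreover have "mat_prod (d ^ (N + 1)) (map (\<lambda>k. act_on d (N + 1) R 0 k) (rev [1..<k + 1])) \<in> carrier_mat (d ^ (N +
    1)) (d ^ (N + 1))"
    by (rule mat_prod_carrier) (auto simp del: power_Suc)
  ultimately show ?case
    using Suc act_on_aux_left[OF d _ X ex com, of k N]
    by (simp only: list.map mat_prod_Cons)
       (rule intertwine_mult[OF act_on_carrier _ coprod_ord_carrier coprod_ord_carrier coprod_ord_carrier], simp_all)
qed

text \<open>The leftmost factor belongs to the smallest site, hence the induction descends from k =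
  N, where the product is empty.\<close>

lemma monodromy_right:
  assumes d: "d > 0" and X: "X \<in> carrier_mat d d" and z: "z * z' = 1"
   and ex: "exchanges d R z X Q Qi" and com: "commutes2 d R Q" "commutes2 d R Qi" and "k \<le> N"
  shows "mat_prod (d ^ (N + 1)) (map (\<lambda>k. act_on d (N + 1) R k 0) [k + 1..<N + 1]) * coprod_ord d N X Q Qi z' N
    = coprod_ord d N X Q Qi z' k * mat_prod (d ^ (N + 1)) (map (\<lambda>k. act_on d (N + 1) R k 0) [k + 1..<N + 1])"
  using \<open>k \<le> N\<close>
proof (induction k rule: inc_induct)
  case base
  show ?case using left_mult_one_mat[OF coprod_ord_carrier] right_mult_one_mat[OF coprod_ord_carrier] by simp
next
  case (step k)
  have "[k + 1..<N + 1] = Suc k # [Suc k + 1..<N + 1]" using step.hyps by (simp add: upt_conv_Cons del: upt_Suc)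
  moreover have "mat_prod (d ^ (N + 1)) (map (\<lambda>k. act_on d (N + 1) R k 0) [Suc k + 1..<N + 1]) \<in> carrier_mat (d ^ (N
    + 1)) (d ^ (N + 1))"
    by (rule mat_prod_carrier) (auto simp del: power_Suc)
  ultimately show ?case
    using step act_on_aux_right[OF d _ X z ex com, of k N]
    by (simp only: list.map mat_prod_Cons)
       (rule intertwine_mult[OF act_on_carrier _ coprod_ord_carrier coprod_ord_carrier coprod_ord_carrier], simp_all)
qed

subsection \<open>Kronecker products and the partial trace\<close>

lemma kron_carrier [simp]:
  "A \<in> carrier_mat m n \<Longrightarrow> B \<in> carrier_mat k l \<Longrightarrow> A \<otimes>\<^sub>m B \<in> carrier_mat (m
    * k) (n * l)"
  by (simp add: kron_def)

lemma block_index_less: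
  assumes "\<alpha> < d" "x < (m::nat)"
  shows "\<alpha> * m + x < d * m"
proof -
  have "\<alpha> * m + x < Suc \<alpha> * m" using assms by simp
  also have "\<dots> \<le> d * m" using assms by (intro mult_le_mono1) simp
  finally show ?thesis .
qed

lemma kron_index:
  assumes "A \<in> carrier_mat d d" "B \<in> carrier_mat m m" "\<alpha> < d" "\<beta> < d" "x < m" "y < m"
  shows "(A \<otimes>\<^sub>m B) $$ (\<alpha> * m + x, \<beta> * m + y) = A $$ (\<alpha>, \<beta>) * B $$ (x, y)"
proof -
  have "\<alpha> * m + x < d * m" "\<beta> * m + y < d * m"
    using assms(3-6) by (simp_all add: block_index_less)
  then show ?thesis using assms by (simp add: kron_def)
qed

lemma sum_product_index:
  fixes g :: "nat \<Rightarrow> complex"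
  shows "(\<Sum>k<d * m. g k) = (\<Sum>\<beta><d. \<Sum>w<m. g (\<beta> * m + w))"
  by (simp add: sum.nat_group[symmetric] sum.atLeastLessThan_shift_0[of _ "_ * m"] atLeast0LessThan)

lemma kron_index_cases:
  assumes "i < d * (m::nat)"
  obtains \<alpha> x where "\<alpha> < d" "x < m" "i = \<alpha> * m + x"
  using assms by (metis div_mult_mod_eq less_mult_imp_div_less mod_less_divisor mult_0_right not_gr_zero not_less_zero)

lemma kron_eqI:
  assumes "A \<in> carrier_mat (d * m) (d * m)" "B \<in> carrier_mat (d * m) (d * m)"
    "\<And>\<alpha> \<beta> x y. \<alpha> < d \<Longrightarrow> \<beta> < d \<Longrightarrow> x < m \<Longrightarrow> y < m
      \<Longrightarrow>
       A $$ (\<alpha> * m + x, \<beta> * m + y) = B $$ (\<alpha> * m + x, \<beta> * m + y)"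
  shows "A = B"
proof (rule eq_matI, goal_cases)
  case (1 i j)
  then have "i < d * m" "j < d * m" using assms by auto
  then show ?case using assms(3) by (metis kron_index_cases)
qed (use assms in auto)

lemma mult_mat_entry_block:
  fixes A B :: "complex mat"
  assumes "A \<in> carrier_mat (d * m) (d * m)" "B \<in> carrier_mat (d * m) (d * m)"
    "i < d * m" "j < d * m"
  shows "(A * B) $$ (i, j) = (\<Sum>\<beta><d. \<Sum>w<m. A $$ (i, \<beta> * m + w) * B $$ (\<beta> * m + w, j))"
  unfolding mult_mat_entry[OF assms] by (rule sum_product_index)

lemma kron_mult:
  assumes "A \<in> carrier_mat d d" "B \<in> carrier_mat m m" "A' \<in> carrier_mat d d" "B' \<in> carrier_mat m m"
  shows "(A \<otimes>\<^sub>m B) * (A' \<otimes>\<^sub>m B') = (A * A') \<otimes>\<^sub>m (B * B')"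
proof (rule kron_eqI[of _ d m])
  fix \<alpha> \<beta> x y assume i: "\<alpha> < d" "\<beta> < d" "x < m" "y < m"
  then have l: "\<alpha> * m + x < d * m" "\<beta> * m + y < d * m" by (simp_all add: block_index_less)
  show "((A \<otimes>\<^sub>m B) * (A' \<otimes>\<^sub>m B')) $$ (\<alpha> * m + x, \<beta> * m + y) = ((A * A')
    \<otimes>\<^sub>m (B * B')) $$ (\<alpha> * m + x, \<beta> * m + y)"
    unfolding kron_index[OF mult_carrier_mat[OF assms(1,3)] mult_carrier_mat[OF assms(2,4)] i]
      mult_mat_entry_block[OF kron_carrier[OF assms(1,2)] kron_carrier[OF assms(3,4)] l]
      mult_mat_entry[OF assms(1,3) i(1,2)] mult_mat_entry[OF assms(2,4) i(3,4)] sum_product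
    using assms i by (simp add: kron_index mult_ac)
qed (use assms in \<open>auto intro!: mult_carrier_mat kron_carrier\<close>)

lemma kron_mat_sum:
  assumes "A \<in> carrier_mat d d" "\<And>s. s \<in> S \<Longrightarrow> f s \<in> carrier_mat m m"
  shows "mat_sum (d * m) (\<lambda>s. A \<otimes>\<^sub>m f s) S = A \<otimes>\<^sub>m mat_sum m f S"
proof (rule kron_eqI[of _ d m])
  fix \<alpha> \<beta> x y assume i: "\<alpha> < d" "\<beta> < d" "x < m" "y < m"
  then have l: "\<alpha> * m + x < d * m" "\<beta> * m + y < d * m" by (simp_all add: block_index_less)
  show "mat_sum (d * m) (\<lambda>s. A \<otimes>\<^sub>m f s) S $$ (\<alpha> * m + x, \<beta> * m + y) = (A \<otimes>\<^sub>m
    mat_sum m f S) $$ (\<alpha> * m + x, \<beta> * m + y)"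
    unfolding kron_index[OF assms(1) mat_sum_carrier i]
    using assms i l by (simp add: mat_sum_def kron_index sum_distrib_left cong: sum.cong)
qed (use assms in auto)

lemma partial_trace_carrier [simp]: "partial_trace d m A \<in> carrier_mat m m"
  by (simp add: partial_trace_def)

text \<open>B acts on the surviving space only, so it leaves the trace on the side where it
  stands.\<close>

lemma partial_trace_kron_mult:
  assumes Y: "Y \<in> carrier_mat d d" and B: "B \<in> carrier_mat m m" and A: "A \<in> carrier_mat (d * m) (d * m)"
  shows "partial_trace d m ((Y \<otimes>\<^sub>m B) * A) = B * partial_trace d m ((Y \<otimes>\<^sub>m 1\<^sub>m m) * A)"
proof (rule eq_matI, goal_cases)
  case (1 x y)
  then have i: "x < m" "y < m" using B by (auto simp: partial_trace_def)
  have l: "\<alpha> * m + z < d * m" if "\<alpha> < d" "z < m" for \<alpha> z using that by (rule block_index_less)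
  have e: "((Y \<otimes>\<^sub>m C) * A) $$ (\<alpha> * m + x, \<alpha> * m + y)
      = (\<Sum>\<beta><d. \<Sum>w<m. Y $$ (\<alpha>, \<beta>) * C $$ (x, w) * A $$ (\<beta> * m + w, \<alpha> * m + y))"
    if "C \<in> carrier_mat m m" "\<alpha> < d" "x < m" "y < m" for C \<alpha> x y
    using that Y by (subst mult_mat_entry_block[OF kron_carrier A]) (auto simp: kron_index l)
  have p: "partial_trace d m ((Y \<otimes>\<^sub>m 1\<^sub>m m) * A) $$ (w, y)
     = (\<Sum>\<alpha><d. \<Sum>\<beta><d. Y $$ (\<alpha>, \<beta>) * A $$ (\<beta> * m + w, \<alpha> * m + y))" if "w < m" for w
    using that i by (simp add: partial_trace_def e if_distrib[of "\<lambda>x. _ * x * _"] cong: if_cong)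
  have "partial_trace d m ((Y \<otimes>\<^sub>m B) * A) $$ (x, y)
     = (\<Sum>\<alpha><d. \<Sum>\<beta><d. \<Sum>w<m. B $$ (x, w) * (Y $$ (\<alpha>, \<beta>) * A $$ (\<beta> * m + w, \<alpha> *
       m + y)))"
    using i B by (simp add: partial_trace_def e mult_ac)
  also have "\<dots> = (\<Sum>w<m. B $$ (x, w) * (\<Sum>\<alpha><d. \<Sum>\<beta><d. Y $$ (\<alpha>, \<beta>) * A $$ (\<beta> * m
    + w, \<alpha> * m + y)))"
    by (simp add: sum_distrib_left sum.swap[of _ "{..<d}" "{..<m}"])
  also have "\<dots> = (B * partial_trace d m ((Y \<otimes>\<^sub>m 1\<^sub>m m) * A)) $$ (x, y)"
    unfolding mult_mat_entry[OF B partial_trace_carrier i] by (simp add: p)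
  finally show ?case .
qed (use B in \<open>auto simp: partial_trace_def\<close>)

text \<open>A partial trace is cyclic only for operators on the traced space: Y moves round to the
  left, while B has to leave on the right.\<close>

lemma partial_trace_mult_kron:
  assumes Y: "Y \<in> carrier_mat d d" and B: "B \<in> carrier_mat m m" and A: "A \<in> carrier_mat (d * m) (d * m)"
  shows "partial_trace d m (A * (Y \<otimes>\<^sub>m B)) = partial_trace d m ((Y \<otimes>\<^sub>m 1\<^sub>m m) * A) * B"
proof (rule eq_matI, goal_cases)
  case (1 x y)
  then have i: "x < m" "y < m" using B by (auto simp: partial_trace_def)
  have l: "\<alpha> * m + z < d * m" if "\<alpha> < d" "z < m" for \<alpha> z using that by (rule block_index_less)
  have e: "((Y \<otimes>\<^sub>m 1\<^sub>m m) * A) $$ (\<alpha> * m + x, \<alpha> * m + y)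
      = (\<Sum>\<beta><d. \<Sum>w<m. Y $$ (\<alpha>, \<beta>) * 1\<^sub>m m $$ (x, w) * A $$ (\<beta> * m + w, \<alpha> * m + y))"
    if "\<alpha> < d" "x < m" "y < m" for \<alpha> x y
    using that Y by (subst mult_mat_entry_block[OF kron_carrier A]) (auto simp: kron_index l simp del: index_one_mat)
  have e': "(A * (Y \<otimes>\<^sub>m B)) $$ (\<alpha> * m + x, \<alpha> * m + y)
      = (\<Sum>\<beta><d. \<Sum>w<m. A $$ (\<alpha> * m + x, \<beta> * m + w) * (Y $$ (\<beta>, \<alpha>) * B $$ (w, y)))"
    if "\<alpha> < d" "x < m" "y < m" for \<alpha> x y
    using that Y B by (subst mult_mat_entry_block[OF A kron_carrier]) (auto simp: kron_index l)
  have p: "partial_trace d m ((Y \<otimes>\<^sub>m 1\<^sub>m m) * A) $$ (x, w)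
     = (\<Sum>\<alpha><d. \<Sum>\<beta><d. Y $$ (\<alpha>, \<beta>) * A $$ (\<beta> * m + x, \<alpha> * m + w))" if "w < m" for w
    using that i by (simp add: partial_trace_def e if_distrib[of "\<lambda>x. _ * x * _"] cong: if_cong)
  have "partial_trace d m (A * (Y \<otimes>\<^sub>m B)) $$ (x, y)
     = (\<Sum>\<alpha><d. \<Sum>\<beta><d. \<Sum>w<m. (Y $$ (\<beta>, \<alpha>) * A $$ (\<alpha> * m + x, \<beta> * m + w)) * B
       $$ (w, y))"
    using i B by (simp add: partial_trace_def e' mult_ac)
  also have "\<dots> = (\<Sum>w<m. (\<Sum>\<beta><d. \<Sum>\<alpha><d. Y $$ (\<beta>, \<alpha>) * A $$ (\<alpha> * m + x, \<beta>
    * m + w)) * B $$ (w, y))"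
    by (subst sum.swap) (simp add: sum_distrib_right sum.swap[of _ "{..<d}" "{..<m}"])
  also have "\<dots> = (partial_trace d m ((Y \<otimes>\<^sub>m 1\<^sub>m m) * A) * B) $$ (x, y)"
    unfolding mult_mat_entry[OF partial_trace_carrier B i] by (simp add: p)
  finally show ?case .
qed (use B in \<open>auto simp: partial_trace_def\<close>)

lemma partial_trace_add:
  assumes "A \<in> carrier_mat (d * m) (d * m)" "B \<in> carrier_mat (d * m) (d * m)"
  shows "partial_trace d m (A + B) = partial_trace d m A + partial_trace d m B"
proof (rule eq_matI, goal_cases)
  case (1 x y)
  then have i: "x < m" "y < m" by (auto simp: partial_trace_def)
  have l: "\<alpha> * m + z < d * m" if "\<alpha> < d" "z < m" for \<alpha> z using that by (rule block_index_less)
  show ?case using i l assms by (simp add: partial_trace_def sum.distrib)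
qed (auto simp: partial_trace_def)

definition coprod_sum :: "nat \<Rightarrow> nat \<Rightarrow> complex mat \<Rightarrow> complex mat \<Rightarrow> complex mat
  \<Rightarrow> complex mat" where
  "coprod_sum d N X Q Qi = mat_sum (d ^ N)
     (\<lambda>k. kron_list (replicate (k - 1) Qi @ [X] @ replicate (N - k) Q)) {1..N}"

text \<open>With the auxiliary factor last in the order, X on it is accompanied by Qi on every site,
  and X on a site by Q on factor 0. It is last in the order of the coproduct but still the leftmost
  factor of the space.\<close>

lemma coprod_ord_eq_kron:
  assumes d: "d > 0" and c: "X \<in> carrier_mat d d" "Q \<in> carrier_mat d d" "Qi \<in> carrier_mat d d"
  shows "coprod_ord d N X Q Qi z N =
    (z \<cdot>\<^sub>m X) \<otimes>\<^sub>m tensor_op d N (\<lambda>_. Qi) + Q \<otimes>\<^sub>m coprod_sum d N X Q Qi"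
proof -
  have 1: "tensor_op d (N + 1) (\<lambda>m. if m = 0 then z \<cdot>\<^sub>m X else if m \<le> N then Qi else Q)
      = (z \<cdot>\<^sub>m X) \<otimes>\<^sub>m tensor_op d N (\<lambda>_. Qi)"
  proof -
    have "tensor_op d N (\<lambda>k. if Suc k \<le> N then Qi else Q) = tensor_op d N (\<lambda>_. Qi)"
      unfolding tensor_op_def by (intro kernel_mat_cong[OF d] prod.cong) auto
    then show ?thesis using c d by (simp add: tensor_op_Suc)
  qed
  have 2: "tensor_op d (N + 1) (coprod_aux d N X Q Qi N l)
      = Q \<otimes>\<^sub>m kron_list (replicate (l - 1) Qi @ [X] @ replicate (N - l) Q)" if l: "l \<in> {1..N}" for l
  proof -
    let ?As = "replicate (l - 1) Qi @ [X] @ replicate (N - l) Q"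
    have len: "length ?As = N" using l by auto
    have nth: "?As ! k = coprod_aux d N X Q Qi N l (Suc k)" if "k < N" for k
    proof -
      consider "k < l - 1" | "k = l - 1" | "k > l - 1" by linarith
      then show ?thesis
      proof cases
        case 1
        then have "Suc k < l" by linarith
        then show ?thesis using 1 by (simp add: nth_append coprod_aux_def)
      next
        case 2
        then show ?thesis using l by (simp add: nth_append coprod_aux_def)
      next
        case 3
        then have "l \<le> k" by linarith
        then obtain j where j: "k = l + j" using le_Suc_ex by blast
        then have "k - (l - 1) = Suc j" using l by auto
        then show ?thesis using 3 j that l by (auto simp: nth_append coprod_aux_def)
      qed
    qed
    have "kron_list ?As = tensor_op d N (\<lambda>k. ?As ! k)"
      using kron_list_tensor_op[OF d, of ?As] c len by (simp add: set_replicate_conv_if)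
    also have "\<dots> = tensor_op d N (\<lambda>k. coprod_aux d N X Q Qi N l (Suc k))"
      unfolding tensor_op_def by (intro kernel_mat_cong[OF d] prod.cong refl arg_cong2[where f = index_mat]) (rule nth, simp)
    finally show ?thesis using tensor_op_Suc[OF d, of "coprod_aux d N X Q Qi N l" N] c l
      by (simp add: coprod_aux_def)
  qed
  have 3: "kron_list (replicate (l - 1) Qi @ [X] @ replicate (N - l) Q) \<in> carrier_mat (d ^ N) (d ^ N)"
    if l: "l \<in> {1..N}" for l
  proof -
    let ?As = "replicate (l - 1) Qi @ [X] @ replicate (N - l) Q"
    have "length ?As = N" using l by auto
    then show ?thesis using kron_list_tensor_op[OF d, of ?As] c by (simp add: set_replicate_conv_if)
  qed
  have "mat_sum (d ^ (N + 1)) (\<lambda>l. tensor_op d (N + 1) (coprod_aux d N X Q Qi N l)) {1..N}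
      = mat_sum (d ^ (N + 1)) (\<lambda>l. Q \<otimes>\<^sub>m kron_list (replicate (l - 1) Qi @ [X] @ replicate (N - l) Q))
        {1..N}"
    by (rule mat_sum_cong[OF 2])
  also have "\<dots> = Q \<otimes>\<^sub>m coprod_sum d N X Q Qi"
    unfolding coprod_sum_def using kron_mat_sum[OF c(2) 3, of "{1..N}"] by simp
  finally show ?thesis unfolding coprod_ord_def 1 by simp
qed

lemma mat_diag_mult_entry:
  assumes "X \<in> carrier_mat d d" "i < d" "j < (d::nat)"
  shows "(mat_diag d f * X) $$ (i, j) = f i * X $$ (i, j)"
    and "(X * mat_diag d f) $$ (i, j) = X $$ (i, j) * f j"
  using assms by (simp_all add: mat_diag_mult_left[OF assms(1)] mat_diag_mult_right[OF assms(1)])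

text \<open>Multiplying the intertwining relation of the double-row monodromy matrix by \<open>K\<^sup>L
  Q\<^sup>-\<^sup>1\<close> and tracing
  over the auxiliary space, the terms carrying \<open>X\<close> on the auxiliary space cancel by cyclicity.\<close>

lemma double_row_trace_commute:
  assumes X: "X \<in> carrier_mat d d" and q: "\<And>i. i < d \<Longrightarrow> q i * qi i = 1"
   and A: "A \<in> carrier_mat (d * m) (d * m)" and D: "D \<in> carrier_mat m m" and W: "W \<in> carrier_mat m m"
   and int: "A * ((z' \<cdot>\<^sub>m X) \<otimes>\<^sub>m W + mat_diag d q \<otimes>\<^sub>m D) = ((z \<cdot>\<^sub>m X)
     \<otimes>\<^sub>m W + mat_diag d q \<otimes>\<^sub>m D) * A"
   and comW: "A * (mat_diag d qi \<otimes>\<^sub>m W) = (mat_diag d qi \<otimes>\<^sub>m W) * A"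
   and kl: "\<And>i j. i < d \<Longrightarrow> j < d \<Longrightarrow> z' * q i * X $$ (i, j) * kl j * qi j * qi j = z * kl i *
     qi i * X $$ (i, j)"
  shows "D * partial_trace d m ((mat_diag d kl \<otimes>\<^sub>m 1\<^sub>m m) * A) = partial_trace d m ((mat_diag d kl
    \<otimes>\<^sub>m 1\<^sub>m m) * A) * D"
proof -
  let ?Q = "mat_diag d q" and ?Qi = "mat_diag d qi" and ?Y = "mat_diag d (\<lambda>i. kl i * qi i)" and ?I = "1\<^sub>m m ::
    complex mat"
  let ?tr = "partial_trace d m"
  note cs = X D W A
  have dg [simp]: "mat_diag d f \<in> carrier_mat d d" for f :: "nat \<Rightarrow> complex" by simp
  have kc: "U \<otimes>\<^sub>m V \<in> carrier_mat (d * m) (d * m)" if "U \<in> carrier_mat d d"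
    "V \<in> carrier_mat m m" for U V
    using that by (rule kron_carrier)
  have zX: "z \<cdot>\<^sub>m X \<in> carrier_mat d d" "z' \<cdot>\<^sub>m X \<in> carrier_mat d d" using X by auto
  have QX: "?Q * (z' \<cdot>\<^sub>m X) \<in> carrier_mat d d" by (rule mult_carrier_mat[OF dg zX(2)])
  have Yi: "?Y \<otimes>\<^sub>m ?I \<in> carrier_mat (d * m) (d * m)" by (rule kc) auto
  have YA: "(?Y \<otimes>\<^sub>m ?I) * A \<in> carrier_mat (d * m) (d * m)" by (rule mult_carrier_mat[OF Yi A])
  have YQ: "?Y * ?Q = mat_diag d kl" "?Q * ?Y = mat_diag d kl"
    unfolding mat_diag_diag using q by (auto simp: mat_diag_def mult_ac intro!: eq_matI)
  have dg_dist: "(?Y \<otimes>\<^sub>m ?I) * (A * (U + V)) = (?Y \<otimes>\<^sub>m ?I) * (A * U) + (?Y \<otimes>\<^sub>m ?I) * (A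
    * V)"
    if "U \<in> carrier_mat (d * m) (d * m)" "V \<in> carrier_mat (d * m) (d * m)" for U V
    unfolding mult_add_distrib_mat[OF A that] mult_add_distrib_mat[OF Yi mult_carrier_mat[OF A that(1)] mult_carrier_mat[OF A
      that(2)]] ..
  have dg_dist': "(?Y \<otimes>\<^sub>m ?I) * ((U + V) * A) = (?Y \<otimes>\<^sub>m ?I) * (U * A) + (?Y \<otimes>\<^sub>m ?I) *
    (V * A)"
    if "U \<in> carrier_mat (d * m) (d * m)" "V \<in> carrier_mat (d * m) (d * m)" for U V
    unfolding add_mult_distrib_mat[OF that A] mult_add_distrib_mat[OF Yi mult_carrier_mat[OF that(1) A] mult_carrier_mat[OF
      that(2) A]] ..
  \<comment> \<open>This term is kept: Q goes round the trace and turns Y into K^L, which leaves D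
    on the right. Its partner a2 has D on the left.\<close>
  have a1: "?tr ((?Y \<otimes>\<^sub>m ?I) * (A * (?Q \<otimes>\<^sub>m D))) = ?tr ((mat_diag d kl \<otimes>\<^sub>m ?I) * A) * D"
  proof -
    have "(?Y \<otimes>\<^sub>m ?I) * (A * (?Q \<otimes>\<^sub>m D)) = ((?Y \<otimes>\<^sub>m ?I) * A) * (?Q \<otimes>\<^sub>m D)"
      by (rule assoc_mult_mat[symmetric, OF Yi A kc]) (use D in auto)
    then have "?tr ((?Y \<otimes>\<^sub>m ?I) * (A * (?Q \<otimes>\<^sub>m D))) = ?tr ((?Q \<otimes>\<^sub>m ?I) * ((?Y
      \<otimes>\<^sub>m ?I) * A)) * D"
      using partial_trace_mult_kron[OF dg D YA] by simp
    also have "(?Q \<otimes>\<^sub>m ?I) * ((?Y \<otimes>\<^sub>m ?I) * A) = ((?Q \<otimes>\<^sub>m ?I) * (?Y \<otimes>\<^sub>m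
      ?I)) * A"
      by (rule assoc_mult_mat[symmetric, OF kc Yi A]) auto
    also have "(?Q \<otimes>\<^sub>m ?I) * (?Y \<otimes>\<^sub>m ?I) = mat_diag d kl \<otimes>\<^sub>m ?I"
      by (subst kron_mult[of _ d _ m]) (simp_all add: YQ del: mat_diag_diag)
    finally show ?thesis .
  qed
  have a2: "?tr ((?Y \<otimes>\<^sub>m ?I) * ((?Q \<otimes>\<^sub>m D) * A)) = D * ?tr ((mat_diag d kl \<otimes>\<^sub>m ?I) * A)"
  proof -
    have "(?Y \<otimes>\<^sub>m ?I) * ((?Q \<otimes>\<^sub>m D) * A) = ((?Y \<otimes>\<^sub>m ?I) * (?Q \<otimes>\<^sub>m D)) * A"
      by (rule assoc_mult_mat[symmetric, OF Yi kc A]) (use D in auto)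
    also have "(?Y \<otimes>\<^sub>m ?I) * (?Q \<otimes>\<^sub>m D) = mat_diag d kl \<otimes>\<^sub>m D"
      using D by (subst kron_mult[of _ d _ m]) (simp_all add: YQ del: mat_diag_diag)
    finally show ?thesis using partial_trace_kron_mult[OF dg D A] by simp
  qed
  have a3: "?tr ((?Y \<otimes>\<^sub>m ?I) * (((z \<cdot>\<^sub>m X) \<otimes>\<^sub>m W) * A)) = W * ?tr (((?Y * (z
    \<cdot>\<^sub>m X)) \<otimes>\<^sub>m ?I) * A)"
  proof -
    have "(?Y \<otimes>\<^sub>m ?I) * (((z \<cdot>\<^sub>m X) \<otimes>\<^sub>m W) * A) = ((?Y \<otimes>\<^sub>m ?I) * ((z
      \<cdot>\<^sub>m X) \<otimes>\<^sub>m W)) * A"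
      by (rule assoc_mult_mat[symmetric, OF Yi kc A]) (use X W in auto)
    also have "(?Y \<otimes>\<^sub>m ?I) * ((z \<cdot>\<^sub>m X) \<otimes>\<^sub>m W) = (?Y * (z \<cdot>\<^sub>m X))
      \<otimes>\<^sub>m W"
      using X W by (subst kron_mult[of _ d _ m]) simp_all
    finally show ?thesis using partial_trace_kron_mult[OF mult_carrier_mat[OF dg zX(1)] W A] by simp
  qed
  \<comment> \<open>Plain cyclicity would leave W on the right of the trace, whereas a3 has it on
    the left. Splitting off Qi \<otimes> W and moving it through A by comW puts W on the left here
    too, at the price of the extra factors Q and Qi around X.\<close>
  have a4: "?tr ((?Y \<otimes>\<^sub>m ?I) * (A * ((z' \<cdot>\<^sub>m X) \<otimes>\<^sub>m W)))
      = W * ?tr ((((?Q * (z' \<cdot>\<^sub>m X)) * (?Y * ?Qi)) \<otimes>\<^sub>m ?I) * A)"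
  proof -
    have QW: "?Qi \<otimes>\<^sub>m W \<in> carrier_mat (d * m) (d * m)" by (rule kc) (use W in auto)
    have QXI: "(?Q * (z' \<cdot>\<^sub>m X)) \<otimes>\<^sub>m ?I \<in> carrier_mat (d * m) (d * m)" by (rule kc[OF QX]) auto
    have YQW: "(?Y * ?Qi) \<otimes>\<^sub>m W \<in> carrier_mat (d * m) (d * m)" by (rule kc[OF mult_carrier_mat[OF dg dg] W])
    have "?Qi * (?Q * (z' \<cdot>\<^sub>m X)) = (?Qi * ?Q) * (z' \<cdot>\<^sub>m X)"
      by (rule assoc_mult_mat[symmetric, OF dg dg zX(2)])
    also have "?Qi * ?Q = 1\<^sub>m d" unfolding mat_diag_diag using q by (auto simp: mat_diag_def mult_ac intro!: eq_matI)
    finally have QQ: "?Qi * (?Q * (z' \<cdot>\<^sub>m X)) = z' \<cdot>\<^sub>m X" unfolding left_mult_one_mat[OF zX(2)] .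
    have "(z' \<cdot>\<^sub>m X) \<otimes>\<^sub>m W = (?Qi \<otimes>\<^sub>m W) * ((?Q * (z' \<cdot>\<^sub>m X))
      \<otimes>\<^sub>m ?I)"
      using kron_mult[OF dg W QX, of ?I qi] QQ W by simp
    then have "A * ((z' \<cdot>\<^sub>m X) \<otimes>\<^sub>m W) = (A * (?Qi \<otimes>\<^sub>m W)) * ((?Q * (z' \<cdot>\<^sub>m
      X)) \<otimes>\<^sub>m ?I)"
      using assoc_mult_mat[OF A QW QXI] by simp
    also have "\<dots> = (?Qi \<otimes>\<^sub>m W) * (A * ((?Q * (z' \<cdot>\<^sub>m X)) \<otimes>\<^sub>m ?I))"
      unfolding comW by (rule assoc_mult_mat[OF QW A QXI])
    finally have "(?Y \<otimes>\<^sub>m ?I) * (A * ((z' \<cdot>\<^sub>m X) \<otimes>\<^sub>m W)) =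
        ((?Y \<otimes>\<^sub>m ?I) * (?Qi \<otimes>\<^sub>m W)) * (A * ((?Q * (z' \<cdot>\<^sub>m X)) \<otimes>\<^sub>m ?I))"
      using assoc_mult_mat[OF Yi QW mult_carrier_mat[OF A QXI]] by simp
    also have "(?Y \<otimes>\<^sub>m ?I) * (?Qi \<otimes>\<^sub>m W) = (?Y * ?Qi) \<otimes>\<^sub>m W"
      using W by (subst kron_mult[of _ d _ m]) simp_all
    also have "((?Y * ?Qi) \<otimes>\<^sub>m W) * (A * ((?Q * (z' \<cdot>\<^sub>m X)) \<otimes>\<^sub>m ?I))
      = (((?Y * ?Qi) \<otimes>\<^sub>m W) * A) * ((?Q * (z' \<cdot>\<^sub>m X)) \<otimes>\<^sub>m ?I)"
      by (rule assoc_mult_mat[symmetric, OF YQW A QXI])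
    finally have "?tr ((?Y \<otimes>\<^sub>m ?I) * (A * ((z' \<cdot>\<^sub>m X) \<otimes>\<^sub>m W)))
      = ?tr (((?Q * (z' \<cdot>\<^sub>m X)) \<otimes>\<^sub>m ?I) * (((?Y * ?Qi) \<otimes>\<^sub>m W) * A))"
      using partial_trace_mult_kron[OF QX one_carrier_mat mult_carrier_mat[OF YQW A]]
        right_mult_one_mat[OF partial_trace_carrier] by simp
    also have "((?Q * (z' \<cdot>\<^sub>m X)) \<otimes>\<^sub>m ?I) * (((?Y * ?Qi) \<otimes>\<^sub>m W) * A)
      = (((?Q * (z' \<cdot>\<^sub>m X)) \<otimes>\<^sub>m ?I) * ((?Y * ?Qi) \<otimes>\<^sub>m W)) * A"
      by (rule assoc_mult_mat[symmetric, OF QXI YQW A])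
    also have "((?Q * (z' \<cdot>\<^sub>m X)) \<otimes>\<^sub>m ?I) * ((?Y * ?Qi) \<otimes>\<^sub>m W) = ((?Q * (z'
      \<cdot>\<^sub>m X)) * (?Y * ?Qi)) \<otimes>\<^sub>m W"
      using kron_mult[OF QX one_carrier_mat mult_carrier_mat[OF dg dg] W] W by simp
    finally show ?thesis
      using partial_trace_kron_mult[OF mult_carrier_mat[OF QX mult_carrier_mat[OF dg dg]] W A] by simp
  qed
  \<comment> \<open>This is kl in matrix form; it identifies the auxiliary operators left over in a3
    and a4.\<close>
  have "(?Q * (z' \<cdot>\<^sub>m X)) * (?Y * ?Qi) = ?Y * (z \<cdot>\<^sub>m X)"
  proof (rule eq_matI, goal_cases)
    case (1 i j)
    then have ij: "i < d" "j < d" using X by (auto simp: mat_diag_def)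
    show ?case unfolding mat_diag_diag mat_diag_mult_entry(2)[OF QX ij] mat_diag_mult_entry(1)[OF zX(1) ij]
        mat_diag_mult_entry(1)[OF zX(2) ij]
      using kl[OF ij] X ij by (simp add: mult_ac)
  qed (use X in \<open>auto simp: mat_diag_def\<close>)
  then have "?tr ((?Y \<otimes>\<^sub>m ?I) * (A * ((z' \<cdot>\<^sub>m X) \<otimes>\<^sub>m W))) = ?tr ((?Y \<otimes>\<^sub>m
    ?I) * (((z \<cdot>\<^sub>m X) \<otimes>\<^sub>m W) * A))"
    unfolding a3 a4 by simp
  moreover have "?tr ((?Y \<otimes>\<^sub>m ?I) * (A * ((z' \<cdot>\<^sub>m X) \<otimes>\<^sub>m W))) + ?tr ((?Y
    \<otimes>\<^sub>m ?I) * (A * (?Q \<otimes>\<^sub>m D)))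
      = ?tr ((?Y \<otimes>\<^sub>m ?I) * (((z \<cdot>\<^sub>m X) \<otimes>\<^sub>m W) * A)) + ?tr ((?Y \<otimes>\<^sub>m ?I) *
        ((?Q \<otimes>\<^sub>m D) * A))"
  proof -
    note c = kc[OF zX(1) W] kc[OF zX(2) W] kc[OF dg D, of q]
    show ?thesis
      unfolding partial_trace_add[OF mult_carrier_mat[OF Yi mult_carrier_mat[OF A c(2)]] mult_carrier_mat[OF Yi
        mult_carrier_mat[OF A c(3)]], symmetric]
        partial_trace_add[OF mult_carrier_mat[OF Yi mult_carrier_mat[OF c(1) A]] mult_carrier_mat[OF Yi mult_carrier_mat[OF c(3)
          A]], symmetric]
        dg_dist[OF c(2,3), symmetric] dg_dist'[OF c(1,3), symmetric] int ..
  qed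
  ultimately have "?tr ((?Y \<otimes>\<^sub>m ?I) * (A * (?Q \<otimes>\<^sub>m D))) = ?tr ((?Y \<otimes>\<^sub>m ?I) * ((?Q
    \<otimes>\<^sub>m D) * A))"
    by (smt (verit) add_diff_cancel_left' assoc_add_mat comm_add_mat partial_trace_carrier minus_add_uminus_mat
      uminus_carrier_mat uminus_l_inv_mat left_add_zero_mat)
  then show ?thesis unfolding a1 a2 ..
qed

lemma act_on_commute_power:
  assumes "d > 0" "commutes2 d R Q" "i < L" "j < L" "i \<noteq> j"
  shows "act_on d L R i j * tensor_op d L (\<lambda>_. Q) = tensor_op d L (\<lambda>_. Q) * act_on d L R i j"
  using assms by (intro act_on_exchange[where A = Q and B = Q]) (auto simp: commutes2_def)

lemma mat_prod_commute:
  assumes "W \<in> carrier_mat m m" "\<And>A. A \<in> set As \<Longrightarrow> A \<in> carrier_mat m m \<and> A * W = W * A"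
  shows "mat_prod m As * W = W * mat_prod m As"
  using assms(2)
proof (induction As)
  case (Cons A As)
  have "mat_prod m As \<in> carrier_mat m m" using Cons.prems by (intro mat_prod_carrier) auto
  then show ?case unfolding mat_prod_Cons using Cons assms(1)
    by (intro intertwine_mult[of _ m]) auto
qed (use assms(1) in simp)

text \<open>Everything that depends on the affine type is confined to \<open>exchanges\<close>,
  \<open>commutes2\<close>, kr and kl, so the same argument serves root vectors and Cartan
  elements.\<close>

theorem coprod_commutes_double_row_trace:
  assumes d: "d > 0" and X: "X \<in> carrier_mat d d" and q: "\<And>i. i < d \<Longrightarrow> q i * qi i = 1" and z: "z * z' = 1"
   and Q: "Q = mat_diag d q" and Qi: "Qi = mat_diag d qi"
   and ex: "exchanges d R z X Q Qi" and com: "commutes2 d R Q" "commutes2 d R Qi"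
   and kr: "\<And>i j. i < d \<Longrightarrow> j < d \<Longrightarrow> z' * kr i * X $$ (i, j) = z * X $$ (i, j) * kr j"
   and kl: "\<And>i j. i < d \<Longrightarrow> j < d \<Longrightarrow> z' * q i * X $$ (i, j) * kl j * qi j * qi j = z * kl i *
     qi i * X $$ (i, j)"
   and T: "T = mat_prod (d ^ (N + 1)) (map (\<lambda>k. act_on d (N + 1) R 0 k) (rev [1..<N + 1]))"
   and T': "T' = mat_prod (d ^ (N + 1)) (map (\<lambda>k. act_on d (N + 1) R k 0) [1..<N + 1])"
   and t: "t = partial_trace d (d ^ N) ((mat_diag d kl \<otimes>\<^sub>m 1\<^sub>m (d ^ N)) * T * (mat_diag d kr
     \<otimes>\<^sub>m 1\<^sub>m (d ^ N)) * T')"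
  shows "commutator (coprod_sum d N X Q Qi) t = 0\<^sub>m (d ^ N) (d ^ N)"
proof -
  let ?M = "d ^ (N + 1)" and ?m = "d ^ N"
  let ?K = "mat_diag d kr \<otimes>\<^sub>m 1\<^sub>m ?m" and ?L = "mat_diag d kl \<otimes>\<^sub>m 1\<^sub>m ?m"
  let ?D = "coprod_sum d N X Q Qi" and ?W = "tensor_op d N (\<lambda>_. Qi)"
  have M: "?M = d * ?m" by simp
  have QQ: "Q \<in> carrier_mat d d" "Qi \<in> carrier_mat d d" by (simp_all add: Q Qi)
  have D: "?D \<in> carrier_mat ?m ?m" by (simp add: coprod_sum_def)
  have K: "?K \<in> carrier_mat ?M ?M" "?L \<in> carrier_mat ?M ?M" by (simp_all add: M)
  have TT: "T \<in> carrier_mat ?M ?M" "T' \<in> carrier_mat ?M ?M"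
    unfolding T T' by (intro mat_prod_carrier; auto simp del: power_Suc)+
  have kX: "mat_diag d kr * (z' \<cdot>\<^sub>m X) = (z \<cdot>\<^sub>m X) * mat_diag d kr"
  proof (rule eq_matI, goal_cases)
    case (1 i j)
    then have ij: "i < d" "j < d" using X by (auto simp: mat_diag_def)
    show ?case using mat_diag_mult_entry(1)[OF smult_carrier_mat[OF X] ij] mat_diag_mult_entry(2)[OF smult_carrier_mat[OF X] ij]
        kr[OF ij] X ij by (simp add: mult_ac)
  qed (use X in \<open>auto simp: mat_diag_def\<close>)
  have kQ: "mat_diag d kr * Q = Q * mat_diag d kr" "mat_diag d kr * Qi = Qi * mat_diag d kr"
    by (simp_all add: Q Qi mat_diag_diag mult_ac)
  \<comment> \<open>Reflection at K^R turns the weight z' on the auxiliary factor into z. Summands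
    with X on a site have only Q or Qi on factor 0, which commutes with the diagonal K^R.\<close>
  have kz: "?K * coprod_ord d N X Q Qi z' 0 = coprod_ord d N X Q Qi z 0 * ?K"
    unfolding coprod_ord_def
  proof (intro intertwine_add[OF K(1)] intertwine_sum[OF K(1)] tensor_op_carrier mat_sum_carrier)
    show "?K * tensor_op d (N + 1) (\<lambda>m. if m = 0 then z' \<cdot>\<^sub>m X else if m \<le> 0 then Qi else Q)
      = tensor_op d (N + 1) (\<lambda>m. if m = 0 then z \<cdot>\<^sub>m X else if m \<le> 0 then Qi else Q) * ?K"
      using X kX d by (simp add: tensor_op_Suc kron_mult[of _ d _ ?m] left_mult_one_mat[OF tensor_op_carrier]
        right_mult_one_mat[OF tensor_op_carrier])
    show "?K * tensor_op d (N + 1) (coprod_aux d N X Q Qi 0 l)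
      = tensor_op d (N + 1) (coprod_aux d N X Q Qi 0 l) * ?K" for l
      using X kQ QQ d by (simp add: tensor_op_Suc kron_mult[of _ d _ ?m] coprod_aux_def left_mult_one_mat[OF tensor_op_carrier]
        right_mult_one_mat[OF tensor_op_carrier])
  qed
  let ?A = "T * (?K * T')"
  have A: "?A \<in> carrier_mat ?M ?M" using TT K by (meson mult_carrier_mat)
  have int: "?A * coprod_ord d N X Q Qi z' N = coprod_ord d N X Q Qi z N * ?A"
  proof (rule intertwine_mult[OF TT(1) mult_carrier_mat[OF K(1) TT(2)] coprod_ord_carrier coprod_ord_carrier coprod_ord_carrier])
    show "T * coprod_ord d N X Q Qi z 0 = coprod_ord d N X Q Qi z N * T"
      unfolding T using monodromy_left[OF d X ex com, of N N] by simp
    show "?K * T' * coprod_ord d N X Q Qi z' N = coprod_ord d N X Q Qi z 0 * (?K * T')"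
    proof (rule intertwine_mult[OF K(1) TT(2) coprod_ord_carrier coprod_ord_carrier coprod_ord_carrier kz])
      show "T' * coprod_ord d N X Q Qi z' N = coprod_ord d N X Q Qi z' 0 * T'"
        unfolding T' using monodromy_right[OF d X z ex com, of 0 N] by simp
    qed
  qed
  \<comment> \<open>Qi on all N + 1 factors commutes with both rows and with K^R. This is what later
    allows the quantum part of the unwanted terms to be moved through the monodromy.\<close>
  let ?V = "tensor_op d (N + 1) (\<lambda>_. Qi)"
  have V: "?V = Qi \<otimes>\<^sub>m ?W" using QQ d by (simp add: tensor_op_Suc)
  have Vc: "?V \<in> carrier_mat ?M ?M" by (rule tensor_op_carrier)
  have "T * ?V = ?V * T" unfolding T
    by (rule mat_prod_commute[OF Vc]) (auto intro!: act_on_commute_power[OF d com(2)] simp del: power_Suc)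
  moreover have "T' * ?V = ?V * T'" unfolding T'
    by (rule mat_prod_commute[OF Vc]) (auto intro!: act_on_commute_power[OF d com(2)] simp del: power_Suc)
  moreover have "?K * ?V = ?V * ?K" unfolding V using kQ QQ by (simp add: kron_mult[of _ d _ ?m] left_mult_one_mat[OF
    tensor_op_carrier] right_mult_one_mat[OF tensor_op_carrier])
  ultimately have comV: "?A * ?V = ?V * ?A"
    by (intro intertwine_mult[OF TT(1) mult_carrier_mat[OF K(1) TT(2)] Vc Vc Vc] intertwine_mult[OF K(1) TT(2) Vc Vc Vc])
  have t': "t = partial_trace d ?m (?L * ?A)"
    unfolding t using K TT by (simp add: assoc_mult_mat[of _ ?M ?M _ ?M _ ?M] mult_carrier_mat[of _ ?M ?M] del: power_Suc)
  have "?D * t = t * ?D" unfolding t'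
  proof (rule double_row_trace_commute[OF X q A[unfolded M] D tensor_op_carrier _ _ kl])
    show "?A * ((z' \<cdot>\<^sub>m X) \<otimes>\<^sub>m ?W + mat_diag d q \<otimes>\<^sub>m ?D) = ((z \<cdot>\<^sub>m X)
      \<otimes>\<^sub>m ?W + mat_diag d q \<otimes>\<^sub>m ?D) * ?A"
      using int unfolding coprod_ord_eq_kron[OF d X QQ] Q[symmetric] .
    show "?A * (mat_diag d qi \<otimes>\<^sub>m ?W) = (mat_diag d qi \<otimes>\<^sub>m ?W) * ?A"
      using comV unfolding V Qi[symmetric] .
  qed
  moreover have "t * ?D \<in> carrier_mat ?m ?m" unfolding t by (rule mult_carrier_mat[OF partial_trace_carrier D])
  ultimately show ?thesis unfolding commutator_def by (simp add: minus_r_inv_mat)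
qed

subsection \<open>Entries of the matrices\<close>

definition cartan_weight :: "nat \<Rightarrow> nat \<Rightarrow> nat \<Rightarrow> complex" where
  "cartan_weight d i \<alpha> = (if \<alpha> = i then 1 else 0) - (if \<alpha> = d + 1 - i then 1 else 0)"

lemma H_gen_diag: "H_gen t n i = mat_diag (dimV t n) (\<lambda>x. cartan_weight (dimV t n) i (Suc x))"
  by (intro eq_matI) (auto simp: H_gen_def elem_mat_def mat_diag_def Let_def cartan_weight_def)

lemma mat_diag_arith:
  fixes f g :: "nat \<Rightarrow> complex"
  shows "a \<cdot>\<^sub>m mat_diag d f = mat_diag d (\<lambda>x. a * f x)"
    "mat_diag d f + mat_diag d g = mat_diag d (\<lambda>x. f x + g x)"
    "mat_diag d f - mat_diag d g = mat_diag d (\<lambda>x. f x - g x)"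
    "- mat_diag d f = mat_diag d (\<lambda>x. - f x)"
  by (auto intro!: eq_matI simp: mat_diag_def)

lemma mat_diag_power:
  fixes f :: "nat \<Rightarrow> complex"
  shows "mat_diag d f ^\<^sub>m k = mat_diag d (\<lambda>x. f x ^ k)"
  by (induction k) (simp_all add: mult.commute carrier_matD(1)[OF mat_diag_dim])

lemma mat_exp_diag: "mat_exp (mat_diag d f) = mat_diag d (\<lambda>x. exp (f x))"
proof (rule eq_matI, goal_cases)
  case (1 i j)
  then have ij: "i < d" "j < d" by (auto simp: mat_diag_def)
  have "mat_exp (mat_diag d f) $$ (i, j) = (\<Sum>k. mat_diag d (\<lambda>x. f x ^ k) $$ (i, j) / fact k)"
    using ij by (simp add: mat_exp_def carrier_matD(1)[OF mat_diag_dim] mat_diag_power)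
  also have "\<dots> = (if i = j then \<Sum>k. f i ^ k / fact k else 0)"
    using ij by (simp add: mat_diag_def)
  also have "(\<Sum>k. f i ^ k / fact k) = exp (f i)"
    by (simp add: exp_def scaleR_conv_of_real field_simps)
  finally show ?case using ij by (simp add: mat_diag_def)
qed (simp_all add: mat_exp_def mat_diag_def)

text \<open>\<open>mat_inverse\<close> returns an option, so invertibility is established before a
  value can be named; uniqueness of inverses then identifies it.\<close>

lemma mat_inv_diag:
  assumes "\<And>x. x < d \<Longrightarrow> q x * qi x = 1"
  shows "mat_inv (mat_diag d q) = mat_diag d qi"
proof -
  let ?Q = "mat_diag d q" and ?Qi = "mat_diag d qi"
  have inv: "?Q * ?Qi = 1\<^sub>m d" "?Qi * ?Q = 1\<^sub>m d"
    using assms unfolding mat_diag_diag by (auto intro!: eq_matI simp: mat_diag_def mult.commute)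
  have "?Q \<in> Units (ring_mat TYPE(complex) d ())"
    using inv mat_diag_dim[of d q] mat_diag_dim[of d qi] unfolding Units_def ring_mat_def
    by (simp del: mat_diag_diag mat_diag_dim) blast
  then obtain B where B: "mat_inverse ?Q = Some B"
    using mat_inverse(1)[OF mat_diag_dim] by (meson not_None_eq)
  have B': "?Q * B = 1\<^sub>m d" "B \<in> carrier_mat d d" using mat_inverse(2)[OF mat_diag_dim B] by auto
  have "B = (?Qi * ?Q) * B" using B'(2) inv by simp
  also have "\<dots> = ?Qi * (?Q * B)" by (rule assoc_mult_mat[OF mat_diag_dim mat_diag_dim B'(2)])
  also have "\<dots> = ?Qi" using B'(1) right_mult_one_mat[OF mat_diag_dim] by simp
  finally show ?thesis using B by (simp add: mat_inv_def)
qed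

abbreviation F_fun :: "affine_type \<Rightarrow> nat \<Rightarrow> complex \<Rightarrow> complex \<Rightarrow> nat \<Rightarrow>
  nat \<Rightarrow> complex" where
  "F_fun t n \<eta> u a c \<equiv> (if a < c then e_fun t n \<eta> u else ebar_fun t n \<eta> u)"

lemma elem_kron_elem_index:
  assumes "a < d" "b < d" "c < d" "e < d"
  shows "(elem_mat d i j \<otimes>\<^sub>m elem_mat d k l) $$ (a * d + b, c * d + e)
    = (if Suc a = i \<and> Suc c = j \<and> Suc b = k \<and> Suc e = l then 1 else 0)"
proof -
  have c: "elem_mat d x y \<in> carrier_mat d d" for x y by (simp add: elem_mat_def)
  show ?thesis unfolding kron_index[OF c c assms(1,3,2,4)] using assms by (simp add: elem_mat_def)
qed

text \<open>A fixed entry selects at most one summand, the one at p0, and P collects the equalities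
  between the four indices that remain to be met.\<close>

lemma sum_elem_kron_elem:
  assumes "finite S" "S \<subseteq> {1..d} \<times> {1..d}" "a < d" "b < d" "c < d" "e < d"
    and "\<And>p. p \<in> S \<Longrightarrow> f p = g p \<cdot>\<^sub>m (elem_mat d (i p) (j p) \<otimes>\<^sub>m elem_mat d (k
      p) (l p))"
    and "\<And>p. p \<in> S \<Longrightarrow> (Suc a = i p \<and> Suc c = j p \<and> Suc b = k p \<and> Suc e = l p)
      \<longleftrightarrow> (p = p0 \<and> P)"
  shows "mat_sum (d * d) f S $$ (a * d + b, c * d + e) = (if p0 \<in> S \<and> P then g p0 else 0)"
proof -
  have l: "a * d + b < d * d" "c * d + e < d * d" using assms by (simp_all add: block_index_less)
  have "f p $$ (a * d + b, c * d + e) = (if p = p0 then if P then g p0 else 0 else 0)" if "p \<in> S" for p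
  proof -
    have "dim_row (elem_mat d x y) = d" "dim_col (elem_mat d x y) = d" for x y by (simp_all add: elem_mat_def)
    then have "f p $$ (a * d + b, c * d + e) =
        g p * (elem_mat d (i p) (j p) \<otimes>\<^sub>m elem_mat d (k p) (l p)) $$ (a * d + b, c * d + e)"
      using l by (simp add: assms(7)[OF that] kron_def)
    then show ?thesis using assms(8)[OF that] assms(3-6) by (auto simp: elem_kron_elem_index)
  qed
  then show ?thesis using l assms(1) by (simp add: mat_sum_def)
qed

lemma r_entry_expand:
  "r_entry pr C B (\<lambda>a c. if a < c then E else E') V a b c e =
      C * (if a = b \<and> a = c \<and> a = e \<and> a \<noteq> pr a then 1 else 0)
    + B * (if a = c \<and> b = e \<and> a \<noteq> b \<and> b \<noteq> pr a then 1 else 0)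
    + E * (if a = e \<and> b = c \<and> a < b \<and> b \<noteq> pr a then 1 else 0)
    + E' * (if a = e \<and> b = c \<and> b < a \<and> b \<noteq> pr a then 1 else 0)
    + (if b = pr a \<and> e = pr c then V a c else 0)"
proof -
  \<comment> \<open>Hiding duality behind P leaves a case split in which no equation for
    \<open>pr\<close> can be used for rewriting.\<close>
  define P where "P x y \<longleftrightarrow> y = pr x" for x y
  show ?thesis
    unfolding r_entry_def P_def[symmetric]
    by (cases "a = b"; cases "a < b"; cases "P a b") auto
qed

lemma R_mat_entry:
  fixes t n
  defines "d \<equiv> dimV t n"
  assumes "a < d" "b < d" "c < d" "e < d"
  shows "R_mat t n \<eta> u $$ (a * d + b, c * d + e) =
    r_entry (dual_index t n) (c_fun t n \<eta> u) (b_fun t n \<eta> u) (F_fun t n \<eta> u) (a_fun t n \<eta> u)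
      (Suc a) (Suc b) (Suc c) (Suc e)"
proof -
  let ?du = "dual_index t n" and ?E = "elem_mat d" and ?I = "{1..d}"
  have l: "a * d + b < d * d" "c * d + e < d * d" using assms by (simp_all add: block_index_less)
  have du: "Suc x = ?du (Suc y) \<longleftrightarrow> Suc y = ?du (Suc x)" if "x < d" "y < d" for x y
    using that by (auto simp: dual_index_def d_def)
  have e1: "mat_sum (d * d) (\<lambda>\<alpha>. ?E \<alpha> \<alpha> \<otimes>\<^sub>m ?E \<alpha> \<alpha>) {\<alpha> \<in> ?I.
    \<alpha> \<noteq> ?du \<alpha>} $$ (a * d + b, c * d + e)
    = (if a = b \<and> a = c \<and> a = e \<and> Suc a \<noteq> ?du (Suc a) then 1 else 0)"
  proof -
    have "(?E \<alpha> \<alpha> \<otimes>\<^sub>m ?E \<alpha> \<alpha>) $$ (a * d + b, c * d + e)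
       = (if \<alpha> = Suc a then if a = b \<and> a = c \<and> a = e then 1 else 0 else 0)" for \<alpha>
      using assms by (auto simp: elem_kron_elem_index)
    then show ?thesis using l assms by (simp add: mat_sum_def)
  qed
  have e2: "mat_sum (d * d) (\<lambda>(\<alpha>, \<beta>). ?E \<alpha> \<alpha> \<otimes>\<^sub>m ?E \<beta> \<beta>) {(\<alpha>,
    \<beta>) \<in> ?I \<times> ?I. \<alpha> \<noteq> \<beta> \<and> \<alpha> \<noteq> ?du \<beta>} $$ (a * d + b, c * d + e)
    = (if (Suc a, Suc b) \<in> {(\<alpha>, \<beta>) \<in> ?I \<times> ?I. \<alpha> \<noteq> \<beta> \<and> \<alpha> \<noteq> ?du
      \<beta>} \<and> (a = c \<and> b = e) then 1 else 0)"
    using assms by (intro sum_elem_kron_elem[where g = "\<lambda>_. 1" and i = fst and j = fst and k = snd and l = snd])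
      (auto intro: finite_subset[of _ "?I \<times> ?I"])
  have e3: "mat_sum (d * d) (\<lambda>(\<alpha>, \<beta>). ?E \<alpha> \<beta> \<otimes>\<^sub>m ?E \<beta> \<alpha>) {(\<alpha>,
    \<beta>) \<in> ?I \<times> ?I. \<alpha> < \<beta> \<and> \<alpha> \<noteq> ?du \<beta>} $$ (a * d + b, c * d + e)
    = (if (Suc a, Suc b) \<in> {(\<alpha>, \<beta>) \<in> ?I \<times> ?I. \<alpha> < \<beta> \<and> \<alpha> \<noteq> ?du
      \<beta>} \<and> (a = e \<and> b = c) then 1 else 0)"
    using assms by (intro sum_elem_kron_elem[where g = "\<lambda>_. 1" and i = fst and j = snd and k = snd and l = fst])
      (auto intro: finite_subset[of _ "?I \<times> ?I"])
  have e4: "mat_sum (d * d) (\<lambda>(\<alpha>, \<beta>). ?E \<alpha> \<beta> \<otimes>\<^sub>m ?E \<beta> \<alpha>) {(\<alpha>,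
    \<beta>) \<in> ?I \<times> ?I. \<alpha> > \<beta> \<and> \<alpha> \<noteq> ?du \<beta>} $$ (a * d + b, c * d + e)
    = (if (Suc a, Suc b) \<in> {(\<alpha>, \<beta>) \<in> ?I \<times> ?I. \<alpha> > \<beta> \<and> \<alpha> \<noteq> ?du
      \<beta>} \<and> (a = e \<and> b = c) then 1 else 0)"
    using assms by (intro sum_elem_kron_elem[where g = "\<lambda>_. 1" and i = fst and j = snd and k = snd and l = fst])
      (auto intro: finite_subset[of _ "?I \<times> ?I"])
  have e5: "mat_sum (d * d) (\<lambda>(\<alpha>, \<beta>). a_fun t n \<eta> u \<alpha> \<beta> \<cdot>\<^sub>m (?E \<alpha>
    \<beta> \<otimes>\<^sub>m ?E (?du \<alpha>) (?du \<beta>))) (?I \<times> ?I) $$ (a * d + b, c * d + e)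
    = (if (Suc a, Suc c) \<in> ?I \<times> ?I \<and> (Suc b = ?du (Suc a) \<and> Suc e = ?du (Suc c)) then a_fun t n \<eta> u
      (fst (Suc a, Suc c)) (snd (Suc a, Suc c)) else 0)"
    using assms by (intro sum_elem_kron_elem[where g = "\<lambda>p. a_fun t n \<eta> u (fst p) (snd p)" and i = fst and j = snd
        and k = "\<lambda>p. ?du (fst p)" and l = "\<lambda>p. ?du (snd p)"]) auto
  have dab: "Suc a = ?du (Suc b) \<longleftrightarrow> Suc b = ?du (Suc a)" by (rule du) (use assms in auto)
  have f2: "mat_sum (d * d) (\<lambda>(\<alpha>, \<beta>). ?E \<alpha> \<alpha> \<otimes>\<^sub>m ?E \<beta> \<beta>) {(\<alpha>,
    \<beta>) \<in> ?I \<times> ?I. \<alpha> \<noteq> \<beta> \<and> \<alpha> \<noteq> ?du \<beta>} $$ (a * d + b, c * d + e)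
    = (if a = c \<and> b = e \<and> a \<noteq> b \<and> Suc b \<noteq> ?du (Suc a) then 1 else 0)"
    unfolding e2 mem_Collect_eq split dab using assms by auto
  have f3: "mat_sum (d * d) (\<lambda>(\<alpha>, \<beta>). ?E \<alpha> \<beta> \<otimes>\<^sub>m ?E \<beta> \<alpha>) {(\<alpha>,
    \<beta>) \<in> ?I \<times> ?I. \<alpha> < \<beta> \<and> \<alpha> \<noteq> ?du \<beta>} $$ (a * d + b, c * d + e)
    = (if a = e \<and> b = c \<and> a < b \<and> Suc b \<noteq> ?du (Suc a) then 1 else 0)"
    unfolding e3 mem_Collect_eq split dab using assms by auto
  have f4: "mat_sum (d * d) (\<lambda>(\<alpha>, \<beta>). ?E \<alpha> \<beta> \<otimes>\<^sub>m ?E \<beta> \<alpha>) {(\<alpha>,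
    \<beta>) \<in> ?I \<times> ?I. \<alpha> > \<beta> \<and> \<alpha> \<noteq> ?du \<beta>} $$ (a * d + b, c * d + e)
    = (if a = e \<and> b = c \<and> b < a \<and> Suc b \<noteq> ?du (Suc a) then 1 else 0)"
    unfolding e4 mem_Collect_eq split dab using assms by auto
  have f5: "mat_sum (d * d) (\<lambda>(\<alpha>, \<beta>). a_fun t n \<eta> u \<alpha> \<beta> \<cdot>\<^sub>m (?E \<alpha>
    \<beta> \<otimes>\<^sub>m ?E (?du \<alpha>) (?du \<beta>))) (?I \<times> ?I) $$ (a * d + b, c * d + e)
    = (if Suc b = ?du (Suc a) \<and> Suc e = ?du (Suc c) then a_fun t n \<eta> u (Suc a) (Suc c) else 0)"
    unfolding e5 using assms by simp
  have idx: "(x1 \<cdot>\<^sub>m S1 + x2 \<cdot>\<^sub>m S2 + x3 \<cdot>\<^sub>m S3 + x4 \<cdot>\<^sub>m S4 + S5) $$ (a * d + b,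
    c * d + e) =
      x1 * S1 $$ (a * d + b, c * d + e) + x2 * S2 $$ (a * d + b, c * d + e) + x3 * S3 $$ (a * d + b, c * d + e)
      + x4 * S4 $$ (a * d + b, c * d + e) + S5 $$ (a * d + b, c * d + e)"
    if "S1 \<in> carrier_mat (d * d) (d * d)" "S2 \<in> carrier_mat (d * d) (d * d)" "S3 \<in> carrier_mat (d * d) (d * d)"
      "S4 \<in> carrier_mat (d * d) (d * d)" "S5 \<in> carrier_mat (d * d) (d * d)" for S1 S2 S3 S4 S5 and x1 x2 x3 x4 :: complex
    using that l by simp
  have "R_mat t n \<eta> u $$ (a * d + b, c * d + e) =
      c_fun t n \<eta> u * (if a = b \<and> a = c \<and> a = e \<and> Suc a \<noteq> ?du (Suc a) then 1 else 0)
    + b_fun t n \<eta> u * (if a = c \<and> b = e \<and> a \<noteq> b \<and> Suc b \<noteq> ?du (Suc a) then 1 else 0)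
    + e_fun t n \<eta> u * (if a = e \<and> b = c \<and> a < b \<and> Suc b \<noteq> ?du (Suc a) then 1 else 0)
    + ebar_fun t n \<eta> u * (if a = e \<and> b = c \<and> b < a \<and> Suc b \<noteq> ?du (Suc a) then 1 else 0)
    + (if Suc b = ?du (Suc a) \<and> Suc e = ?du (Suc c) then a_fun t n \<eta> u (Suc a) (Suc c) else 0)"
    unfolding R_mat_def Let_def d_def[symmetric]
    unfolding idx[OF mat_sum_carrier mat_sum_carrier mat_sum_carrier mat_sum_carrier mat_sum_carrier]
    unfolding e1 f2 f3 f4 f5 ..
  then show ?thesis by (simp only: r_entry_expand nat.inject Suc_less_eq)
qed

lemma hfun_exp: "hfun t x = (exp x - sigma t * exp (- x)) / 2"
  by (auto simp: hfun_def sigma_def cosh_field_def sinh_field_def)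

definition G_fun :: "affine_type \<Rightarrow> nat \<Rightarrow> complex \<Rightarrow> nat \<Rightarrow> complex" where
  "G_fun t n \<eta> \<alpha> = eps t n \<alpha> * exp (2 * bar t n \<alpha> * \<eta>)"

lemma R_coefficients:
  fixes t n \<eta> u
  defines "y \<equiv> exp (u / 2)" and "Q \<equiv> exp \<eta>" and "K \<equiv> exp (kappa t n * \<eta>)"
  shows "c_fun t n \<eta> u = C_coef y Q K (sigma t)"
    "b_fun t n \<eta> u = B_coef y K (sigma t)"
    "F_fun t n \<eta> u a c = F_coef y Q K (sigma t) a c"
    "a \<in> {1..dimV t n} \<Longrightarrow> c \<in> {1..dimV t n} \<Longrightarrow>
      a_fun t n \<eta> u a c = V_coef (dual_index t n) y Q K (sigma t) (G_fun t n \<eta>) a c"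
proof -
  have nz: "y \<noteq> 0" "Q \<noteq> 0" "K \<noteq> 0" by (simp_all add: y_def Q_def K_def)
  have ex: "exp (2 * \<eta>) = Q^2" "exp u = y^2"
    unfolding y_def Q_def power2_eq_square by (simp_all add: exp_add[symmetric])
  have ex': "exp (- (2 * \<eta>)) = 1 / Q^2" "exp (- (u / 2)) = 1 / y" "exp (- u / 2) = 1 / y"
    "exp (- (kappa t n * \<eta>)) = 1 / K"
    by (simp_all add: ex exp_minus inverse_eq_divide y_def K_def)
  have s: "sinh (2 * \<eta>) = (Q^2 - 1/Q^2) / 2" "sinh (u / 2) = (y - 1/y) / 2"
    by (simp_all add: sinh_field_def ex ex' flip: y_def)
  have su: "sinh (u/2 - 2 * \<eta>) = (y/Q^2 - Q^2/y) / 2"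
    by (simp add: sinh_field_def exp_diff ex flip: y_def)
  have h: "hfun t (u/2 - kappa t n * \<eta>) = (y/K - sigma t * K / y) / 2"
    by (simp add: hfun_exp exp_diff flip: y_def K_def)
  have h2: "hfun t (u/2 - (kappa t n - 2) * \<eta>) = (y * Q^2/K - sigma t * K / (y * Q^2)) / 2"
    by (simp add: hfun_exp exp_diff left_diff_distrib ex flip: y_def K_def)
  show c: "c_fun t n \<eta> u = C_coef y Q K (sigma t)"
    unfolding c_fun_def su h by (simp add: mult.commute[of 2])
  show b: "b_fun t n \<eta> u = B_coef y K (sigma t)"
    unfolding b_fun_def s h by simp
  show "F_fun t n \<eta> u a c = F_coef y Q K (sigma t) a c"
    unfolding F_coef_def e_fun_def ebar_fun_def s h ex' ex using nz by (simp add: field_simps power2_eq_square)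
  assume a: "a \<in> {1..dimV t n}" "c \<in> {1..dimV t n}"
  have d1: "c = dual_index t n a \<longleftrightarrow> a = dual_index t n c" using a by (auto simp: dual_index_def)
  \<comment> \<open>As \<open>eps\<close> is 1 or - 1, its product equals its quotient. This turns
    the factor in \<open>a_fun\<close> that depends on both indices into a ratio of values of
    \<open>G_fun\<close>.\<close>
  have eps: "eps t n x / eps t n z = eps t n x * eps t n z" for x z by (simp add: eps_def)
  have g: "G_fun t n \<eta> a / G_fun t n \<eta> c = eps t n a * eps t n c * exp (2 * (bar t n a - bar t n c) * \<eta>)"
  proof -
    have "G_fun t n \<eta> a / G_fun t n \<eta> c = (eps t n a / eps t n c) * exp (2 * bar t n a * \<eta> - 2 * bar t n c *
      \<eta>)"
      by (simp add: G_fun_def exp_diff)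
    then show ?thesis unfolding eps by (simp add: algebra_simps)
  qed
  have k: "exp ((kappa t n + 2 * (bar t n a - bar t n c)) * \<eta>) = K * exp (2 * (bar t n a - bar t n c) * \<eta>)"
    "exp ((- kappa t n + 2 * (bar t n a - bar t n c)) * \<eta>) = exp (2 * (bar t n a - bar t n c) * \<eta>) / K"
  proof -
    have "(kappa t n + r) * \<eta> = kappa t n * \<eta> + r * \<eta>"
      "(- kappa t n + r) * \<eta> = r * \<eta> - kappa t n * \<eta>" for r
      by (simp_all add: algebra_simps)
    then show "exp ((kappa t n + 2 * (bar t n a - bar t n c)) * \<eta>) = K * exp (2 * (bar t n a - bar t n c) * \<eta>)"
      "exp ((- kappa t n + 2 * (bar t n a - bar t n c)) * \<eta>) = exp (2 * (bar t n a - bar t n c) * \<eta>) / K"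
      unfolding K_def by (simp_all only: exp_add exp_diff)
  qed
  show "a_fun t n \<eta> u a c = V_coef (dual_index t n) y Q K (sigma t) (G_fun t n \<eta>) a c"
  proof (cases "a = c")
    case True
    show ?thesis
    proof (cases "a = dual_index t n a")
      case self: True
      \<comment> \<open>A self-dual index requires odd dimension, which leaves two types.\<close>
      have t: "t = B1 \<or> t = A2_even"
      proof (rule ccontr)
        assume "\<not> ?thesis"
        then have "dimV t n = 2 * n" by (cases t) (auto simp: dimV_def)
        then show False using self a by (simp add: dual_index_def) presburger
      qed
      \<comment> \<open>The exceptional corrections contain sinh ((2n - 1) * \<eta>) and cosh ((2n +
        1) * \<eta>), and these arguments are kappa * \<eta> in the respective types. Hence a single
        expression in K and \<sigma> covers both.\<close>
      define X where "X = (y - 1/y) * (y/K - sigma t * K/y)"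
      have V: "V_coef (dual_index t n) y Q K (sigma t) (G_fun t n \<eta>) a c
          = (X + sigma t * (Q^2 - 1/Q^2) * (K - sigma t / K)) / 2"
        using True self by (simp add: V_coef_def X_def)
      show ?thesis
      proof (cases "t = B1")
        case B: True
        have sh: "sinh ((2 * of_nat n - 1) * \<eta>) = (K - 1/K) / 2"
          using B by (simp add: sinh_field_def K_def exp_minus inverse_eq_divide)
        have "a_fun t n \<eta> u a c = X / 2 + 2 * sinh (2 * \<eta>) * sinh ((2 * of_nat n - 1) * \<eta>)"
          unfolding X_def b[symmetric] using True self B by (simp add: a_fun_def Let_def)
        then show ?thesis unfolding V s sh using B by (simp add: sigma_def add_divide_distrib)
      next
        case B: False
        then have t: "t = A2_even" using t by simp
        have sh: "cosh ((2 * of_nat n + 1) * \<eta>) = (K + 1/K) / 2"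
          using t by (simp add: cosh_field_def K_def exp_minus inverse_eq_divide)
        have "a_fun t n \<eta> u a c = X / 2 - 2 * sinh (2 * \<eta>) * cosh ((2 * of_nat n + 1) * \<eta>)"
          unfolding X_def b[symmetric] using True self B by (simp add: a_fun_def Let_def)
        then show ?thesis unfolding V s sh using t by (simp add: sigma_def diff_divide_distrib) (simp add: algebra_simps)
      qed
    next
      case False
      then show ?thesis using True by (simp add: a_fun_def V_coef_def Let_def s h2)
    qed
  next
    case False
    define E w where "E = exp (2 * (bar t n a - bar t n c) * \<eta>)" and "w = y / K - sigma t * K / y"
    from False show ?thesis unfolding a_fun_def V_coef_def Let_def s h ex' k g d1 y_def[symmetric] E_def[symmetric]
      w_def[symmetric]
      using nz by (cases "a < c"; cases "a = dual_index t n c")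
        (simp_all only: if_True if_False simp_thms, simp_all add: field_simps)
  qed
qed

lemma dual_index_involutive: "x \<in> {1..dimV t n} \<Longrightarrow> dual_index t n x \<in> {1..dimV t n} \<and> dual_index t n
  (dual_index t n x) = x"
  by (auto simp: dual_index_def)

lemma local_int_cong:
  assumes e: "\<And>a b c e. a \<in> I \<Longrightarrow> b \<in> I \<Longrightarrow> c \<in> I \<Longrightarrow> e \<in> I
    \<Longrightarrow> r a b c e = r' a b c e"
    and loc: "local_int I r z \<xi> q qi"
  shows "local_int I r' z \<xi> q qi"
  unfolding local_int_def
proof (intro ballI)
  fix a b c e assume A: "a \<in> I" "b \<in> I" "c \<in> I" "e \<in> I"
  show "z * q e * (\<Sum>s\<in>I. r' a b s e * \<xi> s c) + qi c * (\<Sum>s\<in>I. r' a b c s * \<xi> s e)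
   = z * qi b * (\<Sum>s\<in>I. \<xi> a s * r' s b c e) + q a * (\<Sum>s\<in>I. \<xi> b s * r' a s c e)"
    using loc[unfolded local_int_def, rule_format, OF A] by (simp add: e A cong: sum.cong)
qed

text \<open>Each term of the relation is linear in X, so a normalising scalar w such as sqrt 2
  factors out. The diagonal matrices collapse one of the two sums in every term.\<close>

lemma exchanges_of_local_int:
  assumes R: "\<And>a b c e. a < d \<Longrightarrow> b < d \<Longrightarrow> c < d \<Longrightarrow> e < d \<Longrightarrow>
      R $$ (a * d + b, c * d + e) = r (Suc a) (Suc b) (Suc c) (Suc e)"
   and X: "\<And>s c. s < d \<Longrightarrow> c < d \<Longrightarrow> X $$ (s, c) = w * \<xi> (Suc s) (Suc c)"
   and loc: "local_int {1..d} r z \<xi> q qi"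
  shows "exchanges d R z X (mat_diag d (\<lambda>x. q (Suc x))) (mat_diag d (\<lambda>x. qi (Suc x)))"
  unfolding exchanges_def
proof (intro allI impI)
  fix a b c e assume A: "a < d" "b < d" "c < d" "e < d"
  let ?Q = "mat_diag d (\<lambda>x. q (Suc x))" and ?Qi = "mat_diag d (\<lambda>x. qi (Suc x))"
  have D: "mat_diag d f $$ (x, y) = (if x = y then f y else 0)" if "x < d" "y < d" for x y and f :: "nat \<Rightarrow> complex"
    using that by (simp add: mat_diag_def)
  have sw: "(\<Sum>s<d. \<Sum>t<d. if s = x then f s t else 0) = (\<Sum>t<d. f x t)" if "x < d" for x and f :: "nat \<Rightarrow>
    nat \<Rightarrow> complex"
    using that by (subst sum.swap) simp
  let ?r = "\<lambda>a b c e. r (Suc a) (Suc b) (Suc c) (Suc e)" and ?x = "\<lambda>s c. \<xi> (Suc s) (Suc c)"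
  have loc': "z * q (Suc e) * (\<Sum>s<d. ?r a b s e * ?x s c) + qi (Suc c) * (\<Sum>t<d. ?r a b c t * ?x t e)
     = z * qi (Suc b) * (\<Sum>s<d. ?x a s * ?r s b c e) + q (Suc a) * (\<Sum>s<d. ?x b s * ?r a s c e)"
    using loc[unfolded local_int_def, rule_format, of "Suc a" "Suc b" "Suc c" "Suc e"] A
    by (simp add: sum.atLeast1_atMost_eq)
  have "(\<Sum>s<d. \<Sum>t<d. R $$ (a * d + b, s * d + t) * (z * X $$ (s, c) * ?Q $$ (t, e) + ?Qi $$ (s, c) * X $$ (t, e)))
     = (\<Sum>s<d. \<Sum>t<d. if t = e then w * (z * q (Suc e) * (?r a b s e * ?x s c)) else 0)
     + (\<Sum>s<d. \<Sum>t<d. if s = c then w * (qi (Suc c) * (?r a b c t * ?x t e)) else 0)"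
    unfolding sum.distrib[symmetric]
    using A by (intro sum.cong refl; simp add: R X D; (auto simp: algebra_simps)?)
  also have "\<dots> = w * (z * q (Suc e) * (\<Sum>s<d. ?r a b s e * ?x s c) + qi (Suc c) * (\<Sum>t<d. ?r a b c t * ?x t e))"
    using A by (subst (2) sum.swap) (simp add: sum_distrib_left distrib_left)
  also have "\<dots> = w * (z * qi (Suc b) * (\<Sum>s<d. ?x a s * ?r s b c e) + q (Suc a) * (\<Sum>s<d. ?x b s * ?r a s c e))"
    unfolding loc' ..
  also have "\<dots> = (\<Sum>s<d. \<Sum>t<d. if t = b then w * (z * qi (Suc b) * (?x a s * ?r s b c e)) else 0)
     + (\<Sum>s<d. \<Sum>t<d. if s = a then w * (q (Suc a) * (?x b t * ?r a t c e)) else 0)"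
    unfolding sw[OF A(1)] using A by (simp add: sum_distrib_left distrib_left)
  also have "\<dots> = (\<Sum>s<d. \<Sum>t<d. (z * X $$ (a, s) * ?Qi $$ (b, t) + ?Q $$ (a, s) * X $$ (b, t)) * R $$ (s * d + t, c
    * d + e))"
    unfolding sum.distrib[symmetric]
    using A by (intro sum.cong refl; simp add: R X D; (auto simp: algebra_simps)?)
  finally show "(\<Sum>s<d. \<Sum>t<d. R $$ (a * d + b, s * d + t) * (z * X $$ (s, c) * ?Q $$ (t, e) + ?Qi $$ (s, c) * X $$ (t,
    e)))
     = (\<Sum>s<d. \<Sum>t<d. (z * X $$ (a, s) * ?Qi $$ (b, t) + ?Q $$ (a, s) * X $$ (b, t)) * R $$ (s * d + t, c * d + e))" .
qed

text \<open>A nonzero entry either keeps the two indices up to order or sends a dual pair to a dual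
  pair; both preserve the product of weights.\<close>

lemma r_entry_weight:
  assumes "q a * q (pr a) = 1" "q c * q (pr c) = (1::complex)"
  shows "r_entry pr C B F V a b c e = 0 \<or> q a * q b = q c * q e"
proof -
  have "(if P1 \<and> P2 \<and> P3 then x else 0) + (if S1 \<and> S2 \<and> S3 \<and> S4 then y else 0) + (if T1 \<and> T2 then v
    else 0) = 0
      \<or> P1 \<and> P2 \<or> S1 \<and> S2 \<or> T1 \<and> T2" for P1 P2 P3 S1 S2 S3 S4 T1 T2 and x y v :: complex
    by auto
  then have "r_entry pr C B F V a b c e = 0 \<or> a = c \<and> b = e \<or> a = e \<and> b = c \<or> b = pr a \<and> e = pr c"
    unfolding r_entry_def .
  then show ?thesis using assms by (metis mult.commute)
qed

lemma commutes2_R_mat: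
  fixes t n
  defines "d \<equiv> dimV t n"
  assumes q: "\<And>\<alpha>. \<alpha> \<in> {1..d} \<Longrightarrow> q \<alpha> * q (dual_index t n \<alpha>) = 1"
  shows "commutes2 d (R_mat t n \<eta> u) (mat_diag d (\<lambda>x. q (Suc x)))"
  unfolding commutes2_def
proof (intro allI impI)
  fix a b c e assume A: "a < d" "b < d" "c < d" "e < d"
  let ?Q = "mat_diag d (\<lambda>x. q (Suc x))" and ?R = "R_mat t n \<eta> u"
  have D: "mat_diag d f $$ (x, y) = (if x = y then f y else 0)" if "x < d" "y < d" for x y and f :: "nat \<Rightarrow> complex"
    using that by (simp add: mat_diag_def)
  have "(\<Sum>s<d. \<Sum>t<d. ?R $$ (a * d + b, s * d + t) * (?Q $$ (s, c) * ?Q $$ (t, e)))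
     = (\<Sum>s<d. \<Sum>t<d. if t = e then if s = c then ?R $$ (a * d + b, c * d + e) * (q (Suc c) * q (Suc e)) else 0 else 0)"
    using A by (intro sum.cong refl) (auto simp: D)
  also have "\<dots> = ?R $$ (a * d + b, c * d + e) * (q (Suc c) * q (Suc e))"
    using A by simp
  also have "\<dots> = (q (Suc a) * q (Suc b)) * ?R $$ (a * d + b, c * d + e)"
  proof -
    have "?R $$ (a * d + b, c * d + e) = 0 \<or> q (Suc a) * q (Suc b) = q (Suc c) * q (Suc e)"
      unfolding R_mat_entry[OF A[unfolded d_def], folded d_def]
      by (rule r_entry_weight; rule q) (use A in auto)
    then show ?thesis by (metis mult.commute mult_zero_left)
  qed
  also have "\<dots> = (\<Sum>s<d. \<Sum>t<d. if t = b then if s = a then (q (Suc a) * q (Suc b)) * ?R $$ (a * d + b, c * d + e)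
    else 0 else 0)"
    using A by simp
  also have "\<dots> = (\<Sum>s<d. \<Sum>t<d. (?Q $$ (a, s) * ?Q $$ (b, t)) * ?R $$ (s * d + t, c * d + e))"
    using A by (intro sum.cong refl) (auto simp: D)
  finally show "(\<Sum>s<d. \<Sum>t<d. ?R $$ (a * d + b, s * d + t) * (?Q $$ (s, c) * ?Q $$ (t, e)))
     = (\<Sum>s<d. \<Sum>t<d. (?Q $$ (a, s) * ?Q $$ (b, t)) * ?R $$ (s * d + t, c * d + e))" .
qed

section \<open>The diagonals of the K-matrices and a single generator on the chain\<close>

definition KR_entry :: "affine_type \<Rightarrow> nat \<Rightarrow> complex \<Rightarrow> complex \<Rightarrow> nat \<Rightarrow>
  complex \<Rightarrow> nat \<Rightarrow> complex" where
  "KR_entry t n \<eta> \<gamma>0 p u \<alpha> =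
     (if \<alpha> \<le> p then exp (- u)
      else if \<alpha> \<le> dimV t n - p then (gam t n \<eta> \<gamma>0 p * exp u + 1) / (gam t n \<eta> \<gamma>0 p + exp u)
      else exp u)"

lemma KR_mat_diag: "KR_mat t n \<eta> \<gamma>0 p u = mat_diag (dimV t n) (\<lambda>x. KR_entry t n \<eta> \<gamma>0 p u (Suc x))"
  unfolding KR_mat_def KR_entry_def by (rule arg_cong[where f = "mat_diag _"]) (auto simp: fun_eq_iff Suc_le_eq)

abbreviation M_const :: "affine_type \<Rightarrow> nat \<Rightarrow> complex \<Rightarrow> complex" where
  "M_const t n \<eta> \<equiv> (if t \<in> {A2_odd, C1} then - 1 else 1) * exp (2 * (of_nat (dimV t n) + 1) * \<eta>)"

lemma G_fun_nonzero: "G_fun t n \<eta> \<alpha> \<noteq> 0"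
  by (simp add: G_fun_def eps_def)

text \<open>Squaring \<open>G_fun\<close> removes \<open>eps\<close>, and the sign of M goes into
  \<open>M_const\<close>. The G-ratios that govern R therefore govern K^L as well.\<close>

lemma M_mat_diag: "M_mat t n \<eta> = mat_diag (dimV t n) (\<lambda>x. M_const t n \<eta> / (G_fun t n \<eta> (Suc x))^2)"
proof (rule eq_matI, goal_cases)
  case (1 i j)
  then have ij: "i < dimV t n" "j < dimV t n" by (auto simp: mat_diag_def)
  let ?m = "\<lambda>\<alpha>. (if t \<in> {A2_odd, C1} then - 1 else 1) * exp (4 * ((of_nat (dimV t n) + 1) / 2 - bar t n
    \<alpha>) * \<eta>)"
  have m: "?m \<alpha> = M_const t n \<eta> / (G_fun t n \<eta> \<alpha>)^2" for \<alpha>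
  proof -
    have "(G_fun t n \<eta> \<alpha>)^2 = exp (4 * bar t n \<alpha> * \<eta>)"
      by (simp add: G_fun_def eps_def power_mult_distrib mult.assoc flip: exp_double)
    moreover have "4 * ((of_nat (dimV t n) + 1) / 2 - bar t n \<alpha>) * \<eta>
       = 2 * (of_nat (dimV t n) + 1) * \<eta> - 4 * bar t n \<alpha> * \<eta>" by (simp add: field_simps)
    ultimately show ?thesis by (simp add: exp_diff)
  qed
  have "M_mat t n \<eta> $$ (i, j) = (\<Sum>\<alpha>\<in>{1..dimV t n}. if \<alpha> = Suc i then if i = j then ?m \<alpha> else 0
    else 0)"
    using ij by (simp only: M_mat_def mat_sum_def index_mat split) (intro sum.cong, auto simp: elem_mat_def)
  also have "\<dots> = (if i = j then ?m (Suc i) else 0)" using ij by simp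
  finally show ?case unfolding m using ij by (simp add: mat_diag_def)
qed (auto simp: M_mat_def mat_sum_def mat_diag_def)

abbreviation "R_coef t n \<eta> u \<equiv> r_coef (dual_index t n) (exp (u / 2)) (exp \<eta>) (exp (kappa t n * \<eta>)) (sigma
  t) (G_fun t n \<eta>)"

text \<open>The constant of M cancels from the condition on K^L. What is left in \<open>sup\<close>
  is a balance of K-eigenvalues, q^2 and G^2 between the row and column of each nonzero entry of
  X.\<close>

lemma generator_commutes:
  fixes t n p \<eta> \<gamma>0 u
  defines "d \<equiv> dimV t n" and "pr \<equiv> dual_index t n" and "k \<equiv> KR_entry t n \<eta> \<gamma>0 p" and "G \<equiv>
    G_fun t n \<eta>"
  assumes d: "d > 0"
   and X: "X \<in> carrier_mat d d" "\<And>s c. s < d \<Longrightarrow> c < d \<Longrightarrow> X $$ (s, c) = w * \<xi> (Suc s)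
     (Suc c)"
   and q: "\<And>\<alpha>. q \<alpha> * qi \<alpha> = 1" "\<And>\<alpha>. \<alpha> \<in> {1..d} \<Longrightarrow> q \<alpha> * q
     (pr \<alpha>) = 1"
   and loc: "local_int {1..d} (r_coef pr (exp (u / 2)) (exp \<eta>) (exp (kappa t n * \<eta>)) (sigma t) G) z \<xi> q qi"
   and z: "z * z' = 1"
   and sup: "\<And>i j. i \<in> {1..d} \<Longrightarrow> j \<in> {1..d} \<Longrightarrow> \<xi> i j \<noteq> 0 \<Longrightarrow>
     z' * k u i = z * k u j \<and>
      z' * k (- u - rho t n \<eta>) j * (q i)^2 * (G i)^2 = z * k (- u - rho t n \<eta>) i * (q j)^2 * (G j)^2"
  shows "commutator (coprod_E d N (mat_diag d (\<lambda>x. q (Suc x))) X) (transfer_mat t n \<eta> \<gamma>0 p N u) = 0\<^sub>m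
    (d ^ N) (d ^ N)"
proof -
  let ?Q = "mat_diag d (\<lambda>x. q (Suc x))" and ?Qi = "mat_diag d (\<lambda>x. qi (Suc x))"
  let ?R = "R_mat t n \<eta> u" and ?kl = "\<lambda>x. k (- u - rho t n \<eta>) (Suc x) * (M_const t n \<eta> / (G (Suc x))^2)"
  have q0: "q \<alpha> \<noteq> 0" for \<alpha> using q(1)[of \<alpha>] by auto
  have qi: "qi \<alpha> = 1 / q \<alpha>" for \<alpha> using q(1)[of \<alpha>] q0[of \<alpha>] by (simp add: field_simps)
  have qi2: "qi \<alpha> * qi (dual_index t n \<alpha>) = 1" if "\<alpha> \<in> {1..dimV t n}" for \<alpha>
    using q(2)[of \<alpha>] that by (simp add: qi pr_def d_def)
  have inv: "mat_inv ?Q = ?Qi" by (rule mat_inv_diag) (rule q(1))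
  have coef: "local_int {1..d} (r_entry pr (c_fun t n \<eta> u) (b_fun t n \<eta> u) (F_fun t n \<eta> u) (a_fun t n \<eta> u)) z
    \<xi> q qi"
  proof -
    have e: "r_entry pr (c_fun t n \<eta> u) (b_fun t n \<eta> u) (F_fun t n \<eta> u) (a_fun t n \<eta> u) a b c e
        = r_coef pr (exp (u / 2)) (exp \<eta>) (exp (kappa t n * \<eta>)) (sigma t) G a b c e"
      if "a \<in> {1..d}" "b \<in> {1..d}" "c \<in> {1..d}" "e \<in> {1..d}" for a b c e
      unfolding r_entry_def R_coefficients(1-3) G_def pr_def
      using that R_coefficients(4)[of a t n c \<eta> u] by (simp add: d_def)
    show ?thesis by (rule local_int_cong[OF e[symmetric] loc])
  qed
  have KL: "KL_mat t n \<eta> \<gamma>0 p u = mat_diag d ?kl"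
    unfolding KL_mat_def KR_mat_diag M_mat_diag mat_diag_diag by (simp add: d_def k_def G_def)
  have KR: "KR_mat t n \<eta> \<gamma>0 p u = mat_diag d (\<lambda>x. k u (Suc x))"
    unfolding KR_mat_diag by (simp add: d_def k_def)
  have "commutator (coprod_sum d N X ?Q ?Qi) (transfer_mat t n \<eta> \<gamma>0 p N u) = 0\<^sub>m (d ^ N) (d ^ N)"
  proof (rule coprod_commutes_double_row_trace[OF d X(1) _ z refl refl _ _ _ _ _ refl refl])
    show "q (Suc i) * qi (Suc i) = 1" for i by (rule q)
    show "exchanges d ?R z X ?Q ?Qi"
      by (rule exchanges_of_local_int[OF R_mat_entry[of _ t n, folded d_def pr_def] X(2) coef])
    show "commutes2 d ?R ?Q" unfolding d_def
      by (rule commutes2_R_mat) (use q(2) in \<open>simp add: d_def pr_def\<close>)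
    show "commutes2 d ?R ?Qi" unfolding d_def by (rule commutes2_R_mat) (rule qi2)
    show "transfer_mat t n \<eta> \<gamma>0 p N u = partial_trace d (d ^ N)
      ((mat_diag d ?kl \<otimes>\<^sub>m 1\<^sub>m (d ^ N)) *
       mat_prod (d ^ (N + 1)) (map (\<lambda>k. act_on d (N + 1) ?R 0 k) (rev [1..<N + 1])) *
       (mat_diag d (\<lambda>x. k u (Suc x)) \<otimes>\<^sub>m 1\<^sub>m (d ^ N)) *
       mat_prod (d ^ (N + 1)) (map (\<lambda>k. act_on d (N + 1) ?R k 0) [1..<N + 1]))"
      unfolding transfer_mat_def Let_def T_mat_def That_mat_def KL KR d_def ..
    fix i j assume ij: "i < d" "j < d"
    have G0: "G \<alpha> \<noteq> 0" for \<alpha> by (simp add: G_def G_fun_nonzero)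
    show "z' * k u (Suc i) * X $$ (i, j) = z * X $$ (i, j) * k u (Suc j)"
      using sup[of "Suc i" "Suc j"] ij by (cases "\<xi> (Suc i) (Suc j) = 0") (simp_all add: X)
    show "z' * q (Suc i) * X $$ (i, j) * ?kl j * qi (Suc j) * qi (Suc j) = z * ?kl i * qi (Suc i) * X $$ (i, j)"
    proof (cases "\<xi> (Suc i) (Suc j) = 0")
      case False
      let ?a = "k (- u - rho t n \<eta>) (Suc j)" and ?b = "k (- u - rho t n \<eta>) (Suc i)"
      have e: "z' * ?a * (q (Suc i))^2 * (G (Suc i))^2 = z * ?b * (q (Suc j))^2 * (G (Suc j))^2"
        using sup[of "Suc i" "Suc j"] ij False by simp
      have "z' * q (Suc i) * ?a / ((G (Suc j))^2 * (q (Suc j))^2) = z * ?b / ((G (Suc i))^2 * q (Suc i))"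
        using e G0 q0 by (simp add: field_simps power2_eq_square)
      then have "(w * \<xi> (Suc i) (Suc j) * M_const t n \<eta>) * (z' * q (Suc i) * ?a / ((G (Suc j))^2 * (q (Suc j))^2))
        = (w * \<xi> (Suc i) (Suc j) * M_const t n \<eta>) * (z * ?b / ((G (Suc i))^2 * q (Suc i)))" by (rule arg_cong)
      then show ?thesis using ij by (simp add: X qi power2_eq_square mult_ac)
    qed (use ij in \<open>simp add: X\<close>)
  qed
  then show ?thesis by (simp add: coprod_E_def coprod_sum_def inv)
qed

subsection \<open>The root vectors\<close>

lemma dimV_cases: "dimV t n = 2 * n \<or> dimV t n = 2 * n + 1"
  by (simp add: dimV_def)

lemma cartan_weight_dual:
  assumes "i \<in> {1..dimV t n}" "\<alpha> \<in> {1..dimV t n}"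
  shows "cartan_weight (dimV t n) i (dual_index t n \<alpha>) = - cartan_weight (dimV t n) i \<alpha>"
  using assms by (auto simp: cartan_weight_def dual_index_def)

abbreviation q_weight :: "nat \<Rightarrow> complex \<Rightarrow> nat \<Rightarrow> complex \<Rightarrow> nat \<Rightarrow> nat
  \<Rightarrow> complex" where
  "q_weight d A a B b \<alpha> \<equiv> exp (A * cartan_weight d a \<alpha> + B * cartan_weight d b \<alpha>)"

abbreviation q_diag :: "nat \<Rightarrow> complex \<Rightarrow> nat \<Rightarrow> complex \<Rightarrow> nat \<Rightarrow> complex
  mat" where
  "q_diag d A a B b \<equiv> mat_diag d (\<lambda>x. q_weight d A a B b (Suc x))"

lemma KR_entry_same_block:
  assumes "i \<le> p \<and> j \<le> p \<or> p < i \<and> p < j \<and> (i \<le> dimV t n - p \<longleftrightarrow> j \<le> dimV t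
    n - p)"
  shows "KR_entry t n \<eta> \<gamma>0 p u i = KR_entry t n \<eta> \<gamma>0 p u j"
  using assms by (auto simp: KR_entry_def)

text \<open>Cartan weights are odd under duality, so exponentials of them are reciprocal at dual
  indices; this is the condition under which R commutes with Q \<otimes> Q.\<close>

lemma root_commutes:
  fixes t n p \<eta> \<gamma>0 u A B and a b :: nat
  defines "d \<equiv> dimV t n" and "pr \<equiv> dual_index t n" and "k \<equiv> KR_entry t n \<eta> \<gamma>0 p" and "G \<equiv>
    G_fun t n \<eta>"
    and "q \<equiv> q_weight (dimV t n) A a B b"
  assumes ab: "a \<in> {1..d}" "b \<in> {1..d}"
   and X: "X \<in> carrier_mat d d" "\<And>s c. s < d \<Longrightarrow> c < d \<Longrightarrow> X $$ (s, c) = w * \<xi> (Suc s)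
     (Suc c)"
   and loc: "local_int {1..d} (r_coef pr (exp (u / 2)) (exp \<eta>) (exp (kappa t n * \<eta>)) (sigma t) G) z \<xi> q
     (\<lambda>\<alpha>. 1 / q \<alpha>)"
   and z: "z * z' = 1"
   and sup: "\<And>i j. i \<in> {1..d} \<Longrightarrow> j \<in> {1..d} \<Longrightarrow> \<xi> i j \<noteq> 0 \<Longrightarrow>
     z' * k u i = z * k u j \<and>
      z' * k (- u - rho t n \<eta>) j * (q i)^2 * (G i)^2 = z * k (- u - rho t n \<eta>) i * (q j)^2 * (G j)^2"
  shows "commutator (coprod_E d N (q_diag d A a B b) X) (transfer_mat t n \<eta> \<gamma>0 p N u) = 0\<^sub>m (d ^ N) (d ^ N)"
proof -
  have "q \<alpha> * q (pr \<alpha>) = 1" if "\<alpha> \<in> {1..d}" for \<alpha>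
    using that ab by (simp add: q_def pr_def d_def cartan_weight_dual flip: exp_add)
  moreover have "q \<alpha> * (1 / q \<alpha>) = 1" for \<alpha> by (simp add: q_def)
  ultimately have "commutator (coprod_E d N (mat_diag d (\<lambda>x. q (Suc x))) X) (transfer_mat t n \<eta> \<gamma>0 p N u) =
    0\<^sub>m (d ^ N) (d ^ N)"
    unfolding d_def
    using ab X loc z sup
    by (intro generator_commutes[where q = q and qi = "\<lambda>\<alpha>. 1 / q \<alpha>" and \<xi> = \<xi> and w = w and z = z
      and z' = z'])
       (auto simp: d_def pr_def k_def G_def)
  then show ?thesis by (simp add: q_def d_def)
qed

section \<open>Ratios of G and the shift by \<rho>\<close>

lemma G_fun_ratio:
  assumes "eps t n a = s * eps t n b" "bar t n a = bar t n b + r"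
  shows "G_fun t n \<eta> a = s * exp (2 * r * \<eta>) * G_fun t n \<eta> b"
  using assms by (simp add: G_fun_def distrib_left distrib_right exp_add)

lemma exp_two_mult: "exp (2 * \<eta>) = (exp \<eta>)^2" "exp (4 * \<eta>) = (exp \<eta>)^4" for \<eta> :: complex
  by (simp_all add: exp_double exp_of_nat_mult[of 4, simplified])

text \<open>Within either half of the index range \<open>bar\<close> advances by 1 and
  \<open>eps\<close> is constant; m < n keeps both steps away from the middle, where the formulas
  change.\<close>

lemma G_fun_Suc:
  assumes "1 \<le> m" "m < n"
  shows "G_fun t n \<eta> (m + 1) = (exp \<eta>)^2 * G_fun t n \<eta> m"
    "G_fun t n \<eta> (dimV t n + 1 - m) = (exp \<eta>)^2 * G_fun t n \<eta> (dimV t n - m)"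
proof -
  have "eps t n (m + 1) = 1 * eps t n m" "bar t n (m + 1) = bar t n m + 1"
    using assms by (auto simp: eps_def bar_def dimV_def)
  from G_fun_ratio[OF this, of \<eta>] show "G_fun t n \<eta> (m + 1) = (exp \<eta>)^2 * G_fun t n \<eta> m"
    by (simp add: exp_two_mult)
  define x where "x = dimV t n - m"
  have x: "dimV t n + 1 - m = Suc x" "n < x" "dimV t n + 1 < 2 * x" "\<not> Suc x \<le> n"
    using assms dimV_cases[of t n] by (auto simp: x_def)
  then have "eps t n (dimV t n + 1 - m) = 1 * eps t n (dimV t n - m)"
    "bar t n (dimV t n + 1 - m) = bar t n (dimV t n - m) + 1"
    unfolding x(1) x_def[symmetric] by (simp_all add: eps_def bar_def)
  from G_fun_ratio[OF this, of \<eta>] show "G_fun t n \<eta> (dimV t n + 1 - m) = (exp \<eta>)^2 * G_fun t n \<eta> (dimV t n -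
    m)"
    by (simp add: exp_two_mult)
qed

lemma sigma_cases: "sigma t = 1 \<or> sigma t = - 1"
  by (simp add: sigma_def)

text \<open>The extra imaginary summand of \<rho> in the twisted types is what produces the sign
  \<sigma>, so one formula holds for all types.\<close>

lemma exp_rho:
  "exp (rho t n \<eta>) = sigma t / (exp (kappa t n * \<eta>))^2"
  "exp (- rho t n \<eta>) = sigma t * (exp (kappa t n * \<eta>))^2"
proof -
  have e: "exp (2 * kappa t n * \<eta>) = (exp (kappa t n * \<eta>))^2"
    by (simp add: mult.assoc exp_double)
  have pi: "exp (\<i> * of_real pi) = - 1" by (simp add: exp_eq_polar)
  show "exp (rho t n \<eta>) = sigma t / (exp (kappa t n * \<eta>))^2"
    using e pi by (simp add: rho_def sigma_def exp_diff exp_minus inverse_eq_divide)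
  show "exp (- rho t n \<eta>) = sigma t * (exp (kappa t n * \<eta>))^2"
    using e pi by (simp add: rho_def sigma_def exp_add)
qed

lemma KR_entry_affine:
  assumes "1 \<le> p" "p \<le> n"
  shows "\<alpha> \<le> p \<Longrightarrow> KR_entry t n \<eta> \<gamma>0 p v \<alpha> = exp (- v)"
    "dimV t n - p < \<alpha> \<Longrightarrow> p < \<alpha> \<Longrightarrow> KR_entry t n \<eta> \<gamma>0 p v \<alpha> = exp v"
    "\<alpha> \<le> p \<Longrightarrow> KR_entry t n \<eta> \<gamma>0 p (- u - rho t n \<eta>) \<alpha> = exp u * (sigma t / (exp
      (kappa t n * \<eta>))^2)"
    "dimV t n - p < \<alpha> \<Longrightarrow> p < \<alpha> \<Longrightarrow> KR_entry t n \<eta> \<gamma>0 p (- u - rho t n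
      \<eta>) \<alpha>
       = exp (- u) * (sigma t * (exp (kappa t n * \<eta>))^2)"
  by (simp_all add: KR_entry_def add.commute flip: exp_rho exp_add)

text \<open>No self-dual index separates n from n + 1 here, and \<open>bar\<close> takes the same
  value at both; this reflects the fork at the end of the diagram.\<close>

lemma G_fun_D_end:
  assumes "2 \<le> n"
  shows "G_fun D1 n \<eta> (n + 1) = (exp \<eta>)^2 * G_fun D1 n \<eta> (n - 1)"
    "G_fun D1 n \<eta> n = (exp \<eta>)^2 * G_fun D1 n \<eta> (n - 1)"
    "G_fun D1 n \<eta> (n + 2) = (exp \<eta>)^2 * ((exp \<eta>)^2 * G_fun D1 n \<eta> (n - 1))"
proof -
  have b: "bar D1 n (n + 1) = bar D1 n (n - 1) + 1" "bar D1 n n = bar D1 n (n - 1) + 1" "bar D1 n (n + 2) = bar D1 n (n - 1) + 2"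
    using assms by (auto simp: bar_def dimV_def of_nat_diff)
  have e: "eps D1 n x = 1 * eps D1 n z" for x z by (simp add: eps_def)
  show "G_fun D1 n \<eta> (n + 1) = (exp \<eta>)^2 * G_fun D1 n \<eta> (n - 1)"
    "G_fun D1 n \<eta> n = (exp \<eta>)^2 * G_fun D1 n \<eta> (n - 1)"
    "G_fun D1 n \<eta> (n + 2) = (exp \<eta>)^2 * ((exp \<eta>)^2 * G_fun D1 n \<eta> (n - 1))"
    using G_fun_ratio[OF e b(1), of \<eta>] G_fun_ratio[OF e b(2), of \<eta>] G_fun_ratio[OF e b(3), of \<eta>]
    by (simp_all add: exp_two_mult flip: power_add mult.assoc)
qed

text \<open>For these types \<open>bar\<close> grows by exactly kappa from the first index to the
  last, and \<open>eps\<close> changes by the factor \<sigma>. The value of kappa enters the affine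
  relations through this count.\<close>

lemma G_fun_D_affine:
  assumes t: "t \<in> {A2_odd, B1, D1}" and n: "2 \<le> n"
  shows "G_fun t n \<eta> (dimV t n - 1) = sigma t * (exp (kappa t n * \<eta>))^2 / (exp \<eta>)^2 * G_fun t n \<eta> 1"
    "G_fun t n \<eta> 2 = (exp \<eta>)^2 * G_fun t n \<eta> 1"
    "G_fun t n \<eta> (dimV t n) = sigma t * (exp (kappa t n * \<eta>))^2 * G_fun t n \<eta> 1"
proof -
  have b: "bar t n (dimV t n - 1) = bar t n 1 + (kappa t n - 1)" "eps t n (dimV t n - 1) = sigma t * eps t n 1"
    "bar t n (dimV t n) = bar t n 1 + kappa t n" "eps t n (dimV t n) = sigma t * eps t n 1"
    using t n by (auto simp: bar_def eps_def dimV_def sigma_def of_nat_diff)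
  have "exp (2 * (kappa t n - 1) * \<eta>) = (exp (kappa t n * \<eta>))^2 / (exp \<eta>)^2"
    by (simp add: left_diff_distrib right_diff_distrib exp_diff mult.assoc exp_double)
  then show "G_fun t n \<eta> (dimV t n - 1) = sigma t * (exp (kappa t n * \<eta>))^2 / (exp \<eta>)^2 * G_fun t n \<eta> 1"
    using G_fun_ratio[OF b(2,1), of \<eta>] by simp
  show "G_fun t n \<eta> (dimV t n) = sigma t * (exp (kappa t n * \<eta>))^2 * G_fun t n \<eta> 1"
    using G_fun_ratio[OF b(4,3), of \<eta>] by (simp add: mult.assoc exp_double)
  show "G_fun t n \<eta> 2 = (exp \<eta>)^2 * G_fun t n \<eta> 1"
    using G_fun_Suc(1)[of 1 n t \<eta>] n by (simp add: numeral_2_eq_2)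
qed

lemma G_fun_C_end:
  assumes t: "t \<in> {A2_odd, C1}" and n: "1 \<le> n"
  shows "G_fun t n \<eta> (n + 1) = - ((exp \<eta>)^4 * G_fun t n \<eta> n)"
proof -
  have b: "bar t n (n + 1) = bar t n n + 2" "eps t n (n + 1) = - 1 * eps t n n"
    using t n by (auto simp: bar_def eps_def)
  show ?thesis using G_fun_ratio[OF b(2,1), of \<eta>] by (simp add: exp_two_mult)
qed

text \<open>The growth of \<open>bar\<close> over the whole range is now kappa - 2, and
  \<open>eps\<close> changes by - \<sigma>, that is, by - 1 for \<open>C1\<close> and by 1 for
  \<open>A2_even\<close>.\<close>

lemma G_fun_C_affine:
  assumes t: "t \<in> {A2_even, C1}" and n: "1 \<le> n"
  shows "G_fun t n \<eta> (dimV t n) = - (sigma t * (exp (kappa t n * \<eta>))^2 / (exp \<eta>)^4 * G_fun t n \<eta> 1)"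
proof -
  have b: "bar t n (dimV t n) = bar t n 1 + (kappa t n - 2)" "eps t n (dimV t n) = (- sigma t) * eps t n 1"
    using t n by (auto simp: bar_def eps_def dimV_def sigma_def)
  have "exp (2 * (kappa t n - 2) * \<eta>) = (exp (kappa t n * \<eta>))^2 / (exp \<eta>)^4"
    by (simp add: left_diff_distrib right_diff_distrib exp_diff mult.assoc exp_double exp_two_mult)
  then show ?thesis using G_fun_ratio[OF b(2,1), of \<eta>] by simp
qed

lemma G_fun_B_end:
  assumes t: "t \<in> {A2_even, B1}" and n: "1 \<le> n"
  shows "G_fun t n \<eta> (n + 1) = exp \<eta> * G_fun t n \<eta> n" "G_fun t n \<eta> (n + 2) = (exp \<eta>)^2 * G_fun t n
    \<eta> n"
proof -
  have b: "bar t n (n + 1) = bar t n n + 1 / 2" "bar t n (n + 2) = bar t n n + 1"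
    using t n by (auto simp: bar_def dimV_def)
  have e: "eps t n x = 1 * eps t n z" for x z using t by (auto simp: eps_def)
  show "G_fun t n \<eta> (n + 1) = exp \<eta> * G_fun t n \<eta> n" "G_fun t n \<eta> (n + 2) = (exp \<eta>)^2 * G_fun t n \<eta>
    n"
    using G_fun_ratio[OF e b(1), of \<eta>] G_fun_ratio[OF e b(2), of \<eta>] by (simp_all add: exp_two_mult)
qed

text \<open>The condition on m excludes m = p, so m and m + 1 lie in one block of K^R, and so do
  their duals. Interior nodes of both diagrams are covered: p < m on the left, m + 1 \<le> p on the
  right.\<close>

lemma root_bulk:
  fixes t n
  defines "d \<equiv> dimV t n"
  assumes m: "1 \<le> m" "m < n" "m + 1 \<le> p \<or> p < m" "p \<le> n"
   and AB: "exp A = \<tau> * exp \<eta>" "exp B = - \<tau> / exp \<eta>" "\<tau> * \<tau> = 1"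
  shows "commutator (coprod_E d N (q_diag d A m B (m + 1)) (E_gen t n m)) (transfer_mat t n \<eta> \<gamma>0 p N u)
      = 0\<^sub>m (d ^ N) (d ^ N)" (is ?P)
    and "commutator (coprod_E d N (q_diag d A m B (m + 1)) (transpose_mat (E_gen t n m)))
      (transfer_mat t n \<eta> \<gamma>0 p N u) = 0\<^sub>m (d ^ N) (d ^ N)" (is ?T)
proof -
  let ?i = "m" and ?j = "m + 1" and ?i2 = "d + 1 - m" and ?j2 = "d - m" and ?q = "q_weight d A m B (m + 1)"
  let ?xP = "\<lambda>s c. (if s = ?i \<and> c = ?j then 1 else 0) + (if s = ?j2 \<and> c = ?i2 then 1 else (0::complex))"
    and ?xT = "\<lambda>s c. (if s = ?j \<and> c = ?i then 1 else 0) + (if s = ?i2 \<and> c = ?j2 then 1 else (0::complex))"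
  have D: "d = 2 * n \<or> d = 2 * n + 1" using m by (auto simp: d_def dimV_def)
  have t1: "\<tau> = 1 \<or> \<tau> = - 1" using AB(3) by (metis square_eq_1_iff)
  have eA: "exp (- A) = \<tau> / exp \<eta>" "exp (- B) = - \<tau> * exp \<eta>"
    using t1 by (auto simp: exp_minus AB inverse_eq_divide)
  have q: "?q ?i = \<tau> * exp \<eta>" "?q ?j = - \<tau> / exp \<eta>" "?q ?i2 = \<tau> / exp \<eta>"
    "?q ?j2 = - \<tau> * exp \<eta>"
    "\<And>x. x \<notin> {?i, ?j, ?i2, ?j2} \<Longrightarrow> ?q x = 1"
    using m D by (auto simp: cartan_weight_def AB eA)
  have qi: "1 / ?q ?i = \<tau> / exp \<eta>" "1 / ?q ?j = - \<tau> * exp \<eta>" "1 / ?q ?i2 = \<tau> * exp \<eta>"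
    "1 / ?q ?j2 = - \<tau> / exp \<eta>"
    "\<And>x. x \<notin> {?i, ?j, ?i2, ?j2} \<Longrightarrow> 1 / ?q x = 1"
    unfolding q(1-4) using t1 q(5) by auto
  have I: "?i \<in> {1..d}" "?j \<in> {1..d}" "?i2 \<in> {1..d}" "?j2 \<in> {1..d}" using m D by auto
  have pr: "dual_index t n ?i = ?i2" "dual_index t n ?j = ?j2" "dual_index t n ?i2 = ?i" "dual_index t n ?j2 = ?j"
    unfolding dual_index_def d_def[symmetric] using m D by auto
  note nz = exp_not_eq_zero[of "u / 2"] exp_not_eq_zero[of \<eta>] exp_not_eq_zero[of "kappa t n * \<eta>"] G_fun_nonzero[of t n
    \<eta>]
  note dual = dual_index_involutive[of _ t n, folded d_def]
  have G: "G_fun t n \<eta> ?j = (exp \<eta>)^2 * G_fun t n \<eta> ?i" "G_fun t n \<eta> ?i2 = (exp \<eta>)^2 * G_fun t n \<eta>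
    ?j2"
    using G_fun_Suc[of m n t \<eta>] m by (simp_all add: d_def)
  have K: "KR_entry t n \<eta> \<gamma>0 p v ?i = KR_entry t n \<eta> \<gamma>0 p v ?j"
    "KR_entry t n \<eta> \<gamma>0 p v ?j2 = KR_entry t n \<eta> \<gamma>0 p v ?i2" for v
    by (rule KR_entry_same_block; use m D in \<open>auto simp: d_def[symmetric]\<close>)+
  \<comment> \<open>Between the two ends of a nonzero entry G^2 changes by Q^4 and q^2 by Q^-4. With
    equal K-eigenvalues and z = 1 this is the balance demanded by K^L.\<close>
  have GG: "(?q ?i)^2 * (G_fun t n \<eta> ?i)^2 = (?q ?j)^2 * (G_fun t n \<eta> ?j)^2"
    "(?q ?j2)^2 * (G_fun t n \<eta> ?j2)^2 = (?q ?i2)^2 * (G_fun t n \<eta> ?i2)^2"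
    unfolding q(1-4) G using t1 by (auto simp: power_mult_distrib power_divide field_simps)
  have Xc: "E_gen t n m \<in> carrier_mat d d"
    by (simp add: E_gen_def elem_mat_def d_def Let_def)
  have Xe: "E_gen t n m $$ (s, c) = 1 * ?xP (Suc s) (Suc c)" if "s < d" "c < d" for s c
    unfolding E_gen_def Let_def d_def[symmetric] using that m D by (auto simp: elem_mat_def)
  have XeT: "transpose_mat (E_gen t n m) $$ (s, c) = 1 * ?xT (Suc s) (Suc c)" if "s < d" "c < d" for s c
    using that Xc by (simp add: Xe[OF that(2,1)] conj_commute)
  have XcT: "transpose_mat (E_gen t n m) \<in> carrier_mat d d" using Xc by simp
  have ab: "m \<in> {1..d}" "(m + 1) \<in> {1..d}" using m D by auto
  have zz: "1 * 1 = (1::complex)" "1 * 1 = (1::complex)" by simp_all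
  have locP: "local_int {1..d} (R_coef t n \<eta> u) (1) ?xP ?q (\<lambda>\<alpha>. 1 / ?q \<alpha>)"
    by (rule local_int_bulk[where \<tau> = "\<tau>" and I = "{1..d}" and pr = "dual_index t n" and X = ?xP and q = ?q and qi =
      "\<lambda>\<alpha>. 1 / ?q \<alpha>" and y = "exp (u / 2)" and Q = "exp \<eta>" and K = "exp (kappa t n * \<eta>)" and
      \<sigma> = "sigma t" and G = "G_fun t n \<eta>" and i = ?i and j = ?j and ?i2.0 = ?i2 and ?j2.0 = ?j2, OF _ I pr dual _ _ _
      _ refl q qi AB(3) sigma_cases nz G])
      (use m D in auto)
  show ?P
    unfolding d_def
  proof (rule root_commutes[where z = "1" and z' = "1" and w = "1" and
        \<xi> = ?xP], unfold d_def[symmetric], goal_cases)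
    case (7 i j)
    then consider "i = ?i" "j = ?j" | "i = ?j2" "j = ?i2" by (auto split: if_splits)
    then show ?case
      by cases (simp_all only: K GG mult.assoc mult_1_left simp_thms)
  qed (rule Xe, assumption, assumption | rule ab Xc locP zz)+
  \<comment> \<open>The same Q serves the transpose. Its first index is the former j, where q is -
    \<tau> / exp \<eta>, so the transposed pattern is met with - \<tau> in place of \<tau>.\<close>
  have qT: "?q ?j = (- \<tau>) / exp \<eta>" "?q ?i = - (- \<tau>) * exp \<eta>" "?q ?j2 = (- \<tau>) * exp \<eta>"
    "?q ?i2 = - (- \<tau>) / exp \<eta>" "\<And>x. x \<notin> {?j, ?i, ?j2, ?i2} \<Longrightarrow> ?q x = 1"
    by (simp_all only: q(1-4) minus_minus) (rule q(5), blast)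
  have qiT: "1 / ?q ?j = (- \<tau>) * exp \<eta>" "1 / ?q ?i = - (- \<tau>) / exp \<eta>" "1 / ?q ?j2 = (- \<tau>) / exp \<eta>"
    "1 / ?q ?i2 = - (- \<tau>) * exp \<eta>" "\<And>x. x \<notin> {?j, ?i, ?j2, ?i2} \<Longrightarrow> 1 / ?q x = 1"
    by (simp_all only: qi(1-4) minus_minus) (rule qi(5), blast)
  have tauT: "(- \<tau>) * (- \<tau>) = 1" using t1 by auto
  have locT: "local_int {1..d} (R_coef t n \<eta> u) (1) ?xT ?q (\<lambda>\<alpha>. 1 / ?q \<alpha>)"
    by (rule local_int_bulk_transp[where \<tau> = "(- \<tau>)" and I = "{1..d}" and pr = "dual_index t n" and X = ?xT and q = ?q
      and qi = "\<lambda>\<alpha>. 1 / ?q \<alpha>" and y = "exp (u / 2)" and Q = "exp \<eta>" and K = "exp (kappa t n * \<eta>)"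
      and \<sigma> = "sigma t" and G = "G_fun t n \<eta>" and i = ?j and j = ?i and ?i2.0 = ?j2 and ?j2.0 = ?i2, OF _ I(2,1,4,3)
      pr(2,1,4,3) dual _ _ _ _ refl qT qiT tauT sigma_cases nz G])
      (use m D in auto)
  show ?T
    unfolding d_def
  proof (rule root_commutes[where z = "1" and z' = "1" and w = "1" and
        \<xi> = ?xT], unfold d_def[symmetric], goal_cases)
    case (7 i j)
    then consider "i = ?j" "j = ?i" | "i = ?i2" "j = ?j2" by (auto split: if_splits)
    then show ?case
      by cases (simp_all only: K GG mult.assoc mult_1_left simp_thms)
  qed (rule XeT, assumption, assumption | rule ab XcT locT zz)+
qed

text \<open>p + 2 \<le> n places n - 1, ..., n + 2 in the middle block. For p = n - 1 the vector
  would join an outer index to a middle one.\<close>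

lemma root_D_end:
  fixes t n
  defines "d \<equiv> dimV t n"
  assumes m: "t = D1" "p + 2 \<le> n"
   and AB: "exp A = \<tau> * exp \<eta>" "exp B = - \<tau> * exp \<eta>" "\<tau> * \<tau> = 1"
  shows "commutator (coprod_E d N (q_diag d A (n - 1) B n) (E_gen t n n)) (transfer_mat t n \<eta> \<gamma>0 p N u)
      = 0\<^sub>m (d ^ N) (d ^ N)" (is ?P)
    and "commutator (coprod_E d N (q_diag d A (n - 1) B n) (transpose_mat (E_gen t n n)))
      (transfer_mat t n \<eta> \<gamma>0 p N u) = 0\<^sub>m (d ^ N) (d ^ N)" (is ?T)
proof -
  let ?i = "n - 1" and ?j = "n + 1" and ?i2 = "n + 2" and ?j2 = "n" and ?q = "q_weight d A (n - 1) B n"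
  let ?xP = "\<lambda>s c. (if s = ?i \<and> c = ?j then 1 else 0) + (if s = ?j2 \<and> c = ?i2 then 1 else (0::complex))"
    and ?xT = "\<lambda>s c. (if s = ?j \<and> c = ?i then 1 else 0) + (if s = ?i2 \<and> c = ?j2 then 1 else (0::complex))"
  have D: "d = 2 * n" using m by (auto simp: d_def dimV_def)
  have t1: "\<tau> = 1 \<or> \<tau> = - 1" using AB(3) by (metis square_eq_1_iff)
  have eA: "exp (- A) = \<tau> / exp \<eta>" "exp (- B) = - \<tau> / exp \<eta>"
    using t1 by (auto simp: exp_minus AB inverse_eq_divide)
  have q: "?q ?i = \<tau> * exp \<eta>" "?q ?j = - \<tau> / exp \<eta>" "?q ?i2 = \<tau> / exp \<eta>"
    "?q ?j2 = - \<tau> * exp \<eta>"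
    "\<And>x. x \<notin> {?i, ?j, ?i2, ?j2} \<Longrightarrow> ?q x = 1"
    using m D by (auto simp: cartan_weight_def AB eA)
  have qi: "1 / ?q ?i = \<tau> / exp \<eta>" "1 / ?q ?j = - \<tau> * exp \<eta>" "1 / ?q ?i2 = \<tau> * exp \<eta>"
    "1 / ?q ?j2 = - \<tau> / exp \<eta>"
    "\<And>x. x \<notin> {?i, ?j, ?i2, ?j2} \<Longrightarrow> 1 / ?q x = 1"
    unfolding q(1-4) using t1 q(5) by auto
  have I: "?i \<in> {1..d}" "?j \<in> {1..d}" "?i2 \<in> {1..d}" "?j2 \<in> {1..d}" using m D by auto
  have pr: "dual_index t n ?i = ?i2" "dual_index t n ?j = ?j2" "dual_index t n ?i2 = ?i" "dual_index t n ?j2 = ?j"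
    unfolding dual_index_def d_def[symmetric] using m D by auto
  note nz = exp_not_eq_zero[of "u / 2"] exp_not_eq_zero[of \<eta>] exp_not_eq_zero[of "kappa t n * \<eta>"] G_fun_nonzero[of t n
    \<eta>]
  note dual = dual_index_involutive[of _ t n, folded d_def]
  have G: "G_fun t n \<eta> ?j = (exp \<eta>)^2 * G_fun t n \<eta> ?i" "G_fun t n \<eta> ?j2 = (exp \<eta>)^2 * G_fun t n \<eta>
    ?i" "G_fun t n \<eta> ?i2 = (exp \<eta>)^2 * ((exp \<eta>)^2 * G_fun t n \<eta> ?i)"
    using G_fun_D_end[of n \<eta>] m by (simp_all add: d_def)
  have K: "KR_entry t n \<eta> \<gamma>0 p v ?i = KR_entry t n \<eta> \<gamma>0 p v ?j"
    "KR_entry t n \<eta> \<gamma>0 p v ?j2 = KR_entry t n \<eta> \<gamma>0 p v ?i2" for v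
    by (rule KR_entry_same_block; use m(2-) D in \<open>auto simp: d_def[symmetric]\<close>)+
  have GG: "(?q ?i)^2 * (G_fun t n \<eta> ?i)^2 = (?q ?j)^2 * (G_fun t n \<eta> ?j)^2"
    "(?q ?j2)^2 * (G_fun t n \<eta> ?j2)^2 = (?q ?i2)^2 * (G_fun t n \<eta> ?i2)^2"
    unfolding q(1-4) G using t1 by (auto simp: power_mult_distrib power_divide field_simps)
  have Xc: "E_gen t n n \<in> carrier_mat d d"
    by (simp add: E_gen_def elem_mat_def d_def Let_def)
  have Xe: "E_gen t n n $$ (s, c) = 1 * ?xP (Suc s) (Suc c)" if "s < d" "c < d" for s c
    unfolding E_gen_def Let_def d_def[symmetric] using that m D by (auto simp: elem_mat_def)
  have XeT: "transpose_mat (E_gen t n n) $$ (s, c) = 1 * ?xT (Suc s) (Suc c)" if "s < d" "c < d" for s c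
    using that Xc by (simp add: Xe[OF that(2,1)] conj_commute)
  have XcT: "transpose_mat (E_gen t n n) \<in> carrier_mat d d" using Xc by simp
  have ab: "(n - 1) \<in> {1..d}" "n \<in> {1..d}" using m(2-) D by auto
  have zz: "1 * 1 = (1::complex)" "1 * 1 = (1::complex)" by simp_all
  have locP: "local_int {1..d} (R_coef t n \<eta> u) (1) ?xP ?q (\<lambda>\<alpha>. 1 / ?q \<alpha>)"
    by (rule local_int_D_end[where \<tau> = "\<tau>" and I = "{1..d}" and pr = "dual_index t n" and X = ?xP and q = ?q and qi =
      "\<lambda>\<alpha>. 1 / ?q \<alpha>" and y = "exp (u / 2)" and Q = "exp \<eta>" and K = "exp (kappa t n * \<eta>)" and
      \<sigma> = "sigma t" and G = "G_fun t n \<eta>" and i = ?i and j = ?j and ?i2.0 = ?i2 and ?j2.0 = ?j2, OF _ I pr dual _ _ _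
      _ refl q qi AB(3) sigma_cases nz G])
      (use m D in auto)
  show ?P
    unfolding d_def
  proof (rule root_commutes[where z = "1" and z' = "1" and w = "1" and
        \<xi> = ?xP], unfold d_def[symmetric], goal_cases)
    case (7 i j)
    then consider "i = ?i" "j = ?j" | "i = ?j2" "j = ?i2" by (auto split: if_splits)
    then show ?case
      by cases (simp_all only: K GG mult.assoc mult_1_left simp_thms)
  qed (rule Xe, assumption, assumption | rule ab Xc locP zz)+
  have qT: "?q ?j = (- \<tau>) / exp \<eta>" "?q ?i = - (- \<tau>) * exp \<eta>" "?q ?j2 = (- \<tau>) * exp \<eta>"
    "?q ?i2 = - (- \<tau>) / exp \<eta>" "\<And>x. x \<notin> {?j, ?i, ?j2, ?i2} \<Longrightarrow> ?q x = 1"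
    by (simp_all only: q(1-4) minus_minus) (rule q(5), blast)
  have qiT: "1 / ?q ?j = (- \<tau>) * exp \<eta>" "1 / ?q ?i = - (- \<tau>) / exp \<eta>" "1 / ?q ?j2 = (- \<tau>) / exp \<eta>"
    "1 / ?q ?i2 = - (- \<tau>) * exp \<eta>" "\<And>x. x \<notin> {?j, ?i, ?j2, ?i2} \<Longrightarrow> 1 / ?q x = 1"
    by (simp_all only: qi(1-4) minus_minus) (rule qi(5), blast)
  have tauT: "(- \<tau>) * (- \<tau>) = 1" using t1 by auto
  have locT: "local_int {1..d} (R_coef t n \<eta> u) (1) ?xT ?q (\<lambda>\<alpha>. 1 / ?q \<alpha>)"
    by (rule local_int_D_end_transp[where \<tau> = "(- \<tau>)" and I = "{1..d}" and pr = "dual_index t n" and X = ?xT and q = ?q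
      and qi = "\<lambda>\<alpha>. 1 / ?q \<alpha>" and y = "exp (u / 2)" and Q = "exp \<eta>" and K = "exp (kappa t n * \<eta>)"
      and \<sigma> = "sigma t" and G = "G_fun t n \<eta>" and i = ?j and j = ?i and ?i2.0 = ?j2 and ?j2.0 = ?i2, OF _ I(2,1,4,3)
      pr(2,1,4,3) dual _ _ _ _ refl qT qiT tauT sigma_cases nz G])
      (use m D in auto)
  show ?T
    unfolding d_def
  proof (rule root_commutes[where z = "1" and z' = "1" and w = "1" and
        \<xi> = ?xT], unfold d_def[symmetric], goal_cases)
    case (7 i j)
    then consider "i = ?j" "j = ?i" | "i = ?i2" "j = ?j2" by (auto split: if_splits)
    then show ?case
      by cases (simp_all only: K GG mult.assoc mult_1_left simp_thms)
  qed (rule XeT, assumption, assumption | rule ab XcT locT zz)+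
qed

text \<open>With p at least 2 the indices 1, 2 lie in the first block and d - 1, d in the last, so
  both summands of the vector join the two outer blocks. For p = 1 the index 2 would fall outside
  the first block.\<close>

lemma root_D_affine:
  fixes t n
  defines "d \<equiv> dimV t n"
  assumes m: "t \<in> {A2_odd, B1, D1}" "2 \<le> p" "p \<le> n"
   and AB: "exp A = \<tau> / exp \<eta>" "exp B = - \<tau> / exp \<eta>" "\<tau> * \<tau> = 1"
  shows "commutator (coprod_E d N (q_diag d A 2 B 1) (E_gen t n 0)) (transfer_mat t n \<eta> \<gamma>0 p N u)
      = 0\<^sub>m (d ^ N) (d ^ N)" (is ?P)
    and "commutator (coprod_E d N (q_diag d A 2 B 1) (transpose_mat (E_gen t n 0)))
      (transfer_mat t n \<eta> \<gamma>0 p N u) = 0\<^sub>m (d ^ N) (d ^ N)" (is ?T)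
proof -
  let ?i = "d - 1" and ?j = "1" and ?i2 = "2" and ?j2 = "d" and ?q = "q_weight d A 2 B 1"
  let ?xP = "\<lambda>s c. (if s = ?i \<and> c = ?j then 1 else 0) + (if s = ?j2 \<and> c = ?i2 then 1 else (0::complex))"
    and ?xT = "\<lambda>s c. (if s = ?j \<and> c = ?i then 1 else 0) + (if s = ?i2 \<and> c = ?j2 then 1 else (0::complex))"
  have D: "d = 2 * n \<or> d = 2 * n + 1" using m by (auto simp: d_def dimV_def)
  have t1: "\<tau> = 1 \<or> \<tau> = - 1" using AB(3) by (metis square_eq_1_iff)
  have eA: "exp (- A) = \<tau> * exp \<eta>" "exp (- B) = - \<tau> * exp \<eta>"
    using t1 by (auto simp: exp_minus AB)
  have q: "?q ?i = \<tau> * exp \<eta>" "?q ?j = - \<tau> / exp \<eta>" "?q ?i2 = \<tau> / exp \<eta>"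
    "?q ?j2 = - \<tau> * exp \<eta>"
    "\<And>x. x \<notin> {?i, ?j, ?i2, ?j2} \<Longrightarrow> ?q x = 1"
    using m D by (auto simp: cartan_weight_def AB eA)
  have qi: "1 / ?q ?i = \<tau> / exp \<eta>" "1 / ?q ?j = - \<tau> * exp \<eta>" "1 / ?q ?i2 = \<tau> * exp \<eta>"
    "1 / ?q ?j2 = - \<tau> / exp \<eta>"
    "\<And>x. x \<notin> {?i, ?j, ?i2, ?j2} \<Longrightarrow> 1 / ?q x = 1"
    unfolding q(1-4) using t1 q(5) by auto
  have I: "?i \<in> {1..d}" "?j \<in> {1..d}" "?i2 \<in> {1..d}" "?j2 \<in> {1..d}" using m D by auto
  have pr: "dual_index t n ?i = ?i2" "dual_index t n ?j = ?j2" "dual_index t n ?i2 = ?i" "dual_index t n ?j2 = ?j"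
    unfolding dual_index_def d_def[symmetric] using m D by auto
  note nz = exp_not_eq_zero[of "u / 2"] exp_not_eq_zero[of \<eta>] exp_not_eq_zero[of "kappa t n * \<eta>"] G_fun_nonzero[of t n
    \<eta>]
  note dual = dual_index_involutive[of _ t n, folded d_def]
  have G: "G_fun t n \<eta> ?i = sigma t * (exp (kappa t n * \<eta>))^2 / (exp \<eta>)^2 * G_fun t n \<eta> ?j"
    "G_fun t n \<eta> ?i2 = (exp \<eta>)^2 * G_fun t n \<eta> ?j" "G_fun t n \<eta> ?j2 = sigma t * (exp (kappa t n * \<eta>))^2
    * G_fun t n \<eta> ?j"
    using G_fun_D_affine[of t n \<eta>] m by (simp_all add: d_def)
  have z: "exp u = (exp (u / 2))^2" "exp (- u) = 1 / (exp (u / 2))^2" "exp u * exp (- u) = 1" "exp (- u) * exp u = 1"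
    by (simp_all add: exp_minus inverse_eq_divide flip: exp_double)
  have p: "1 \<le> p" "p \<le> n" using m by auto
  have lo: "?j \<le> p" "?i2 \<le> p" using m(2-) D by auto
  have hi: "dimV t n - p < ?i" "p < ?i" "dimV t n - p < ?j2" "p < ?j2"
    unfolding d_def[symmetric] using m(2-) D by auto
  note K = KR_entry_affine(1)[OF p lo(1), where v = u] KR_entry_affine(3)[OF p lo(1)] KR_entry_affine(1)[OF p lo(2), where v = u]
    KR_entry_affine(3)[OF p lo(2)]
    KR_entry_affine(2)[OF p hi(1,2), where v = u] KR_entry_affine(4)[OF p hi(1,2)] KR_entry_affine(2)[OF p hi(3,4), where v = u]
      KR_entry_affine(4)[OF p hi(3,4)]
  have Xc: "E_gen t n 0 \<in> carrier_mat d d"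
    by (simp add: E_gen_def elem_mat_def d_def Let_def)
  have Xe: "E_gen t n 0 $$ (s, c) = 1 * ?xP (Suc s) (Suc c)" if "s < d" "c < d" for s c
    unfolding E_gen_def Let_def d_def[symmetric] using that m D by (auto simp: elem_mat_def)
  have XeT: "transpose_mat (E_gen t n 0) $$ (s, c) = 1 * ?xT (Suc s) (Suc c)" if "s < d" "c < d" for s c
    using that Xc by (simp add: Xe[OF that(2,1)] conj_commute)
  have XcT: "transpose_mat (E_gen t n 0) \<in> carrier_mat d d" using Xc by simp
  have ab: "2 \<in> {1..d}" "1 \<in> {1..d}" using m(2-) D by auto
  have zz: "exp u * exp (- u) = (1::complex)" "exp (- u) * exp u = (1::complex)" by (rule z)+
  have locP: "local_int {1..d} (R_coef t n \<eta> u) (exp u) ?xP ?q (\<lambda>\<alpha>. 1 / ?q \<alpha>)"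
    unfolding z(1,2) by (rule local_int_D_affine[where \<tau> = "\<tau>" and I = "{1..d}" and pr = "dual_index t n" and X = ?xP
      and q = ?q and qi = "\<lambda>\<alpha>. 1 / ?q \<alpha>" and y = "exp (u / 2)" and Q = "exp \<eta>" and K = "exp (kappa t n
      * \<eta>)" and \<sigma> = "sigma t" and G = "G_fun t n \<eta>" and i = ?i and j = ?j and ?i2.0 = ?i2 and ?j2.0 = ?j2, OF _
      I pr dual _ _ _ _ refl q qi AB(3) sigma_cases nz G])
      (use m D in auto)
  show ?P
    unfolding d_def
  proof (rule root_commutes[where z = "exp u" and z' = "exp (- u)" and w = "1" and
        \<xi> = ?xP], unfold d_def[symmetric], goal_cases)
    case (7 i j)
    then consider "i = ?i" "j = ?j" | "i = ?j2" "j = ?i2" by (auto split: if_splits)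
    \<comment> \<open>From column to row G^2 changes by K^4 / Q^4 and q^2 by Q^4, while the shift by
      \<rho> makes the K-eigenvalue at the column exp (2 * u) / K^4 times the one at the row. The
      powers of K and Q cancel, and exp (2 * u) is the quotient of z and z'.\<close>
    then show ?case
      by cases (simp_all only: K q G, insert sigma_cases[of t] t1 nz, auto simp: z(3,4) field_simps power_mult_distrib
        power_divide)
  qed (rule Xe, assumption, assumption | rule ab Xc locP zz)+
  have qT: "?q ?j = (- \<tau>) / exp \<eta>" "?q ?i = - (- \<tau>) * exp \<eta>" "?q ?j2 = (- \<tau>) * exp \<eta>"
    "?q ?i2 = - (- \<tau>) / exp \<eta>" "\<And>x. x \<notin> {?j, ?i, ?j2, ?i2} \<Longrightarrow> ?q x = 1"
    by (simp_all only: q(1-4) minus_minus) (rule q(5), blast)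
  have qiT: "1 / ?q ?j = (- \<tau>) * exp \<eta>" "1 / ?q ?i = - (- \<tau>) / exp \<eta>" "1 / ?q ?j2 = (- \<tau>) / exp \<eta>"
    "1 / ?q ?i2 = - (- \<tau>) * exp \<eta>" "\<And>x. x \<notin> {?j, ?i, ?j2, ?i2} \<Longrightarrow> 1 / ?q x = 1"
    by (simp_all only: qi(1-4) minus_minus) (rule qi(5), blast)
  have tauT: "(- \<tau>) * (- \<tau>) = 1" using t1 by auto
  have locT: "local_int {1..d} (R_coef t n \<eta> u) (exp (- u)) ?xT ?q (\<lambda>\<alpha>. 1 / ?q \<alpha>)"
    unfolding z(1,2) by (rule local_int_D_affine_transp[where \<tau> = "(- \<tau>)" and I = "{1..d}" and pr = "dual_index t n"
      and X = ?xT and q = ?q and qi = "\<lambda>\<alpha>. 1 / ?q \<alpha>" and y = "exp (u / 2)" and Q = "exp \<eta>" and K =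
      "exp (kappa t n * \<eta>)" and \<sigma> = "sigma t" and G = "G_fun t n \<eta>" and i = ?j and j = ?i and ?i2.0 = ?j2 and
      ?j2.0 = ?i2, OF _ I(2,1,4,3) pr(2,1,4,3) dual _ _ _ _ refl qT qiT tauT sigma_cases nz G])
      (use m D in auto)
  show ?T
    unfolding d_def
  proof (rule root_commutes[where z = "exp (- u)" and z' = "exp u" and w = "1" and
        \<xi> = ?xT], unfold d_def[symmetric], goal_cases)
    case (7 i j)
    then consider "i = ?j" "j = ?i" | "i = ?i2" "j = ?j2" by (auto split: if_splits)
    then show ?case
      by cases (simp_all only: K q G, insert sigma_cases[of t] t1 nz, auto simp: z(3,4) field_simps power_mult_distrib
        power_divide)
  qed (rule XeT, assumption, assumption | rule ab XcT locT zz)+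
qed

text \<open>Both ends lie in the middle block because p < n. The sign in the G-ratio disappears on
  squaring, so K^L sees only a factor Q^8 in G^2 against Q^-8 in q^2.\<close>

lemma root_C_end:
  fixes t n
  defines "d \<equiv> dimV t n"
  assumes m: "t \<in> {A2_odd, C1}" "p < n"
   and AB: "exp A = (exp \<eta>)^2"
  shows "commutator (coprod_E d N (q_diag d A n 0 n) (E_gen t n n)) (transfer_mat t n \<eta> \<gamma>0 p N u)
      = 0\<^sub>m (d ^ N) (d ^ N)" (is ?P)
    and "commutator (coprod_E d N (q_diag d A n 0 n) (transpose_mat (E_gen t n n)))
      (transfer_mat t n \<eta> \<gamma>0 p N u) = 0\<^sub>m (d ^ N) (d ^ N)" (is ?T)
proof -
  let ?i = "n" and ?i2 = "n + 1" and ?q = "q_weight d A n 0 n"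
  let ?xP = "\<lambda>s c. (if s = ?i \<and> c = ?i2 then 1 else (0::complex))"
    and ?xT = "\<lambda>s c. (if s = ?i2 \<and> c = ?i then 1 else (0::complex))"
  have D: "d = 2 * n" using m by (auto simp: d_def dimV_def)
  have eA: "exp (- A) = 1 / (exp \<eta>)^2" by (simp add: exp_minus AB inverse_eq_divide)
  have q: "?q ?i = (exp \<eta>)^2" "?q ?i2 = 1 / (exp \<eta>)^2"
    "\<And>x. x \<notin> {?i, ?i2} \<Longrightarrow> ?q x = 1"
    using m D by (auto simp: cartan_weight_def AB eA)
  have qi: "1 / ?q ?i = 1 / (exp \<eta>)^2" "1 / ?q ?i2 = (exp \<eta>)^2"
    "\<And>x. x \<notin> {?i, ?i2} \<Longrightarrow> 1 / ?q x = 1"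
    unfolding q(1-2) using q(3) by auto
  have I: "?i \<in> {1..d}" "?i2 \<in> {1..d}" using m D by auto
  have pr: "dual_index t n ?i = ?i2" "dual_index t n ?i2 = ?i"
    unfolding dual_index_def d_def[symmetric] using m D by auto
  note nz = exp_not_eq_zero[of "u / 2"] exp_not_eq_zero[of \<eta>] exp_not_eq_zero[of "kappa t n * \<eta>"] G_fun_nonzero[of t n
    \<eta>]
  note dual = dual_index_involutive[of _ t n, folded d_def]
  have G: "G_fun t n \<eta> ?i2 = - ((exp \<eta>)^4 * G_fun t n \<eta> ?i)"
    using G_fun_C_end[of t n \<eta>] m by (simp_all add: d_def)
  have K: "KR_entry t n \<eta> \<gamma>0 p v ?i = KR_entry t n \<eta> \<gamma>0 p v ?i2" for v
    by (rule KR_entry_same_block; use m(2-) D in \<open>auto simp: d_def[symmetric]\<close>)+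
  have GG: "(?q ?i)^2 * (G_fun t n \<eta> ?i)^2 = (?q ?i2)^2 * (G_fun t n \<eta> ?i2)^2"
    unfolding q(1-2) G by (auto simp: power_mult_distrib power_divide field_simps)
  have Xc: "E_gen t n n \<in> carrier_mat d d"
    by (simp add: E_gen_def elem_mat_def d_def Let_def)
  have Xe: "E_gen t n n $$ (s, c) = of_real (sqrt 2) * ?xP (Suc s) (Suc c)" if "s < d" "c < d" for s c
    unfolding E_gen_def Let_def d_def[symmetric] using that m D by (auto simp: elem_mat_def)
  have XeT: "transpose_mat (E_gen t n n) $$ (s, c) = of_real (sqrt 2) * ?xT (Suc s) (Suc c)" if "s < d" "c < d" for s c
    using that Xc by (simp add: Xe[OF that(2,1)] conj_commute)
  have XcT: "transpose_mat (E_gen t n n) \<in> carrier_mat d d" using Xc by simp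
  have ab: "n \<in> {1..d}" "n \<in> {1..d}" using m(2-) D by auto
  have zz: "1 * 1 = (1::complex)" "1 * 1 = (1::complex)" by simp_all
  have locP: "local_int {1..d} (R_coef t n \<eta> u) (1) ?xP ?q (\<lambda>\<alpha>. 1 / ?q \<alpha>)"
    by (rule local_int_C_end[where I = "{1..d}" and pr = "dual_index t n" and X = ?xP and q = ?q and qi = "\<lambda>\<alpha>. 1 /
      ?q \<alpha>" and y = "exp (u / 2)" and Q = "exp \<eta>" and K = "exp (kappa t n * \<eta>)" and \<sigma> = "sigma t" and G =
      "G_fun t n \<eta>" and i = ?i and ?i2.0 = ?i2, OF _ I pr dual _ _ refl q qi sigma_cases nz G])
      (use m D in auto)
  show ?P
    unfolding d_def
  proof (rule root_commutes[where z = "1" and z' = "1" and w = "of_real (sqrt 2)" and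
        \<xi> = ?xP], unfold d_def[symmetric], goal_cases)
    case (7 i j)
    then have ij: "i = ?i" "j = ?i2" by (auto split: if_splits)
    show ?case
      unfolding ij by (simp_all only: K GG mult.assoc mult_1_left simp_thms)
  qed (rule Xe, assumption, assumption | rule ab Xc locP zz)+
  have qT: "?q ?i2 = 1 / (exp \<eta>)^2" "?q ?i = (exp \<eta>)^2" "\<And>x. x \<notin> {?i2, ?i} \<Longrightarrow> ?q x = 1"
    by (simp_all only: q(1-2) minus_minus) (rule q(3), blast)
  have qiT: "1 / ?q ?i2 = (exp \<eta>)^2" "1 / ?q ?i = 1 / (exp \<eta>)^2"
    "\<And>x. x \<notin> {?i2, ?i} \<Longrightarrow> 1 / ?q x = 1"
    by (simp_all only: qi(1-2) minus_minus) (rule qi(3), blast)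
  have locT: "local_int {1..d} (R_coef t n \<eta> u) (1) ?xT ?q (\<lambda>\<alpha>. 1 / ?q \<alpha>)"
    by (rule local_int_C_end_transp[where I = "{1..d}" and pr = "dual_index t n" and X = ?xT and q = ?q and qi =
      "\<lambda>\<alpha>. 1 / ?q \<alpha>" and y = "exp (u / 2)" and Q = "exp \<eta>" and K = "exp (kappa t n * \<eta>)" and
      \<sigma> = "sigma t" and G = "G_fun t n \<eta>" and i = ?i2 and ?i2.0 = ?i, OF _ I(2,1) pr(2,1) dual _ _ refl qT qiT
      sigma_cases nz G])
      (use m D in auto)
  show ?T
    unfolding d_def
  proof (rule root_commutes[where z = "1" and z' = "1" and w = "of_real (sqrt 2)" and
        \<xi> = ?xT], unfold d_def[symmetric], goal_cases)
    case (7 i j)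
    then have ij: "i = ?i2" "j = ?i" by (auto split: if_splits)
    show ?case
      unfolding ij by (simp_all only: K GG mult.assoc mult_1_left simp_thms)
  qed (rule XeT, assumption, assumption | rule ab XcT locT zz)+
qed

text \<open>A single entry joins the last index to the first, so p \<ge> 1 already places its ends
  in the two outer blocks.\<close>

lemma root_C_affine:
  fixes t n
  defines "d \<equiv> dimV t n"
  assumes m: "t \<in> {A2_even, C1}" "1 \<le> p" "p \<le> n"
   and AB: "exp A = 1 / (exp \<eta>)^2"
  shows "commutator (coprod_E d N (q_diag d A 1 0 1) (E_gen t n 0)) (transfer_mat t n \<eta> \<gamma>0 p N u)
      = 0\<^sub>m (d ^ N) (d ^ N)" (is ?P)
    and "commutator (coprod_E d N (q_diag d A 1 0 1) (transpose_mat (E_gen t n 0)))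
      (transfer_mat t n \<eta> \<gamma>0 p N u) = 0\<^sub>m (d ^ N) (d ^ N)" (is ?T)
proof -
  let ?i = "d" and ?i2 = "1" and ?q = "q_weight d A 1 0 1"
  let ?xP = "\<lambda>s c. (if s = ?i \<and> c = ?i2 then 1 else (0::complex))"
    and ?xT = "\<lambda>s c. (if s = ?i2 \<and> c = ?i then 1 else (0::complex))"
  have D: "d = 2 * n \<or> d = 2 * n + 1" using m by (auto simp: d_def dimV_def)
  have eA: "exp (- A) = (exp \<eta>)^2" by (simp add: exp_minus AB)
  have q: "?q ?i = (exp \<eta>)^2" "?q ?i2 = 1 / (exp \<eta>)^2"
    "\<And>x. x \<notin> {?i, ?i2} \<Longrightarrow> ?q x = 1"
    using m D by (auto simp: cartan_weight_def AB eA)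
  have qi: "1 / ?q ?i = 1 / (exp \<eta>)^2" "1 / ?q ?i2 = (exp \<eta>)^2"
    "\<And>x. x \<notin> {?i, ?i2} \<Longrightarrow> 1 / ?q x = 1"
    unfolding q(1-2) using q(3) by auto
  have I: "?i \<in> {1..d}" "?i2 \<in> {1..d}" using m D by auto
  have pr: "dual_index t n ?i = ?i2" "dual_index t n ?i2 = ?i"
    unfolding dual_index_def d_def[symmetric] using m D by auto
  note nz = exp_not_eq_zero[of "u / 2"] exp_not_eq_zero[of \<eta>] exp_not_eq_zero[of "kappa t n * \<eta>"] G_fun_nonzero[of t n
    \<eta>]
  note dual = dual_index_involutive[of _ t n, folded d_def]
  have G: "G_fun t n \<eta> ?i = - (sigma t * (exp (kappa t n * \<eta>))^2 / (exp \<eta>)^4 * G_fun t n \<eta> ?i2)"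
    using G_fun_C_affine[of t n \<eta>] m by (simp_all add: d_def)
  have z: "exp u = (exp (u / 2))^2" "exp (- u) = 1 / (exp (u / 2))^2" "exp u * exp (- u) = 1" "exp (- u) * exp u = 1"
    by (simp_all add: exp_minus inverse_eq_divide flip: exp_double)
  have p: "1 \<le> p" "p \<le> n" using m by auto
  have lo: "?i2 \<le> p" using m(2-) D by auto
  have hi: "dimV t n - p < ?i" "p < ?i"
    unfolding d_def[symmetric] using m(2-) D by auto
  note K = KR_entry_affine(1)[OF p lo(1), where v = u] KR_entry_affine(3)[OF p lo(1)]
    KR_entry_affine(2)[OF p hi(1,2), where v = u] KR_entry_affine(4)[OF p hi(1,2)]
  have Xc: "E_gen t n 0 \<in> carrier_mat d d"
    by (simp add: E_gen_def elem_mat_def d_def Let_def)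
  have Xe: "E_gen t n 0 $$ (s, c) = of_real (sqrt 2) * ?xP (Suc s) (Suc c)" if "s < d" "c < d" for s c
    unfolding E_gen_def Let_def d_def[symmetric] using that m D by (auto simp: elem_mat_def)
  have XeT: "transpose_mat (E_gen t n 0) $$ (s, c) = of_real (sqrt 2) * ?xT (Suc s) (Suc c)" if "s < d" "c < d" for s c
    using that Xc by (simp add: Xe[OF that(2,1)] conj_commute)
  have XcT: "transpose_mat (E_gen t n 0) \<in> carrier_mat d d" using Xc by simp
  have ab: "1 \<in> {1..d}" "1 \<in> {1..d}" using m(2-) D by auto
  have zz: "exp u * exp (- u) = (1::complex)" "exp (- u) * exp u = (1::complex)" by (rule z)+
  have locP: "local_int {1..d} (R_coef t n \<eta> u) (exp u) ?xP ?q (\<lambda>\<alpha>. 1 / ?q \<alpha>)"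
    unfolding z(1,2) by (rule local_int_C_affine[where I = "{1..d}" and pr = "dual_index t n" and X = ?xP and q = ?q and qi =
      "\<lambda>\<alpha>. 1 / ?q \<alpha>" and y = "exp (u / 2)" and Q = "exp \<eta>" and K = "exp (kappa t n * \<eta>)" and
      \<sigma> = "sigma t" and G = "G_fun t n \<eta>" and i = ?i and ?i2.0 = ?i2, OF _ I pr dual _ _ refl q qi sigma_cases nz G])
      (use m D in auto)
  show ?P
    unfolding d_def
  proof (rule root_commutes[where z = "exp u" and z' = "exp (- u)" and w = "of_real (sqrt 2)" and
        \<xi> = ?xP], unfold d_def[symmetric], goal_cases)
    case (7 i j)
    then have ij: "i = ?i" "j = ?i2" by (auto split: if_splits)
    show ?case
      unfolding ij by (simp_all only: K q G, insert sigma_cases[of t] nz, auto simp: z(3,4) field_simps power_mult_distrib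
        power_divide)
  qed (rule Xe, assumption, assumption | rule ab Xc locP zz)+
  have qT: "?q ?i2 = 1 / (exp \<eta>)^2" "?q ?i = (exp \<eta>)^2" "\<And>x. x \<notin> {?i2, ?i} \<Longrightarrow> ?q x = 1"
    by (simp_all only: q(1-2) minus_minus) (rule q(3), blast)
  have qiT: "1 / ?q ?i2 = (exp \<eta>)^2" "1 / ?q ?i = 1 / (exp \<eta>)^2"
    "\<And>x. x \<notin> {?i2, ?i} \<Longrightarrow> 1 / ?q x = 1"
    by (simp_all only: qi(1-2) minus_minus) (rule qi(3), blast)
  have locT: "local_int {1..d} (R_coef t n \<eta> u) (exp (- u)) ?xT ?q (\<lambda>\<alpha>. 1 / ?q \<alpha>)"
    unfolding z(1,2) by (rule local_int_C_affine_transp[where I = "{1..d}" and pr = "dual_index t n" and X = ?xT and q = ?q and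
      qi = "\<lambda>\<alpha>. 1 / ?q \<alpha>" and y = "exp (u / 2)" and Q = "exp \<eta>" and K = "exp (kappa t n * \<eta>)" and
      \<sigma> = "sigma t" and G = "G_fun t n \<eta>" and i = ?i2 and ?i2.0 = ?i, OF _ I(2,1) pr(2,1) dual _ _ refl qT qiT
      sigma_cases nz G])
      (use m D in auto)
  show ?T
    unfolding d_def
  proof (rule root_commutes[where z = "exp (- u)" and z' = "exp u" and w = "of_real (sqrt 2)" and
        \<xi> = ?xT], unfold d_def[symmetric], goal_cases)
    case (7 i j)
    then have ij: "i = ?i2" "j = ?i" by (auto split: if_splits)
    show ?case
      unfolding ij by (simp_all only: K q G, insert sigma_cases[of t] nz, auto simp: z(3,4) field_simps power_mult_distrib
        power_divide)
  qed (rule XeT, assumption, assumption | rule ab XcT locT zz)+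
qed

text \<open>As q is 1 at the self-dual index, the sign of q at the ends is not free as it was for
  interior roots: it must be - 1, which is the origin of the imaginary shift in the exponent of
  Q.\<close>

lemma root_B_end:
  fixes t n
  defines "d \<equiv> dimV t n"
  assumes m: "t \<in> {A2_even, B1}" "p < n"
   and AB: "exp A = - exp \<eta>"
  shows "commutator (coprod_E d N (q_diag d A n 0 n) (E_gen t n n)) (transfer_mat t n \<eta> \<gamma>0 p N u)
      = 0\<^sub>m (d ^ N) (d ^ N)" (is ?P)
    and "commutator (coprod_E d N (q_diag d A n 0 n) (transpose_mat (E_gen t n n)))
      (transfer_mat t n \<eta> \<gamma>0 p N u) = 0\<^sub>m (d ^ N) (d ^ N)" (is ?T)
proof -
  let ?i = "n" and ?m = "n + 1" and ?i2 = "n + 2" and ?q = "q_weight d A n 0 n"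
  let ?xP = "\<lambda>s c. (if s = ?i \<and> c = ?m then 1 else 0) + (if s = ?m \<and> c = ?i2 then 1 else (0::complex))"
    and ?xT = "\<lambda>s c. (if s = ?i2 \<and> c = ?m then 1 else 0) + (if s = ?m \<and> c = ?i then 1 else (0::complex))"
  have D: "d = 2 * n + 1" using m by (auto simp: d_def dimV_def)
  have eA: "exp (- A) = - 1 / exp \<eta>" by (simp add: exp_minus AB inverse_eq_divide)
  have q: "?q ?i = - exp \<eta>" "?q ?m = 1" "?q ?i2 = - 1 / exp \<eta>"
    "\<And>x. x \<notin> {?i, ?m, ?i2} \<Longrightarrow> ?q x = 1"
    using m D by (auto simp: cartan_weight_def AB eA)
  have qi: "1 / ?q ?i = - 1 / exp \<eta>" "1 / ?q ?m = 1" "1 / ?q ?i2 = - exp \<eta>"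
    "\<And>x. x \<notin> {?i, ?m, ?i2} \<Longrightarrow> 1 / ?q x = 1"
    unfolding q(1-3) using q(4) by auto
  have I: "?i \<in> {1..d}" "?m \<in> {1..d}" "?i2 \<in> {1..d}" using m D by auto
  have pr: "dual_index t n ?i = ?i2" "dual_index t n ?m = ?m" "dual_index t n ?i2 = ?i"
    unfolding dual_index_def d_def[symmetric] using m D by auto
  note nz = exp_not_eq_zero[of "u / 2"] exp_not_eq_zero[of \<eta>] exp_not_eq_zero[of "kappa t n * \<eta>"] G_fun_nonzero[of t n
    \<eta>]
  note dual = dual_index_involutive[of _ t n, folded d_def]
  have G: "G_fun t n \<eta> ?m = exp \<eta> * G_fun t n \<eta> ?i" "G_fun t n \<eta> ?i2 = (exp \<eta>)^2 * G_fun t n \<eta> ?i"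
    using G_fun_B_end[of t n \<eta>] m by (simp_all add: d_def)
  have K: "KR_entry t n \<eta> \<gamma>0 p v ?i = KR_entry t n \<eta> \<gamma>0 p v ?m"
    "KR_entry t n \<eta> \<gamma>0 p v ?m = KR_entry t n \<eta> \<gamma>0 p v ?i2" for v
    by (rule KR_entry_same_block; use m(2-) D in \<open>auto simp: d_def[symmetric]\<close>)+
  have GG: "(?q ?i)^2 * (G_fun t n \<eta> ?i)^2 = (?q ?m)^2 * (G_fun t n \<eta> ?m)^2"
    "(?q ?m)^2 * (G_fun t n \<eta> ?m)^2 = (?q ?i2)^2 * (G_fun t n \<eta> ?i2)^2"
    unfolding q(1-3) G by (auto simp: power_mult_distrib power_divide field_simps)
  have Xc: "E_gen t n n \<in> carrier_mat d d"
    by (simp add: E_gen_def elem_mat_def d_def Let_def)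
  have Xe: "E_gen t n n $$ (s, c) = 1 * ?xP (Suc s) (Suc c)" if "s < d" "c < d" for s c
    unfolding E_gen_def Let_def d_def[symmetric] using that m D by (auto simp: elem_mat_def)
  have XeT: "transpose_mat (E_gen t n n) $$ (s, c) = 1 * ?xT (Suc s) (Suc c)" if "s < d" "c < d" for s c
    using that Xc by (simp add: Xe[OF that(2,1)] conj_commute)
  have XcT: "transpose_mat (E_gen t n n) \<in> carrier_mat d d" using Xc by simp
  have ab: "n \<in> {1..d}" "n \<in> {1..d}" using m(2-) D by auto
  have zz: "1 * 1 = (1::complex)" "1 * 1 = (1::complex)" by simp_all
  have qP: "?q ?i = - exp \<eta>" "?q ?i2 = - 1 / exp \<eta>" "?q ?m = 1"
    "\<And>x. x \<notin> {?i, ?m, ?i2} \<Longrightarrow> ?q x = 1"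
    by (simp_all only: q(1-3) minus_minus) (rule q(4), blast)
  have qiP: "1 / ?q ?i = - 1 / exp \<eta>" "1 / ?q ?i2 = - exp \<eta>" "1 / ?q ?m = 1"
    "\<And>x. x \<notin> {?i, ?m, ?i2} \<Longrightarrow> 1 / ?q x = 1"
    by (simp_all only: qi(1-3) minus_minus) (rule qi(4), blast)
  have locP: "local_int {1..d} (R_coef t n \<eta> u) (1) ?xP ?q (\<lambda>\<alpha>. 1 / ?q \<alpha>)"
    by (rule local_int_B_end[where I = "{1..d}" and pr = "dual_index t n" and X = ?xP and q = ?q and qi = "\<lambda>\<alpha>. 1 /
      ?q \<alpha>" and y = "exp (u / 2)" and Q = "exp \<eta>" and K = "exp (kappa t n * \<eta>)" and \<sigma> = "sigma t" and G =
      "G_fun t n \<eta>" and i = ?i and m = ?m and ?i2.0 = ?i2, OF _ I pr dual _ _ _ refl qP qiP sigma_cases nz G])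
      (use m D in auto)
  show ?P
    unfolding d_def
  proof (rule root_commutes[where z = "1" and z' = "1" and w = "1" and
        \<xi> = ?xP], unfold d_def[symmetric], goal_cases)
    case (7 i j)
    then consider "i = ?i" "j = ?m" | "i = ?m" "j = ?i2" by (auto split: if_splits)
    then show ?case
      by cases (simp_all only: K GG mult.assoc mult_1_left simp_thms)
  qed (rule Xe, assumption, assumption | rule ab Xc locP zz)+
  have qT: "?q ?i2 = - 1 / exp \<eta>" "?q ?i = - exp \<eta>" "?q ?m = 1"
    "\<And>x. x \<notin> {?i2, ?m, ?i} \<Longrightarrow> ?q x = 1"
    by (simp_all only: q(1-3) minus_minus) (rule q(4), blast)
  have qiT: "1 / ?q ?i2 = - exp \<eta>" "1 / ?q ?i = - 1 / exp \<eta>" "1 / ?q ?m = 1"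
    "\<And>x. x \<notin> {?i2, ?m, ?i} \<Longrightarrow> 1 / ?q x = 1"
    by (simp_all only: qi(1-3) minus_minus) (rule qi(4), blast)
  have locT: "local_int {1..d} (R_coef t n \<eta> u) (1) ?xT ?q (\<lambda>\<alpha>. 1 / ?q \<alpha>)"
    by (rule local_int_B_end_transp[where I = "{1..d}" and pr = "dual_index t n" and X = ?xT and q = ?q and qi =
      "\<lambda>\<alpha>. 1 / ?q \<alpha>" and y = "exp (u / 2)" and Q = "exp \<eta>" and K = "exp (kappa t n * \<eta>)" and
      \<sigma> = "sigma t" and G = "G_fun t n \<eta>" and i = ?i2 and m = ?m and ?i2.0 = ?i, OF _ I(3,2,1) pr(3,2,1) dual _ _ _
      refl qT qiT sigma_cases nz G])
      (use m D in auto)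
  show ?T
    unfolding d_def
  proof (rule root_commutes[where z = "1" and z' = "1" and w = "1" and
        \<xi> = ?xT], unfold d_def[symmetric], goal_cases)
    case (7 i j)
    then consider "i = ?i2" "j = ?m" | "i = ?m" "j = ?i" by (auto split: if_splits)
    then show ?case
      by cases (simp_all only: K GG mult.assoc mult_1_left simp_thms)
  qed (rule XeT, assumption, assumption | rule ab XcT locT zz)+
qed

section \<open>Cartan generators\<close>

lemma r_entry_weight_add:
  assumes "h (pr a) = - h a" "h (pr c) = - (h c :: complex)"
  shows "r_entry pr C B F V a b c e = 0 \<or> h a + h b = h c + h e"
proof -
  have "(if P1 \<and> P2 \<and> P3 then x else 0) + (if S1 \<and> S2 \<and> S3 \<and> S4 then y else 0) + (if T1 \<and> T2 then v
    else 0) = 0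
      \<or> P1 \<and> P2 \<or> S1 \<and> S2 \<or> T1 \<and> T2" for P1 P2 P3 S1 S2 S3 S4 T1 T2 and x y v :: complex
    by auto
  then have "r_entry pr C B F V a b c e = 0 \<or> a = c \<and> b = e \<or> a = e \<and> b = c \<or> b = pr a \<and> e = pr c"
    unfolding r_entry_def .
  then show ?thesis using assms by auto
qed

text \<open>With trivial Q and z = 1 the exchange relation says that R conserves the additive
  weight, so Cartan elements enter the transport theorem in the same way as root vectors.\<close>

lemma exchanges_cartan:
  fixes t n
  defines "d \<equiv> dimV t n"
  assumes h: "\<And>\<alpha>. \<alpha> \<in> {1..d} \<Longrightarrow> h (dual_index t n \<alpha>) = - h \<alpha>"
  shows "exchanges d (R_mat t n \<eta> u) 1 (mat_diag d (\<lambda>x. h (Suc x))) (mat_diag d (\<lambda>_. 1)) (mat_diag d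
    (\<lambda>_. 1))"
  unfolding exchanges_def
proof (intro allI impI)
  fix a b c e assume A: "a < d" "b < d" "c < d" "e < d"
  let ?X = "mat_diag d (\<lambda>x. h (Suc x))" and ?Q = "mat_diag d (\<lambda>_. 1 :: complex)" and ?R = "R_mat t n \<eta> u"
  have D: "mat_diag d f $$ (x, y) = (if x = y then f y else 0)" if "x < d" "y < d" for x y and f :: "nat \<Rightarrow> complex"
    using that by (simp add: mat_diag_def)
  have "(\<Sum>s<d. \<Sum>t<d. ?R $$ (a * d + b, s * d + t) * (1 * ?X $$ (s, c) * ?Q $$ (t, e) + ?Q $$ (s, c) * ?X $$ (t, e)))
     = (\<Sum>s<d. \<Sum>t<d. if t = e then if s = c then ?R $$ (a * d + b, c * d + e) * (h (Suc c) + h (Suc e)) else 0 else 0)"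
    using A by (intro sum.cong refl) (auto simp: D)
  also have "\<dots> = ?R $$ (a * d + b, c * d + e) * (h (Suc c) + h (Suc e))"
    using A by simp
  also have "\<dots> = (h (Suc a) + h (Suc b)) * ?R $$ (a * d + b, c * d + e)"
  proof -
    have "?R $$ (a * d + b, c * d + e) = 0 \<or> h (Suc a) + h (Suc b) = h (Suc c) + h (Suc e)"
      unfolding R_mat_entry[OF A[unfolded d_def], folded d_def]
      by (rule r_entry_weight_add; rule h) (use A in auto)
    then show ?thesis by (metis mult.commute mult_zero_left)
  qed
  also have "\<dots> = (\<Sum>s<d. \<Sum>t<d. if t = b then if s = a then (h (Suc a) + h (Suc b)) * ?R $$ (a * d + b, c * d + e)
    else 0 else 0)"
    using A by simp
  also have "\<dots> = (\<Sum>s<d. \<Sum>t<d. (1 * ?X $$ (a, s) * ?Q $$ (b, t) + ?Q $$ (a, s) * ?X $$ (b, t)) * ?R $$ (s * d + t,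
    c * d + e))"
    using A by (intro sum.cong refl) (auto simp: D)
  finally show "(\<Sum>s<d. \<Sum>t<d. ?R $$ (a * d + b, s * d + t) * (1 * ?X $$ (s, c) * ?Q $$ (t, e) + ?Q $$ (s, c) * ?X $$ (t,
    e)))
     = (\<Sum>s<d. \<Sum>t<d. (1 * ?X $$ (a, s) * ?Q $$ (b, t) + ?Q $$ (a, s) * ?X $$ (b, t)) * ?R $$ (s * d + t, c * d + e))" .
qed

lemma cartan_commutes:
  fixes t n
  defines "d \<equiv> dimV t n"
  assumes d: "d > 0" and h: "\<And>\<alpha>. \<alpha> \<in> {1..d} \<Longrightarrow> h (dual_index t n \<alpha>) = - h \<alpha>"
  shows "commutator (coprod_H d N (mat_diag d (\<lambda>x. h (Suc x)))) (transfer_mat t n \<eta> \<gamma>0 p N u) = 0\<^sub>m (d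
    ^ N) (d ^ N)"
proof -
  let ?X = "mat_diag d (\<lambda>x. h (Suc x))" and ?Q = "mat_diag d (\<lambda>_. 1 :: complex)" and ?R = "R_mat t n \<eta> u"
  let ?kr = "\<lambda>x. KR_entry t n \<eta> \<gamma>0 p u (Suc x)"
  let ?kl = "\<lambda>x. KR_entry t n \<eta> \<gamma>0 p (- u - rho t n \<eta>) (Suc x) * (M_const t n \<eta> / (G_fun t n \<eta>
    (Suc x))^2)"
  have KL: "KL_mat t n \<eta> \<gamma>0 p u = mat_diag d ?kl"
    unfolding KL_mat_def KR_mat_diag M_mat_diag mat_diag_diag by (simp add: d_def)
  have KR: "KR_mat t n \<eta> \<gamma>0 p u = mat_diag d ?kr"
    unfolding KR_mat_diag by (simp add: d_def)
  have D: "mat_diag d f $$ (x, y) = (if x = y then f y else 0)" if "x < d" "y < d" for x y and f :: "nat \<Rightarrow> complex"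
    using that by (simp add: mat_diag_def)
  have com: "commutes2 d ?R ?Q"
    unfolding d_def by (rule commutes2_R_mat[where q = "\<lambda>_. 1"]) simp
  have "commutator (coprod_sum d N ?X ?Q ?Q) (transfer_mat t n \<eta> \<gamma>0 p N u) = 0\<^sub>m (d ^ N) (d ^ N)"
  proof (rule coprod_commutes_double_row_trace[where z = 1 and z' = 1 and q = "\<lambda>_. 1" and qi = "\<lambda>_. 1" and R = ?R
        and kr = ?kr and kl = ?kl, OF d mat_diag_dim _ _ refl refl _ com com _ _ refl refl])
    show "exchanges d ?R 1 ?X ?Q ?Q" unfolding d_def by (rule exchanges_cartan) (use h in \<open>simp add: d_def\<close>)
    show "transfer_mat t n \<eta> \<gamma>0 p N u = partial_trace d (d ^ N)
      ((mat_diag d ?kl \<otimes>\<^sub>m 1\<^sub>m (d ^ N)) *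
       mat_prod (d ^ (N + 1)) (map (\<lambda>k. act_on d (N + 1) ?R 0 k) (rev [1..<N + 1])) *
       (mat_diag d ?kr \<otimes>\<^sub>m 1\<^sub>m (d ^ N)) *
       mat_prod (d ^ (N + 1)) (map (\<lambda>k. act_on d (N + 1) ?R k 0) [1..<N + 1]))"
      unfolding transfer_mat_def Let_def T_mat_def That_mat_def KL KR d_def ..
  qed (auto simp: D)
  moreover have "?Q = 1\<^sub>m d" by simp
  ultimately show ?thesis by (simp only: coprod_H_def coprod_sum_def)
qed

section \<open>The diagonals of Q and the assembly of the two quantum groups\<close>

lemma exp_shift_pi: "exp (\<eta> + \<i> * of_real pi) = - exp \<eta>" "exp (- (\<eta> + \<i> * of_real pi)) = - 1 / exp \<eta>"
proof -
  have "exp (\<i> * of_real pi) = - 1" by (simp add: exp_eq_polar)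
  then show "exp (\<eta> + \<i> * of_real pi) = - exp \<eta>" by (simp add: exp_add)
  then show "exp (- (\<eta> + \<i> * of_real pi)) = - 1 / exp \<eta>"
    unfolding exp_minus[of "\<eta> + \<i> * of_real pi"] by (simp add: inverse_eq_divide)
qed

text \<open>All exponents are brought to the two-term form of \<open>q_diag\<close>; where Q
  contains one Cartan element, the second coefficient is 0.\<close>

lemma Q_left_diag:
  fixes \<eta> :: complex
  defines "\<theta> \<equiv> \<eta> + \<i> * of_real pi"
  shows "j < n - p \<Longrightarrow> Q_left t n \<eta> p j = q_diag (dimV t n) \<theta> (p + j) (- \<eta>) (p + j + 1)"
    "left_series t = Series_B \<Longrightarrow> j = n - p \<Longrightarrow> Q_left t n \<eta> p j = q_diag (dimV t n) \<theta> (p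
      + j) 0 (p + j)"
    "left_series t = Series_C \<Longrightarrow> j = n - p \<Longrightarrow> Q_left t n \<eta> p j = q_diag (dimV t n) (2 *
      \<eta>) (p + j) 0 (p + j)"
    "left_series t = Series_D \<Longrightarrow> j = n - p \<Longrightarrow> Q_left t n \<eta> p j = q_diag (dimV t n) \<eta> (p +
      (j - 1)) \<theta> (p + j)"
  by (simp_all add: Q_left_def Let_def H_left_def H_gen_diag mat_diag_arith mat_exp_diag flip: \<theta>_def)

text \<open>Right Cartan elements are negatives with reversed numbering, so the coefficients change
  sign and the indices run backwards towards the affine node.\<close>

lemma Q_right_diag:
  fixes \<eta> :: complex
  defines "\<theta> \<equiv> \<eta> + \<i> * of_real pi"
  shows "j < p \<Longrightarrow> Q_right t n \<eta> p j = q_diag (dimV t n) \<eta> (p - j) (- \<theta>) (p + 1 - j)"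
    "right_series t = Series_C \<Longrightarrow> j = p \<Longrightarrow> Q_right t n \<eta> p j = q_diag (dimV t n) (- (2 *
      \<eta>)) (p + 1 - j) 0 (p + 1 - j)"
    "right_series t = Series_D \<Longrightarrow> j = p \<Longrightarrow> Q_right t n \<eta> p j = q_diag (dimV t n) (- \<theta>)
      (p + 1 - (j - 1)) (- \<eta>) (p + 1 - j)"
  by (simp_all add: Q_right_def Let_def H_right_def H_gen_diag mat_diag_arith mat_exp_diag flip: \<theta>_def)

lemma left_generator_commutes:
  fixes t n
  defines "d \<equiv> dimV t n"
  assumes "p \<le> n" "t = D1 \<Longrightarrow> p \<noteq> n - 1" and i: "i \<in> {1..n - p}"
  shows "commutator (coprod_E d N (Q_left t n \<eta> p i) (Eplus_left t n p i)) (transfer_mat t n \<eta> \<gamma>0 p N u) =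
    0\<^sub>m (d ^ N) (d ^ N)"
    "commutator (coprod_E d N (Q_left t n \<eta> p i) (Eminus_left t n p i)) (transfer_mat t n \<eta> \<gamma>0 p N u) =
      0\<^sub>m (d ^ N) (d ^ N)"
proof -
  have "commutator (coprod_E d N (Q_left t n \<eta> p i) (E_gen t n (p + i))) (transfer_mat t n \<eta> \<gamma>0 p N u) =
    0\<^sub>m (d ^ N) (d ^ N) \<and>
    commutator (coprod_E d N (Q_left t n \<eta> p i) (transpose_mat (E_gen t n (p + i)))) (transfer_mat t n \<eta> \<gamma>0 p N
      u) = 0\<^sub>m (d ^ N) (d ^ N)"
  proof (cases "i < n - p")
    case True
    \<comment> \<open>The imaginary shift sits on the first of the two Cartan weights, which selects
      \<tau> = - 1; for interior right generators it sits on the second and \<tau> is 1.\<close>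
    show ?thesis unfolding Q_left_diag(1)[OF True] d_def
      by (intro conjI root_bulk[where \<tau> = "- 1"]) (use True i in \<open>auto simp: exp_shift_pi exp_minus
        inverse_eq_divide\<close>)
  next
    case False
    then have i': "i = n - p" "p + i = n" "p < n" using i \<open>p \<le> n\<close> by auto
    consider "left_series t = Series_B" "t \<in> {A2_even, B1}" | "left_series t = Series_C" "t \<in> {A2_odd, C1}"
      | "left_series t = Series_D" "t = D1" by (cases t) auto
    then show ?thesis
    proof cases
      case 1
      show ?thesis unfolding Q_left_diag(2)[OF 1(1) i'(1)] i'(2) d_def
        by (intro conjI root_B_end[OF 1(2) i'(3)]) (rule exp_shift_pi)+
    next
      case 2
      show ?thesis unfolding Q_left_diag(3)[OF 2(1) i'(1)] i'(2) d_def
        by (intro conjI root_C_end[OF 2(2) i'(3)]) (rule exp_double)+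
    next
      case 3
      \<comment> \<open>The existence of a left generator gives p < n, and the excluded value n - 1
        then leaves p + 2 \<le> n.\<close>
      then have p: "p + 2 \<le> n" "p + (i - 1) = n - 1" using assms(3) i' by auto
      show ?thesis unfolding Q_left_diag(4)[OF 3(1) i'(1)] i'(2) p(2) d_def
        by (intro conjI root_D_end[OF 3(2) p(1), where \<tau> = 1]) (simp_all add: exp_shift_pi)
    qed
  qed
  then show "commutator (coprod_E d N (Q_left t n \<eta> p i) (Eplus_left t n p i)) (transfer_mat t n \<eta> \<gamma>0 p N u) =
    0\<^sub>m (d ^ N) (d ^ N)"
    "commutator (coprod_E d N (Q_left t n \<eta> p i) (Eminus_left t n p i)) (transfer_mat t n \<eta> \<gamma>0 p N u) =
      0\<^sub>m (d ^ N) (d ^ N)"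
    by (simp_all add: Eplus_left_def Eminus_left_def)
qed

lemma right_generator_commutes:
  fixes t n
  defines "d \<equiv> dimV t n"
  assumes "p \<le> n" "t \<in> {A2_odd, B1, D1} \<Longrightarrow> p \<noteq> 1" and i: "i \<in> {1..p}"
  shows "commutator (coprod_E d N (Q_right t n \<eta> p i) (Eplus_right t n p i)) (transfer_mat t n \<eta> \<gamma>0 p N u) =
    0\<^sub>m (d ^ N) (d ^ N)"
    "commutator (coprod_E d N (Q_right t n \<eta> p i) (Eminus_right t n p i)) (transfer_mat t n \<eta> \<gamma>0 p N u) =
      0\<^sub>m (d ^ N) (d ^ N)"
proof -
  have "commutator (coprod_E d N (Q_right t n \<eta> p i) (E_gen t n (p - i))) (transfer_mat t n \<eta> \<gamma>0 p N u) =
    0\<^sub>m (d ^ N) (d ^ N) \<and>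
    commutator (coprod_E d N (Q_right t n \<eta> p i) (transpose_mat (E_gen t n (p - i)))) (transfer_mat t n \<eta> \<gamma>0 p N
      u) = 0\<^sub>m (d ^ N) (d ^ N)"
  proof (cases "i < p")
    case True
    then have e: "p + 1 - i = p - i + 1" by simp
    show ?thesis unfolding Q_right_diag(1)[OF True] e d_def
      by (intro conjI root_bulk[where \<tau> = 1]) (use True i \<open>p \<le> n\<close> in \<open>auto simp:
        exp_shift_pi[simplified]\<close>)
  next
    case False
    then have i': "i = p" "p - i = 0" "p + 1 - i = 1" "1 \<le> p" using i by auto
    consider "right_series t = Series_C" "t \<in> {A2_even, C1}" | "right_series t = Series_D" "t \<in> {A2_odd, B1, D1}"
      by (cases t) auto
    then show ?thesis
    proof cases
      case 1
      show ?thesis unfolding Q_right_diag(2)[OF 1(1) i'(1)] i'(2,3) d_def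
        by (intro conjI root_C_affine[OF 1(2) i'(4) \<open>p \<le> n\<close>]) (simp_all add: exp_minus exp_double
          inverse_eq_divide)
    next
      case 2
      \<comment> \<open>p is positive because i is, and 1 is excluded for these types. The exponent
        - \<theta> at index 2 is what selects \<tau> = - 1 below.\<close>
      then have p: "2 \<le> p" "p + 1 - (i - 1) = 2" using assms(3) i' by auto
      show ?thesis unfolding Q_right_diag(3)[OF 2(1) i'(1)] i'(2,3) p(2) d_def
        by (intro conjI root_D_affine[OF 2(2) p(1) \<open>p \<le> n\<close>, where \<tau> = "- 1"])
          (simp_all only: exp_shift_pi, simp_all add: exp_minus inverse_eq_divide)
    qed
  qed
  then show "commutator (coprod_E d N (Q_right t n \<eta> p i) (Eplus_right t n p i)) (transfer_mat t n \<eta> \<gamma>0 p N u) =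
    0\<^sub>m (d ^ N) (d ^ N)"
    "commutator (coprod_E d N (Q_right t n \<eta> p i) (Eminus_right t n p i)) (transfer_mat t n \<eta> \<gamma>0 p N u) =
      0\<^sub>m (d ^ N) (d ^ N)"
    by (simp_all add: Eplus_right_def Eminus_right_def)
qed

theorem mainTheorem1:
  fixes t :: affine_type and n p N :: nat and \<eta> \<gamma>0 u :: complex
  assumes "n \<ge> 1" and "p \<le> n" and "N \<ge> 1"
    and "t = A2_odd \<Longrightarrow> p \<noteq> 1"
    and "t = B1 \<Longrightarrow> n > 1 \<and> p \<noteq> 1"
    and "t = D1 \<Longrightarrow> n > 1 \<and> p \<noteq> 1 \<and> p \<noteq> n - 1"
    and "\<gamma>0 \<in> {1, - 1}"
    \<comment> \<open>\<open>u\<close> is not a zero of a denominator occurring in the entries of \<open>K\<^sup>R(u,p)\<close> or \<open>K\<^sup>L(u,p)\<close>\<close>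
    and "2 * p < dimV t n \<Longrightarrow>
           gam t n \<eta> \<gamma>0 p + exp u \<noteq> 0 \<and> gam t n \<eta> \<gamma>0 p + exp (- u - rho t n \<eta>) \<noteq> 0"
  shows "(\<forall>i\<in>{1..n - p}.
            commutator (coprod_H (dimV t n) N (H_left t n p i))
              (transfer_mat t n \<eta> \<gamma>0 p N u) = 0\<^sub>m (dimV t n ^ N) (dimV t n ^ N) \<and>
            commutator (coprod_E (dimV t n) N (Q_left t n \<eta> p i) (Eplus_left t n p i))
              (transfer_mat t n \<eta> \<gamma>0 p N u) = 0\<^sub>m (dimV t n ^ N) (dimV t n ^ N) \<and>
            commutator (coprod_E (dimV t n) N (Q_left t n \<eta> p i) (Eminus_left t n p i))
              (transfer_mat t n \<eta> \<gamma>0 p N u) = 0\<^sub>m (dimV t n ^ N) (dimV t n ^ N)) \<and>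
         (\<forall>i\<in>{1..p}.
            commutator (coprod_H (dimV t n) N (H_right t n p i))
              (transfer_mat t n \<eta> \<gamma>0 p N u) = 0\<^sub>m (dimV t n ^ N) (dimV t n ^ N) \<and>
            commutator (coprod_E (dimV t n) N (Q_right t n \<eta> p i) (Eplus_right t n p i))
              (transfer_mat t n \<eta> \<gamma>0 p N u) = 0\<^sub>m (dimV t n ^ N) (dimV t n ^ N) \<and>
            commutator (coprod_E (dimV t n) N (Q_right t n \<eta> p i) (Eminus_right t n p i))
              (transfer_mat t n \<eta> \<gamma>0 p N u) = 0\<^sub>m (dimV t n ^ N) (dimV t n ^ N))"
proof -
  have d: "dimV t n > 0" using assms(1) by (simp add: dimV_def)
  have D: "dimV t n = 2 * n \<or> dimV t n = 2 * n + 1" by (rule dimV_cases)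
  have H: "commutator (coprod_H (dimV t n) N (H_left t n p i)) (transfer_mat t n \<eta> \<gamma>0 p N u)
      = 0\<^sub>m (dimV t n ^ N) (dimV t n ^ N)" if "i \<in> {1..n - p}" for i
    unfolding H_left_def H_gen_diag
    by (rule cartan_commutes[OF d], rule cartan_weight_dual) (use that D assms(2) in auto)
  have H': "commutator (coprod_H (dimV t n) N (H_right t n p i)) (transfer_mat t n \<eta> \<gamma>0 p N u)
      = 0\<^sub>m (dimV t n ^ N) (dimV t n ^ N)" if "i \<in> {1..p}" for i
    unfolding H_right_def H_gen_diag mat_diag_arith
    by (rule cartan_commutes[OF d], rule arg_cong[where f = uminus], rule cartan_weight_dual) (use that D assms(2) in auto)
  have p: "t \<in> {A2_odd, B1, D1} \<Longrightarrow> p \<noteq> 1" using assms(4-6) by auto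
  show ?thesis
    by (intro conjI ballI H H' left_generator_commutes right_generator_commutes) (use assms(2,6) p in auto)
qed

end
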